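(* Let $\Omega\subset\mathbb{R}^n$, $n\ge 2$, be a bounded domain, let $T>0$, and let $2\le p\le n$. Put $\Omega_T=\Omega\times(0,T)$ and $P_T=(\Omega\times\{0\})\cup(\partial\Omega\times[0,T))$. Let $h\in C(P_T,\mathbb{R}^+)$ with $\inf_{P_T}h>0$. If $\Omega$ satisfies a uniform outer ball condition, then the problem $$\Delta_p u=(p-1)u^{p-2}u_t\ \text{ in }\Omega_T,\qquad u(x,t)=h(x,t)\ \ \forall (x,t)\in P_T,$$ has a unique positive viscosity solution $u$ that is continuous on $\Omega_T\cup P_T$.
   Context: $\mathbb{R}^+=(0,\infty)$. $B_\rho(z)$ denotes the open ball of radius $\rho$ centred at $z$. $\Omega$ satisfies a uniform outer ball condition if there is $\rho_0>0$ such that for each $y\in\partial\Omega$ and each $0<\rho\le\rho_0$ there is $z\in\mathbb{R}^n\setminus\Omega$ with $B_\rho(z)\subset\mathbb{R}^n\setminus\Omega$ and $y\in\partial B_\rho(z)\cap\partial\Omega$. $\Delta_p\psi=\operatorname{div}(|D\psi|^{p-2}D\psi)$ is the $p$-Laplacian in the $x$-variables ($D$ is the gradient in $x$); for a function $\psi$ that is $C^2$ in $x$ it means $|D\psi|^{p-2}\operatorname{tr}(D^2\psi)+(p-2)|D\psi|^{p-4}\sum_{i,j}\psi_{x_i}\psi_{x_j}\psi_{x_ix_j}$ where $D\psi\neq0$, and, where $D\psi=0$, it means $0$ if $p\ne2$ and $\operatorname{tr}(D^2\psi)$ if $p=2$. A test function is a function $\psi$ on $\Omega_T$ that is $C^2$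 in $x$ and $C^1$ in $t$. For a function $u>0$ on $\Omega_T$: $u$ is a (viscosity) sub-solution of the equation, i.e. $\Delta_pu-(p-1)u^{p-2}u_t\ge0$ in $\Omega_T$, if $u$ is upper semicontinuous on $\Omega_T$ and for every test function $\psi$ and $(y,s)\in\Omega_T$ such that $u-\psi$ has a local maximum at $(y,s)$, $\Delta_p\psi(y,s)-(p-1)u(y,s)^{p-2}\psi_t(y,s)\ge0$. It is a (viscosity) super-solution, i.e. $\Delta_pu-(p-1)u^{p-2}u_t\le0$, if $u$ is lower semicontinuous on $\Omega_T$ and $\Delta_p\psi(y,s)-(p-1)u(y,s)^{p-2}\psi_t(y,s)\le0$ whenever $u-\psi$ has a local minimum at $(y,s)\in\Omega_T$. A positive viscosity solution of the problem is a function $u>0$, continuous on $\Omega_T\cup P_T=\overline\Omega\times[0,T)$, which is both a sub-solution and a super-solution of the equation in $\Omega_T$ and satisfies $u=h$ on $P_T$. *)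

theory Defs
  imports "HOL-Analysis.Analysis"
begin

text \<open>Points of space-time are pairs \<open>(x, t)\<close> with \<open>x :: real ^ 'n\<close> and \<open>t :: real\<close>. Functions are total;
  only their values on the indicated subset of space-time are ever used.\<close>

definition cylinder :: "(real ^ 'n) set \<Rightarrow> real \<Rightarrow> ((real ^ 'n) \<times> real) set"
  where "cylinder \<Omega> T = \<Omega> \<times> {0<..<T}"

definition parabolic_boundary :: "(real ^ 'n) set \<Rightarrow> real \<Rightarrow> ((real ^ 'n) \<times> real) set"
  where "parabolic_boundary \<Omega> T = (\<Omega> \<times> {0}) \<union> (frontier \<Omega> \<times> {0..<T})"

definition uniform_outer_ball :: "(real ^ 'n) set \<Rightarrow> bool"
  where "uniform_outer_ball \<Omega> \<longleftrightarrow>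
    (\<exists>\<rho>0>0. \<forall>y\<in>frontier \<Omega>. \<forall>\<rho>. 0 < \<rho> \<and> \<rho> \<le> \<rho>0 \<longrightarrow>
      (\<exists>z\<in>- \<Omega>. ball z \<rho> \<subseteq> - \<Omega> \<and> y \<in> frontier (ball z \<rho>) \<inter> frontier \<Omega>))"

definition space_grad :: "((real ^ 'n) \<times> real \<Rightarrow> real) \<Rightarrow> (real ^ 'n) \<times> real \<Rightarrow> real ^ 'n"
  where "space_grad \<psi> = (\<lambda>(x, t). \<chi> i. frechet_derivative (\<lambda>y. \<psi> (y, t)) (at x) (axis i 1))"

definition space_hess :: "((real ^ 'n) \<times> real \<Rightarrow> real) \<Rightarrow> (real ^ 'n) \<times> real \<Rightarrow> real ^ 'n ^ 'n"
  where "space_hess \<psi> = (\<lambda>(x, t). jacobian (\<lambda>y. space_grad \<psi> (y, t)) (at x))"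

definition time_deriv :: "((real ^ 'n) \<times> real \<Rightarrow> real) \<Rightarrow> (real ^ 'n) \<times> real \<Rightarrow> real"
  where "time_deriv \<psi> = (\<lambda>(x, t). deriv (\<lambda>s. \<psi> (x, s)) t)"

text \<open>\<open>C\<^sup>2\<close> in \<open>x\<close> and \<open>C\<^sup>1\<close> in \<open>t\<close>: the derivatives exist and are jointly continuous in \<open>(x, t)\<close>.
  The set \<open>Q\<close> is meant to be open, so the derivatives depend only on \<open>\<psi>\<close> on \<open>Q\<close>.\<close>

definition test_function :: "((real ^ 'n) \<times> real) set \<Rightarrow> ((real ^ 'n) \<times> real \<Rightarrow> real) \<Rightarrow> bool"
  where "test_function Q \<psi> \<longleftrightarrow>
    (\<forall>(x, t)\<in>Q. (\<lambda>y. \<psi> (y, t)) differentiable (at x)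
              \<and> (\<lambda>y. space_grad \<psi> (y, t)) differentiable (at x)
              \<and> (\<lambda>s. \<psi> (x, s)) differentiable (at t))
    \<and> continuous_on Q \<psi> \<and> continuous_on Q (space_grad \<psi>)
    \<and> continuous_on Q (space_hess \<psi>) \<and> continuous_on Q (time_deriv \<psi>)"

definition p_laplacian :: "real \<Rightarrow> ((real ^ 'n) \<times> real \<Rightarrow> real) \<Rightarrow> (real ^ 'n) \<times> real \<Rightarrow> real"
  where "p_laplacian p \<psi> z =
    (let g = space_grad \<psi> z; H = space_hess \<psi> z in
      if g \<noteq> 0 then
        norm g powr (p - 2) * trace H
        + (p - 2) * norm g powr (p - 4) * (\<Sum>i\<in>UNIV. \<Sum>j\<in>UNIV. g $ i * g $ j * H $ i $ j)
      else if p = 2 then trace H else 0)"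

definition upper_semicont_on :: "'a::topological_space set \<Rightarrow> ('a \<Rightarrow> real) \<Rightarrow> bool"
  where "upper_semicont_on S u \<longleftrightarrow>
    (\<forall>z\<in>S. \<forall>c>u z. eventually (\<lambda>w. u w < c) (at z within S))"

definition lower_semicont_on :: "'a::topological_space set \<Rightarrow> ('a \<Rightarrow> real) \<Rightarrow> bool"
  where "lower_semicont_on S u \<longleftrightarrow>
    (\<forall>z\<in>S. \<forall>c<u z. eventually (\<lambda>w. c < u w) (at z within S))"

definition local_max_at :: "'a::topological_space set \<Rightarrow> ('a \<Rightarrow> real) \<Rightarrow> 'a \<Rightarrow> bool"
  where "local_max_at S f z \<longleftrightarrow> z \<in> S \<and> eventually (\<lambda>w. f w \<le> f z) (at z within S)"

definition local_min_at :: "'a::topological_space set \<Rightarrow> ('a \<Rightarrow> real) \<Rightarrow> 'a \<Rightarrow> bool"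
  where "local_min_at S f z \<longleftrightarrow> z \<in> S \<and> eventually (\<lambda>w. f z \<le> f w) (at z within S)"

definition viscosity_subsolution ::
  "real \<Rightarrow> ((real ^ 'n) \<times> real) set \<Rightarrow> ((real ^ 'n) \<times> real \<Rightarrow> real) \<Rightarrow> bool"
  where "viscosity_subsolution p Q u \<longleftrightarrow>
    (\<forall>z\<in>Q. 0 < u z) \<and> upper_semicont_on Q u \<and>
    (\<forall>\<psi> z. test_function Q \<psi> \<and> local_max_at Q (\<lambda>w. u w - \<psi> w) z \<longrightarrow>
      p_laplacian p \<psi> z - (p - 1) * u z powr (p - 2) * time_deriv \<psi> z \<ge> 0)"

definition viscosity_supersolution ::
  "real \<Rightarrow> ((real ^ 'n) \<times> real) set \<Rightarrow> ((real ^ 'n) \<times> real \<Rightarrow> real) \<Rightarrow> bool"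
  where "viscosity_supersolution p Q u \<longleftrightarrow>
    (\<forall>z\<in>Q. 0 < u z) \<and> lower_semicont_on Q u \<and>
    (\<forall>\<psi> z. test_function Q \<psi> \<and> local_min_at Q (\<lambda>w. u w - \<psi> w) z \<longrightarrow>
      p_laplacian p \<psi> z - (p - 1) * u z powr (p - 2) * time_deriv \<psi> z \<le> 0)"

definition positive_viscosity_solution ::
  "real \<Rightarrow> (real ^ 'n) set \<Rightarrow> real \<Rightarrow> ((real ^ 'n) \<times> real \<Rightarrow> real)
    \<Rightarrow> ((real ^ 'n) \<times> real \<Rightarrow> real) \<Rightarrow> bool"
  where "positive_viscosity_solution p \<Omega> T h u \<longleftrightarrow>
    (\<forall>z\<in>cylinder \<Omega> T \<union> parabolic_boundary \<Omega> T. 0 < u z)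
    \<and> continuous_on (cylinder \<Omega> T \<union> parabolic_boundary \<Omega> T) u
    \<and> viscosity_subsolution p (cylinder \<Omega> T) u
    \<and> viscosity_supersolution p (cylinder \<Omega> T) u
    \<and> (\<forall>z\<in>parabolic_boundary \<Omega> T. u z = h z)"

end

(*
  For v = ln u the equation becomes (p - 1) v_t = Delta_p v + (p - 1) |Dv|^p, which depends on
  neither x nor v; existence then follows from the comparison principle by Perron's method, with
  barriers built from the outer balls.

  The comparison principle avoids the Jensen-Ishii lemma and Alexandrov's theorem. After
  sup-convolution, a subsolution S1 and (the negative of) a supersolution S2 are semiconvex. At a
  maximum of S1 + S2 both lie within c |h|^2 / 2 of affine functions with opposite gradients, so
  every test function touching one of them nearby has almost that gradient and a Hessian bounded
  below. The equation may therefore be replaced by one with constant coefficients, and the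
  comparison for that one uses only polynomial solutions of the Dirichlet problem in a ball.
*)
theory Submission
  imports Defs "HOL-Library.Function_Algebras"
begin

section \<open>Constant-coefficient comparison by harmonic polynomials\<close>

text \<open>The obstacle is that the coefficients degenerate with the gradient, while test Hessians
  are bounded from one side only: a small error in the coefficients times a huge Hessian is not
  small. The constant multiples of \<open>\<omega>\<close> are paid from a surplus
  \<open>\<kappa>\<close>. It exists because the equation for the logarithm does not contain the
  unknown itself: subtracting an increasing function of time makes a subsolution strict. That the
  equation does not contain \<open>(x, t)\<close> either allows a test function to be translated
  from a point of the sup-convolution to its contact point. In the sum of the two frozen
  inequalities the gradient power and the time derivative cancel, because the two gradients are
  opposite, and only the linear second-order part remains. Nothing is uniform up to time
  \<open>T\<close>, since \<open>h\<close> may be unbounded there; bounds and comparison are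
  therefore obtained up to each earlier time.\<close>

lemma (in vector_space) injective_on_span_imp_surjective:
  assumes "finite B" and TV: "\<And>f. f \<in> span B \<Longrightarrow> T f \<in> span B"
    and add: "\<And>f g. f \<in> span B \<Longrightarrow> g \<in> span B \<Longrightarrow> T (f + g) = T f + T g"
    and scl: "\<And>c f. f \<in> span B \<Longrightarrow> T (scale c f) = scale c (T f)"
    and ker: "\<And>f. f \<in> span B \<Longrightarrow> T f = 0 \<Longrightarrow> f = 0"
    and "y \<in> span B"
  shows "\<exists>f\<in>span B. T f = y"
proof (rule ccontr)
  assume no: "\<not> ?thesis"
  obtain C where C: "C \<subseteq> span B" "independent C" "span B \<subseteq> span C"
    using maximal_independent_subset[of "span B"] by metis
  have finC: "finite C" using independent_span_bound[OF \<open>finite B\<close> C(2,1)] by simp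
  have T0: "T 0 = 0" using scl[of 0 0] span_zero by simp
  have Tsum: "T (\<Sum>b\<in>F. scale (u b) b) = (\<Sum>b\<in>F. scale (u b) (T b))" if "F \<subseteq> C" for u F
    using finite_subset[OF that finC] that
  proof (induction F rule: finite_induct)
    case (insert x F)
    have x: "x \<in> span B" and s: "(\<Sum>b\<in>F. scale (u b) b) \<in> span B"
      using insert.prems C(1) by (auto intro!: span_sum span_scale)
    then show ?case using insert by (simp add: add scl span_scale)
  qed (simp add: T0)
  have zero: "u b = 0" if "(\<Sum>b\<in>C. scale (u b) (T b)) = 0" "b \<in> C" for u b
  proof -
    have "(\<Sum>b\<in>C. scale (u b) b) \<in> span B"
      using C(1) by (intro span_sum span_scale) auto
    then have "(\<Sum>b\<in>C. scale (u b) b) = 0"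
      using ker Tsum[of C u] that by simp
    then show ?thesis using C(2) that(2) unfolding dependent_finite[OF finC] by auto
  qed
  have inj: "inj_on T C"
  proof (rule inj_onI, rule ccontr)
    fix a b assume ab: "a \<in> C" "b \<in> C" "T a = T b" "a \<noteq> b"
    define u :: "'b \<Rightarrow> 'a" where "u x = (if x = a then 1 else if x = b then - 1 else 0)" for x
    have "(\<Sum>x\<in>C. scale (u x) (T x)) = (\<Sum>x\<in>{a,b}. scale (u x) (T x))"
      using ab finC by (intro sum.mono_neutral_right) (auto simp: u_def)
    also have "\<dots> = 0" using ab by (simp add: u_def)
    finally have "u a = 0" using zero ab by blast
    then show False by (simp add: u_def)
  qed
  have ind: "independent (T ` C)"
  proof
    assume "dependent (T ` C)"
    then obtain u where u: "\<exists>v\<in>T ` C. u v \<noteq> 0" "(\<Sum>v\<in>T ` C. scale (u v) v) = 0"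
      using dependent_finite[OF finite_imageI[OF finC]] by auto
    have "(\<Sum>b\<in>C. scale (u (T b)) (T b)) = 0" using u(2) by (simp add: sum.reindex[OF inj])
    then show False using u(1) zero[of "\<lambda>b. u (T b)"] by auto
  qed
  \<comment> \<open>If \<open>y\<close> is not attained, the images of the basis \<open>C\<close>
    together with \<open>y\<close> are independent, and they are one vector too many for
    \<open>span C\<close>.\<close>
  have "y \<notin> span (T ` C)"
  proof
    assume "y \<in> span (T ` C)"
    then obtain u where "y = (\<Sum>v\<in>T ` C. scale (u v) v)"
      using span_finite[of "T ` C"] finC by auto
    also have "\<dots> = T (\<Sum>b\<in>C. scale (u (T b)) b)"
      using Tsum[of C "\<lambda>b. u (T b)"] by (simp add: sum.reindex[OF inj])
    finally have "y = T (\<Sum>b\<in>C. scale (u (T b)) b)" .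
    moreover have "(\<Sum>b\<in>C. scale (u (T b)) b) \<in> span B"
      using C(1) by (intro span_sum span_scale) auto
    ultimately show False using no by blast
  qed
  then have "independent (insert y (T ` C))" "y \<notin> T ` C"
    using ind independent_insertI span_base by auto
  moreover have "insert y (T ` C) \<subseteq> span C" using C TV \<open>y \<in> span B\<close> by blast
  ultimately have "card (insert y (T ` C)) \<le> card C"
    using independent_span_bound[OF finC] by blast
  moreover have "card (insert y (T ` C)) = Suc (card C)"
    using \<open>y \<notin> T ` C\<close> finC card_image[OF inj] by simp
  ultimately show False by simp
qed

text \<open>The degree bound is part of the predicate, because the Dirichlet problem below is solved
  by linear algebra in the finite-dimensional space of polynomials of degree at most
  \<open>d\<close>.\<close>

inductive polyd :: "nat \<Rightarrow> ('a::euclidean_space \<Rightarrow> real) \<Rightarrow> bool" where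
  const: "polyd d (\<lambda>_. c)"
| coord: "polyd d f \<Longrightarrow> b \<in> Basis \<Longrightarrow> polyd (Suc d) (\<lambda>z. (z \<bullet> b) * f z)"
| add: "polyd d f \<Longrightarrow> polyd d g \<Longrightarrow> polyd d (\<lambda>z. f z + g z)"

lemma polyd_Suc: "polyd d f \<Longrightarrow> polyd (Suc d) f"
  by (induction rule: polyd.induct) (auto intro: polyd.intros)

lemma polyd_mono: "polyd d f \<Longrightarrow> d \<le> e \<Longrightarrow> polyd e f"
  by (induction e) (auto simp: le_Suc_eq intro: polyd_Suc)

lemma polyd_cmult: "polyd d f \<Longrightarrow> polyd d (\<lambda>z. c * f z)"
proof (induction rule: polyd.induct)
  case (coord d f b)
  then show ?case using polyd.coord[OF coord.IH coord.hyps(2)] by (simp add: mult.left_commute)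
qed (auto intro: polyd.intros simp: distrib_left)

lemma polyd_diff: "polyd d f \<Longrightarrow> polyd d g \<Longrightarrow> polyd d (\<lambda>z. f z - g z)"
  using polyd.add[OF _ polyd_cmult[of d g "-1"]] by simp

lemma polyd_sum: "(\<And>i. i \<in> I \<Longrightarrow> polyd d (f i)) \<Longrightarrow> polyd d (\<lambda>z. \<Sum>i\<in>I. f i z)"
  by (induction I rule: infinite_finite_induct) (auto intro: polyd.intros)

lemma polyd_mult: "polyd d f \<Longrightarrow> polyd e g \<Longrightarrow> polyd (d + e) (\<lambda>z. f z * g z)"
proof (induction rule: polyd.induct)
  case (const d c)
  then show ?case using polyd_mono[OF polyd_cmult] by (metis le_add2)
next
  case (coord d f b)
  then show ?case using polyd.coord[OF coord.IH[OF coord.prems] coord.hyps(2)] by (simp add: mult.assoc)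
next
  case (add d f g)
  then show ?case using polyd.add by (simp add: distrib_right)
qed

lemma polyd_inner: "polyd 1 (\<lambda>z. z \<bullet> v)"
proof -
  have "polyd 1 (\<lambda>z. \<Sum>b\<in>Basis. (z \<bullet> b) * (v \<bullet> b))"
    using polyd.coord[OF polyd.const[of 0]] by (intro polyd_sum) simp
  then show ?thesis by (simp only: euclidean_inner[of _ v])
qed

lemma polyd_norm_sq: "polyd 2 (\<lambda>z. (norm (z - a))\<^sup>2)"
proof -
  have eq: "(norm (z - a))\<^sup>2 = (\<Sum>b\<in>Basis. (z \<bullet> b - a \<bullet> b) * (z \<bullet> b - a \<bullet> b))" for z
    unfolding power2_norm_eq_inner by (subst euclidean_inner) (simp add: inner_diff_left)
  have "polyd 2 (\<lambda>z. \<Sum>b\<in>Basis. (z \<bullet> b - a \<bullet> b) * (z \<bullet> b - a \<bullet> b))"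
    by (subst one_add_one[symmetric]) (intro polyd_sum polyd_mult polyd_diff polyd_inner polyd.const)
  then show ?thesis by (simp only: eq)
qed

lemma real_polynomial_function_imp_polyd:
  "real_polynomial_function f \<Longrightarrow> \<exists>d. polyd d f"
proof (induction rule: real_polynomial_function.induct)
  case (linear f)
  have "f = (\<lambda>z. \<Sum>b\<in>Basis. (z \<bullet> b) * f b)"
  proof
    fix z
    show "f z = (\<Sum>b\<in>Basis. (z \<bullet> b) * f b)"
      using Linear_Algebra.linear_componentwise[OF bounded_linear.linear[OF linear], of z 1] by simp
  qed
  moreover have "polyd 1 (\<lambda>z. \<Sum>b\<in>Basis. (z \<bullet> b) * f b)"
    using polyd.coord[OF polyd.const[of 0]] by (intro polyd_sum) simp
  ultimately show ?case by metis
next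
  case (add f g)
  then obtain d e where "polyd d f" "polyd e g" by blast
  then show ?case using polyd.add[of "max d e"] polyd_mono by (metis max.cobounded1 max.cobounded2)
next
  case (mult f g)
  then show ?case using polyd_mult by blast
qed (auto intro: polyd.const)

section \<open>Directional derivatives of polynomials\<close>

definition pd :: "'a::euclidean_space \<Rightarrow> ('a \<Rightarrow> real) \<Rightarrow> 'a \<Rightarrow> real"
  where "pd \<xi> f z = frechet_derivative f (at z) \<xi>"

lemma pd_eqI:
  assumes "\<And>z. (f has_derivative (\<lambda>\<xi>. G \<xi> z)) (at z)"
  shows "pd \<xi> f = G \<xi>"
  by (simp add: pd_def fun_eq_iff frechet_derivative_at[OF assms, symmetric])

text \<open>Since \<open>d - 1\<close> is truncated, the case \<open>d = 0\<close> is recorded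
  separately: the derivative of a constant, multiplied by a coordinate, must again have degree 0,
  and only its vanishing ensures that.\<close>

lemma polyd_derivative_ex:
  "polyd d f \<Longrightarrow> \<exists>G. (\<forall>\<xi>. polyd (d - 1) (G \<xi>) \<and> (d = 0 \<longrightarrow> G \<xi> = (\<lambda>_. 0))) \<and>
     (\<forall>z. (f has_derivative (\<lambda>\<xi>. G \<xi> z)) (at z))"
proof (induction rule: polyd.induct)
  case (const d c)
  then show ?case by (intro exI[of _ "\<lambda>\<xi> z. 0"]) (auto intro: polyd.const)
next
  case (coord d f b)
  then obtain G where G: "\<And>\<xi>. polyd (d - 1) (G \<xi>)" "\<And>\<xi>. d = 0 \<Longrightarrow> G \<xi> = (\<lambda>_. 0)"
    "\<And>z. (f has_derivative (\<lambda>\<xi>. G \<xi> z)) (at z)" by blast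
  have "polyd d (\<lambda>z. (z \<bullet> b) * G \<xi> z)" for \<xi>
  proof (cases d)
    case (Suc d')
    then show ?thesis using polyd.coord[OF G(1) coord.hyps(2)] by simp
  qed (use G(2) in \<open>simp add: polyd.const\<close>)
  then have "polyd d (\<lambda>z. (z \<bullet> b) * G \<xi> z + (\<xi> \<bullet> b) * f z)" for \<xi>
    by (intro polyd.add polyd_cmult coord)
  moreover have "((\<lambda>z. (z \<bullet> b) * f z) has_derivative (\<lambda>\<xi>. (z \<bullet> b) * G \<xi> z + (\<xi> \<bullet> b) * f z)) (at z)" for z
    by (auto intro!: derivative_eq_intros G(3))
  ultimately show ?case by (intro exI[of _ "\<lambda>\<xi> z. (z \<bullet> b) * G \<xi> z + (\<xi> \<bullet> b) * f z"]) simp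
next
  case (add d f g)
  then obtain G1 G2 where "\<And>\<xi>. polyd (d - 1) (G1 \<xi>)" "\<And>\<xi>. d = 0 \<Longrightarrow> G1 \<xi> = (\<lambda>_. 0)"
    "\<And>z. (f has_derivative (\<lambda>\<xi>. G1 \<xi> z)) (at z)"
    "\<And>\<xi>. polyd (d - 1) (G2 \<xi>)" "\<And>\<xi>. d = 0 \<Longrightarrow> G2 \<xi> = (\<lambda>_. 0)"
    "\<And>z. (g has_derivative (\<lambda>\<xi>. G2 \<xi> z)) (at z)" by metis
  then show ?case
    by (intro exI[of _ "\<lambda>\<xi> z. G1 \<xi> z + G2 \<xi> z"]) (auto intro!: polyd.add has_derivative_add)
qed

lemma
  assumes "polyd d f"
  shows polyd_pd_polyd: "polyd (d - 1) (pd \<xi> f)"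
    and polyd_has_derivative: "(f has_derivative (\<lambda>\<xi>. pd \<xi> f z)) (at z)"
    and polyd_pd_0: "d = 0 \<Longrightarrow> pd \<xi> f = (\<lambda>_. 0)"
proof -
  obtain G where G: "\<And>\<xi>. polyd (d - 1) (G \<xi>)" "\<And>\<xi>. d = 0 \<Longrightarrow> G \<xi> = (\<lambda>_. 0)"
    "\<And>z. (f has_derivative (\<lambda>\<xi>. G \<xi> z)) (at z)" using polyd_derivative_ex[OF assms] by blast
  have "pd \<xi> f = G \<xi>" for \<xi> using pd_eqI G(3) by blast
  then show "polyd (d - 1) (pd \<xi> f)" "(f has_derivative (\<lambda>\<xi>. pd \<xi> f z)) (at z)"
    "d = 0 \<Longrightarrow> pd \<xi> f = (\<lambda>_. 0)" using G by auto
qed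

lemma polyd_continuous_on: "polyd d f \<Longrightarrow> continuous_on S f"
  by (meson polyd_has_derivative has_derivative_continuous continuous_at_imp_continuous_on)

lemma pd_add: "polyd d f \<Longrightarrow> polyd e g \<Longrightarrow> pd \<xi> (\<lambda>z. f z + g z) = (\<lambda>z. pd \<xi> f z + pd \<xi> g z)"
  by (rule pd_eqI) (auto intro!: has_derivative_add polyd_has_derivative)

lemma pd_cmult: "polyd d f \<Longrightarrow> pd \<xi> (\<lambda>z. c * f z) = (\<lambda>z. c * pd \<xi> f z)"
  by (rule pd_eqI) (auto intro!: derivative_eq_intros polyd_has_derivative)

lemma pd_const: "pd \<xi> (\<lambda>z. c) = (\<lambda>z. 0)"
  by (rule pd_eqI) (auto intro!: derivative_eq_intros)

lemma pd_norm_sq: "pd \<xi> (\<lambda>z. (norm (z - a))\<^sup>2) = (\<lambda>z. 2 * ((z - a) \<bullet> \<xi>))"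
  unfolding power2_norm_eq_inner
  by (rule pd_eqI) (auto intro!: derivative_eq_intros simp: inner_commute)

lemma pd_inner: "pd \<xi> (\<lambda>z. k * ((z - a) \<bullet> v)) = (\<lambda>z. k * (\<xi> \<bullet> v))"
  by (rule pd_eqI) (auto intro!: derivative_eq_intros)

lemma polyd_along_line:
  assumes "polyd d f"
  shows "((\<lambda>s. f (z + s *\<^sub>R \<xi>)) has_real_derivative pd \<xi> f (z + s *\<^sub>R \<xi>)) (at s)"
proof -
  have "((\<lambda>s. f (z + s *\<^sub>R \<xi>)) has_derivative (\<lambda>h. pd (h *\<^sub>R \<xi>) f (z + s *\<^sub>R \<xi>))) (at s)"
    by (rule has_derivative_compose[OF _ polyd_has_derivative[OF assms]])
       (auto intro!: derivative_eq_intros)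
  moreover have "pd (h *\<^sub>R \<xi>) f w = h * pd \<xi> f w" for h w
    using linear_scale[OF has_derivative_linear[OF polyd_has_derivative[OF assms]]] by simp
  ultimately show ?thesis by (simp add: has_field_derivative_def mult_commute_abs)
qed

text \<open>Induction on the degree: the derivatives vanish on the ball and have lower degree, so
  they vanish everywhere and \<open>q\<close> is constant.\<close>

lemma polyd_eq_0:
  "polyd d q \<Longrightarrow> r > 0 \<Longrightarrow> (\<And>z. z \<in> ball a r \<Longrightarrow> q z = 0) \<Longrightarrow> q = (\<lambda>_. 0)"
proof (induction d arbitrary: q)
  case 0
  have "(q has_derivative (\<lambda>\<xi>. 0)) (at z)" for z
    using polyd_has_derivative[OF 0(1), of z] by (simp add: polyd_pd_0[OF 0(1)])
  then have "q z = q a" for z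
    using has_derivative_zero_constant[of UNIV q] by auto
  then show ?case using 0 by auto
next
  case (Suc d)
  have z0: "pd \<xi> q = (\<lambda>_. 0)" for \<xi>
  proof (rule Suc.IH)
    show "polyd d (pd \<xi> q)" using polyd_pd_polyd[OF Suc.prems(1)] by simp
    fix z assume z: "z \<in> ball a r"
    have "((\<lambda>_. 0) has_derivative (\<lambda>\<xi>. pd \<xi> q z)) (at z)"
      by (rule has_derivative_transform_within_open[OF polyd_has_derivative[OF Suc.prems(1)] _ z])
         (use Suc.prems(3) in auto)
    then show "pd \<xi> q z = 0"
      using has_derivative_unique[OF has_derivative_const] by metis
  qed (use Suc in auto)
  have "(q has_derivative (\<lambda>\<xi>. 0)) (at z)" for z
    using polyd_has_derivative[OF Suc.prems(1), of z] by (simp add: z0)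
  then have "q z = q a" for z
    using has_derivative_zero_constant[of UNIV q] by auto
  then show ?case using Suc by auto
qed

lemma second_derivative_at_max:
  fixes \<phi> \<phi>' :: "real \<Rightarrow> real"
  assumes "\<delta> > 0" and der: "\<And>s. \<bar>s\<bar> < \<delta> \<Longrightarrow> (\<phi> has_real_derivative \<phi>' s) (at s)"
    and der2: "(\<phi>' has_real_derivative D) (at 0)"
    and mx: "\<And>s. \<bar>s\<bar> < \<delta> \<Longrightarrow> \<phi> s \<le> \<phi> 0"
  shows "\<phi>' 0 = 0" "D \<le> 0"
proof -
  show 0: "\<phi>' 0 = 0"
    by (rule DERIV_local_max[OF der \<open>\<delta> > 0\<close>]) (use assms in auto)
  show "D \<le> 0"
  proof (rule ccontr)
    \<comment> \<open>A positive \<open>D\<close> makes \<open>\<phi>'\<close> positive just to the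
      right of 0, and by the mean value theorem \<open>\<phi>\<close> then exceeds its
      maximum.\<close>
    assume "\<not> D \<le> 0"
    then obtain e where e: "e > 0" "\<And>h. h > 0 \<Longrightarrow> h < e \<Longrightarrow> \<phi>' 0 < \<phi>' (0 + h)"
      using DERIV_pos_inc_right[OF der2] by auto
    define h where "h = min e \<delta> / 2"
    have h: "h > 0" "h < e" "h < \<delta>" using e \<open>\<delta> > 0\<close> by (auto simp: h_def)
    obtain c where c: "0 < c" "c < h" "\<phi> h - \<phi> 0 = (h - 0) * \<phi>' c"
      using MVT2[of 0 h \<phi> \<phi>'] h der by (metis abs_of_nonneg order_le_less_trans)
    have "\<phi>' c > 0" using e(2)[of c] c h 0 by simp
    then have "\<phi> h > \<phi> 0" using c h by (simp add: algebra_simps)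
    then show False using mx[of h] h by simp
  qed
qed

lemma polyd_at_max:
  assumes "polyd d f" "\<delta> > 0" "\<And>w. w \<in> ball z \<delta> \<Longrightarrow> f w \<le> f z"
  shows "pd \<xi> f z = 0" "pd \<xi> (pd \<xi> f) z \<le> 0"
proof -
  define e where "e = \<delta> / (norm \<xi> + 1)"
  have e: "e > 0" unfolding e_def using assms(2) by (simp add: add_nonneg_pos)
  have le: "f (z + s *\<^sub>R \<xi>) \<le> f (z + 0 *\<^sub>R \<xi>)" if "\<bar>s\<bar> < e" for s
  proof -
    have "\<bar>s\<bar> * norm \<xi> \<le> \<bar>s\<bar> * (norm \<xi> + 1)" by (simp add: mult_left_mono)
    also have "\<dots> < \<delta>" using that unfolding e_def by (simp add: pos_less_divide_eq add_nonneg_pos)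
    finally show ?thesis using assms(3)[of "z + s *\<^sub>R \<xi>"] by (simp add: dist_norm)
  qed
  note d1 = polyd_along_line[OF assms(1), of z \<xi>]
  note d2 = polyd_along_line[OF polyd_pd_polyd[OF assms(1), of \<xi>], of z \<xi> 0]
  show "pd \<xi> f z = 0" "pd \<xi> (pd \<xi> f) z \<le> 0"
    using second_derivative_at_max[OF e d1 d2 le] by auto
qed

text \<open>A constant-coefficient second-order operator written as a sum of squares, so that at a
  maximum every summand is nonpositive. The directions may span a proper subspace; in the
  application they have no time component.\<close>

definition lop :: "'i set \<Rightarrow> ('i \<Rightarrow> 'a::euclidean_space) \<Rightarrow> ('a \<Rightarrow> real) \<Rightarrow> 'a \<Rightarrow> real"
  where "lop I X f z = (\<Sum>k\<in>I. pd (X k) (pd (X k) f) z)"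

lemma polyd_lop: "polyd d f \<Longrightarrow> polyd (d - 2) (lop I X f)"
  unfolding lop_def using polyd_pd_polyd[OF polyd_pd_polyd]
  by (intro polyd_sum) (simp add: numeral_2_eq_2)

lemma lop_add: "polyd d f \<Longrightarrow> polyd d g \<Longrightarrow> lop I X (\<lambda>z. f z + g z) = (\<lambda>z. lop I X f z + lop I X g z)"
  unfolding lop_def
  by (simp add: pd_add[of d] pd_add[OF polyd_pd_polyd polyd_pd_polyd] sum.distrib)

lemma lop_cmult: "polyd d f \<Longrightarrow> lop I X (\<lambda>z. c * f z) = (\<lambda>z. c * lop I X f z)"
  unfolding lop_def
  by (simp add: pd_cmult[of d] pd_cmult[OF polyd_pd_polyd] sum_distrib_left)

lemma lop_norm_sq: "lop I X (\<lambda>z. (norm (z - a))\<^sup>2) z = 2 * (\<Sum>k\<in>I. (norm (X k))\<^sup>2)"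
  unfolding lop_def pd_norm_sq pd_inner by (simp add: sum_distrib_left power2_norm_eq_inner)

lemma lop_maximum_principle:
  assumes f: "polyd d f" and I: "finite I" "k \<in> I" "X k \<noteq> 0" and "r > 0"
    and L: "\<And>z. z \<in> ball a r \<Longrightarrow> lop I X f z \<ge> 0"
    and bd: "\<And>z. z \<in> sphere a r \<Longrightarrow> f z \<le> 0" and z: "z \<in> ball a r"
  shows "f z \<le> 0"
proof (rule ccontr)
  assume "\<not> f z \<le> 0"
  \<comment> \<open>With this \<open>\<eta>\<close> the added square is \<open>f z / 2\<close> on
    the sphere, so the maximum of \<open>g\<close> lies in the open ball, where
    \<open>lop I X g\<close> would be both positive and nonpositive.\<close>
  define \<eta> where "\<eta> = f z / (2 * r\<^sup>2)"
  have \<eta>: "\<eta> > 0" using \<open>\<not> f z \<le> 0\<close> \<open>r > 0\<close> by (simp add: \<eta>_def)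
  define g where "g w = f w + \<eta> * (norm (w - a))\<^sup>2" for w
  have pg: "polyd (max d 2) g" unfolding g_def
    using f by (intro polyd.add polyd_cmult) (auto intro: polyd_mono polyd_norm_sq)
  have "(\<Sum>k\<in>I. (norm (X k))\<^sup>2) > 0"
    using I by (intro sum_pos2[of _ k]) auto
  then have Lg: "lop I X g w > 0" if "w \<in> ball a r" for w
    unfolding g_def using L[OF that] \<eta> polyd_mono[OF f, of "max d 2"]
      polyd_mono[OF polyd_norm_sq[of a], of "max d 2"]
    by (simp add: lop_add[of "max d 2"] polyd_cmult lop_cmult[OF polyd_norm_sq] lop_norm_sq add_nonneg_pos)
  obtain w where w: "w \<in> cball a r" "\<And>w'. w' \<in> cball a r \<Longrightarrow> g w' \<le> g w"
    using continuous_attains_sup[OF compact_cball _ polyd_continuous_on[OF pg], of a r] \<open>r > 0\<close> by auto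
  show False
  proof (cases "w \<in> ball a r")
    case True
    then obtain \<delta> where "\<delta> > 0" "ball w \<delta> \<subseteq> ball a r"
      using open_ball openE by blast
    then have "pd \<xi> (pd \<xi> g) w \<le> 0" for \<xi>
      using w(2) polyd_at_max[OF pg, of \<delta> w \<xi>] ball_subset_cball by (meson subsetD)
    then have "lop I X g w \<le> 0" unfolding lop_def by (simp add: sum_nonpos)
    then show False using Lg True by fastforce
  next
    case False
    then have s: "w \<in> sphere a r" using w(1) by auto
    then have "norm (w - a) = r" by (simp add: dist_norm norm_minus_commute)
    then have "g w \<le> \<eta> * r\<^sup>2" using bd[OF s] by (simp add: g_def)
    also have "\<dots> < f z" using \<open>\<not> f z \<le> 0\<close> \<open>r > 0\<close> by (simp add: \<eta>_def)
    also have "\<dots> \<le> g z" using \<eta> by (simp add: g_def)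
    finally show False using w(2)[of z] z by auto
  qed
qed

text \<open>The spanning set consists of products over lists of basis vectors of length at most
  \<open>d\<close>, and there are finitely many such lists.\<close>

lemma polyd_finite_span:
  "\<exists>B::('a::euclidean_space \<Rightarrow> real) set. finite B \<and>
     module.span (\<lambda>c f z. c * f z) B = {f. polyd d f}"
proof -
  interpret F: vector_space "\<lambda>(c::real) (f::'a \<Rightarrow> real) z. c * f z"
    by unfold_locales (auto simp: algebra_simps)
  define mon where "mon ls = (\<lambda>z. \<Prod>b\<leftarrow>ls. z \<bullet> b)" for ls :: "'a list"
  define B where "B d = mon ` {ls. set ls \<subseteq> Basis \<and> length ls \<le> d}" for d
  have "finite (B d)" unfolding B_def by (intro finite_imageI finite_lists_length_le) simp
  moreover have "polyd d f" if "f \<in> F.span (B d)" for f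
    using that
  proof (induction rule: F.span_induct_alt)
    case base
    then show ?case using polyd.const[of d 0] by (simp add: zero_fun_def)
  next
    case (step c x y)
    then obtain ls where "x = mon ls" "set ls \<subseteq> Basis" "length ls \<le> d" by (auto simp: B_def)
    moreover have "set ls \<subseteq> Basis \<Longrightarrow> polyd (length ls) (mon ls)" for ls
      by (induction ls) (auto simp: mon_def intro: polyd.intros)
    ultimately have "polyd d x" using polyd_mono by blast
    then show ?case using step polyd.add[OF polyd_cmult] by (simp add: plus_fun_def)
  qed
  moreover have "f \<in> F.span (B d)" if "polyd d f" for f
    using that
  proof (induction rule: polyd.induct)
    case (const d c)
    have "mon [] \<in> B d" by (auto simp: B_def)
    then have "(\<lambda>z. c * mon [] z) \<in> F.span (B d)" by (intro F.span_scale F.span_base)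
    then show ?case by (simp add: mon_def)
  next
    case (coord d f b)
    from coord.IH show ?case
    proof (induction rule: F.span_induct_alt)
      case base
      show ?case using F.span_zero[of "B (Suc d)"] by (simp add: zero_fun_def)
    next
      case (step c x y)
      then obtain ls where "x = mon ls" "set ls \<subseteq> Basis" "length ls \<le> d" by (auto simp: B_def)
      then have "(\<lambda>z. (z \<bullet> b) * x z) = mon (b # ls)" by (simp add: mon_def)
      moreover have "mon (b # ls) \<in> B (Suc d)"
        unfolding B_def using \<open>set ls \<subseteq> Basis\<close> \<open>length ls \<le> d\<close> coord.hyps(2) by (intro imageI) auto
      ultimately have "(\<lambda>z. (z \<bullet> b) * x z) \<in> F.span (B (Suc d))" by (simp add: F.span_base)
      then have "(\<lambda>z. c * ((z \<bullet> b) * x z)) + (\<lambda>z. (z \<bullet> b) * y z) \<in> F.span (B (Suc d))"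
        using step by (intro F.span_add F.span_scale)
      moreover have "(\<lambda>z. c * ((z \<bullet> b) * x z)) + (\<lambda>z. (z \<bullet> b) * y z)
          = (\<lambda>z. (z \<bullet> b) * ((\<lambda>z. c * x z) + y) z)"
        by (auto simp: algebra_simps)
      ultimately show ?case by simp
    qed
  next
    case (add d f g)
    then show ?case using F.span_add[OF add.IH] by (simp add: plus_fun_def)
  qed
  ultimately show ?thesis by blast
qed

text \<open>A harmonic extension that needs no potential theory: \<open>q \<mapsto> lop ((r\<^sup>2 - |z - a|\<^sup>2) q)\<close> is an
  injective endomorphism of the finite-dimensional space of polynomials of bounded degree.\<close>

lemma polynomial_dirichlet_problem:
  assumes g: "polyd d g" and I: "finite I" "k \<in> I" "X k \<noteq> 0" and r: "r > 0"
  shows "\<exists>e H. polyd e H \<and> (\<forall>z. lop I X H z = \<gamma>) \<and> (\<forall>z\<in>sphere a r. H z = g z)"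
proof -
  define \<rho> where "\<rho> z = r\<^sup>2 - (norm (z - a))\<^sup>2" for z
  have p\<rho>: "polyd 2 \<rho>" unfolding \<rho>_def by (intro polyd_diff polyd.const polyd_norm_sq)
  define T where "T q = lop I X (\<lambda>z. \<rho> z * q z)" for q
  have p: "polyd (2 + d) (\<lambda>z. \<rho> z * q z)" if "polyd d q" for q
    by (intro polyd_mult p\<rho> that)
  interpret F: vector_space "\<lambda>(c::real) (f::'a \<Rightarrow> real) z. c * f z"
    by unfold_locales (auto simp: algebra_simps)
  obtain B where B: "finite B" "F.span B = {f. polyd d f}" using polyd_finite_span[of d] by blast
  have "\<exists>q\<in>F.span B. T q = (\<lambda>z. \<gamma> - lop I X g z)"
  proof (rule F.injective_on_span_imp_surjective[OF B(1)])
    \<comment> \<open>Multiplication by \<open>\<rho>\<close> raises the degree bound by 2 and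
      \<open>lop\<close> lowers it by 2, so \<open>T\<close> maps the space into itself.\<close>
    show "T f \<in> F.span B" if "f \<in> F.span B" for f
      using polyd_lop[OF p] that unfolding B T_def by simp
    show "T (f + h) = T f + T h" if "f \<in> F.span B" "h \<in> F.span B" for f h
      using lop_add[OF p p, of f h I X] that unfolding B T_def by (auto simp: distrib_left plus_fun_def)
    show "T (\<lambda>z. c * f z) = (\<lambda>z. c * T f z)" if "f \<in> F.span B" for c f
      using lop_cmult[OF p, of f I X c] that unfolding B T_def by (auto simp: mult.left_commute)
    show "(\<lambda>z. \<gamma> - lop I X g z) \<in> F.span B"
      unfolding B using polyd_mono[OF polyd_lop[OF g, of I X], of d] by (auto intro!: polyd_diff polyd.const)
    fix q assume "q \<in> F.span B" and T0: "T q = 0"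
    then have q: "polyd d q" unfolding B by simp
    have L0: "lop I X (\<lambda>z. \<rho> z * q z) z = 0" for z using T0 by (simp add: T_def fun_eq_iff)
    then have L1: "lop I X (\<lambda>z. (- 1) * (\<rho> z * q z)) z = 0" for z
      by (simp only: lop_cmult[OF p[OF q]] mult_zero_right)
    have \<rho>0: "\<rho> z = 0" if "z \<in> sphere a r" for z
      using that by (simp add: \<rho>_def dist_norm norm_minus_commute)
    \<comment> \<open>\<open>\<rho> * q\<close> vanishes on the sphere and is annihilated by
      \<open>lop\<close>. The maximum principle for it and for its negative makes it vanish in the
      ball, where \<open>\<rho>\<close> is positive.\<close>
    have "q z = 0" if z: "z \<in> ball a r" for z
    proof -
      have "\<rho> z * q z \<le> 0"
        by (rule lop_maximum_principle[where X=X and k=k, OF p[OF q] I r _ _ z]) (use L0 \<rho>0 in auto)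
      moreover have "(- 1) * (\<rho> z * q z) \<le> 0"
        by (rule lop_maximum_principle[where X=X and k=k, OF polyd_cmult[OF p[OF q]] I r _ _ z])
           (use L1 \<rho>0 in \<open>auto simp del: mult_minus1 mult_minus_left\<close>)
      ultimately have "\<rho> z * q z = 0" by simp
      moreover have "norm (z - a) < r" using z by (simp add: dist_norm norm_minus_commute)
      then have "(norm (z - a))\<^sup>2 < r\<^sup>2" by (simp add: power_strict_mono)
      then have "\<rho> z > 0" by (simp add: \<rho>_def)
      ultimately show ?thesis by simp
    qed
    then have "q = (\<lambda>_. 0)" using polyd_eq_0[OF q r] by blast
    then show "q = 0" by (simp add: zero_fun_def)
  qed
  then obtain q where q: "polyd d q" "T q = (\<lambda>z. \<gamma> - lop I X g z)" unfolding B by auto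
  \<comment> \<open>Since \<open>\<rho>\<close> vanishes on the sphere, \<open>q\<close> corrects
    \<open>lop\<close> without changing the boundary values.\<close>
  define H where "H z = g z + \<rho> z * q z" for z
  have "polyd (2 + d) H" unfolding H_def using polyd.add[OF polyd_mono[OF g] p[OF q(1)]] by simp
  moreover have "lop I X H z = \<gamma>" for z
    unfolding H_def using lop_add[OF polyd_mono[OF g] p[OF q(1)], of I X] q(2) by (auto simp: T_def fun_eq_iff)
  moreover have "H z = g z" if "z \<in> sphere a r" for z
    using that by (simp add: H_def \<rho>_def dist_norm norm_minus_commute)
  ultimately show ?thesis by blast
qed

section \<open>Comparison of viscosity inequalities with constant coefficients\<close>

definition touches_above :: "('a::metric_space \<Rightarrow> real) \<Rightarrow> ('a \<Rightarrow> real) \<Rightarrow> 'a \<Rightarrow> bool"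
  where "touches_above S H z \<longleftrightarrow> (\<exists>\<delta>>0. \<forall>w\<in>ball z \<delta>. S w - H w \<le> S z - H z)"

text \<open>The polynomial \<open>H\<close> with \<open>lop I X H\<close> constant and boundary values close to \<open>- S2\<close> separates
  \<open>S1\<close> from \<open>- S2\<close>.\<close>

lemma no_max_of_viscosity_sum:
  assumes I: "finite I" "k \<in> I" "X k \<noteq> 0" and r: "r > 0"
    and cont: "continuous_on (cball a r) S1" "continuous_on (cball a r) S2"
    and S1: "\<And>d H z. polyd d H \<Longrightarrow> z \<in> ball a r \<Longrightarrow> touches_above S1 H z \<Longrightarrow> lop I X H z \<ge> \<beta>1"
    and S2: "\<And>d H z. polyd d H \<Longrightarrow> z \<in> ball a r \<Longrightarrow> touches_above S2 H z \<Longrightarrow> lop I X H z \<ge> \<beta>2"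
    and pos: "\<beta>1 + \<beta>2 > 0"
    and mx: "\<And>z. z \<in> cball a r \<Longrightarrow> S1 z + S2 z \<le> S1 a + S2 a"
  shows False
proof -
  define \<Lambda> where "\<Lambda> = (\<Sum>k\<in>I. (norm (X k))\<^sup>2)"
  have "\<Lambda> > 0" unfolding \<Lambda>_def using I by (intro sum_pos2[of _ k]) auto
  \<comment> \<open>The square added to \<open>H\<close> below raises \<open>lop\<close> by
    \<open>2 * \<eta> * \<Lambda>\<close>, a quarter of \<open>\<beta>1 + \<beta>2\<close>, and
    gains \<open>\<eta> * r\<^sup>2\<close> on the sphere. The approximation error
    \<open>\<theta>\<close> enters twice; as a quarter of that gain it leaves half of it.\<close>
  define \<eta> where "\<eta> = (\<beta>1 + \<beta>2) / (8 * \<Lambda>)"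
  have \<eta>: "\<eta> > 0" and \<eta>\<Lambda>: "\<eta> * \<Lambda> = (\<beta>1 + \<beta>2) / 8" using pos \<open>\<Lambda> > 0\<close> by (simp_all add: \<eta>_def)
  define \<theta> where "\<theta> = \<eta> * r\<^sup>2 / 4"
  have \<theta>: "\<theta> > 0" using \<eta> r by (simp add: \<theta>_def)
  \<comment> \<open>The midpoint of \<open>- \<beta>2\<close> and \<open>\<beta>1\<close>: in the
    ball \<open>H\<close> cannot touch \<open>S1\<close> from above, nor can \<open>- H\<close>
    touch \<open>S2\<close>.\<close>
  define \<gamma> where "\<gamma> = (\<beta>1 - \<beta>2) / 2"
  have "continuous_on (cball a r) (\<lambda>z. - S2 z)" using cont(2) by (intro continuous_intros)
  then obtain g where "real_polynomial_function g" and g: "\<And>z. z \<in> cball a r \<Longrightarrow> \<bar>- S2 z - g z\<bar> < \<theta>"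
    using Stone_Weierstrass_real_polynomial_function[OF compact_cball _ \<theta>] by metis
  then obtain d where "polyd d g" using real_polynomial_function_imp_polyd by blast
  then obtain e H where H: "polyd e H" "\<And>z. lop I X H z = \<gamma>" "\<And>z. z \<in> sphere a r \<Longrightarrow> H z = g z"
    using polynomial_dirichlet_problem[OF _ I(1) _ _ r, of d g k X \<gamma> a] I by metis
  have int: "\<exists>\<delta>>0. ball z \<delta> \<subseteq> cball a r" if "z \<in> ball a r" for z
    using that openE[OF open_ball] ball_subset_cball by (metis subset_trans)
  \<comment> \<open>An interior maximum of \<open>S2 + H\<close> would make \<open>- H\<close> touch
    \<open>S2\<close> from above. The maximum is therefore on the sphere, where \<open>H\<close>
    equals the approximation \<open>g\<close> of \<open>- S2\<close>.\<close>
  have b: "S2 a + H a < \<theta>"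
  proof -
    have "continuous_on (cball a r) (\<lambda>z. S2 z + H z)"
      using cont(2) polyd_continuous_on[OF H(1)] by (intro continuous_intros)
    then obtain w where w: "w \<in> cball a r" "\<And>w'. w' \<in> cball a r \<Longrightarrow> S2 w' + H w' \<le> S2 w + H w"
      using continuous_attains_sup[OF compact_cball, of a r] r by fastforce
    have "w \<notin> ball a r"
    proof
      assume wb: "w \<in> ball a r"
      obtain \<delta> where "\<delta> > 0" "ball w \<delta> \<subseteq> cball a r" using int[OF wb] by blast
      then have "lop I X (\<lambda>z. (-1) * H z) w \<ge> \<beta>2"
        using w(2)
        by (intro S2[OF polyd_cmult[OF H(1)] wb, unfolded touches_above_def] exI[of _ \<delta>]) (auto simp: subset_iff)
      then have "- \<gamma> \<ge> \<beta>2" by (simp only: lop_cmult[OF H(1)] H(2))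
      then show False using pos by (simp add: \<gamma>_def field_simps)
    qed
    then have "w \<in> sphere a r" using w(1) by auto
    then show ?thesis using H(3) g[OF w(1)] w(2)[of a] r by fastforce
  qed
  have "S1 a - H a \<le> S1 a + S2 a - \<eta> * r\<^sup>2 + \<theta>"
  proof -
    have "continuous_on (cball a r) (\<lambda>z. S1 z - (H z + \<eta> * (norm (z - a))\<^sup>2))"
      using cont(1) polyd_continuous_on[OF H(1)] by (intro continuous_intros)
    then obtain w where w: "w \<in> cball a r" "\<And>w'. w' \<in> cball a r \<Longrightarrow>
        S1 w' - (H w' + \<eta> * (norm (w' - a))\<^sup>2) \<le> S1 w - (H w + \<eta> * (norm (w - a))\<^sup>2)"
      using continuous_attains_sup[OF compact_cball, of a r] r by fastforce
    have "w \<notin> ball a r"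
    proof
      assume wb: "w \<in> ball a r"
      obtain \<delta> where "\<delta> > 0" "ball w \<delta> \<subseteq> cball a r" using int[OF wb] by blast
      have pH: "polyd (max e 2) H" "polyd (max e 2) (\<lambda>z. \<eta> * (norm (z - a))\<^sup>2)"
        by (intro polyd_cmult polyd_mono[OF H(1)] polyd_mono[OF polyd_norm_sq], simp)+
      have "lop I X (\<lambda>z. H z + \<eta> * (norm (z - a))\<^sup>2) w \<ge> \<beta>1"
        using w(2) \<open>\<delta> > 0\<close> \<open>ball w \<delta> \<subseteq> cball a r\<close>
        by (intro S1[OF polyd.add[OF pH] wb, unfolded touches_above_def] exI[of _ \<delta>]) (auto simp: subset_iff)
      then have "\<gamma> + \<eta> * (2 * \<Lambda>) \<ge> \<beta>1"
        by (simp add: lop_add[OF pH] lop_cmult[OF polyd_norm_sq] lop_norm_sq H(2) \<Lambda>_def)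
      then show False using pos \<eta>\<Lambda> by (simp add: \<gamma>_def field_simps)
    qed
    then have s: "w \<in> sphere a r" using w(1) by auto
    then have n: "norm (w - a) = r" by (simp add: dist_norm norm_minus_commute)
    have "S1 a - H a \<le> S1 w - (H w + \<eta> * r\<^sup>2)" using w(2)[of a] r n by simp
    also have "\<dots> \<le> S1 w + S2 w + \<theta> - \<eta> * r\<^sup>2" using H(3)[OF s] g[OF w(1)] by linarith
    also have "\<dots> \<le> S1 a + S2 a + \<theta> - \<eta> * r\<^sup>2" using mx[OF w(1)] by simp
    finally show ?thesis by simp
  qed
  moreover have "\<eta> * r\<^sup>2 > 0" using \<eta> r by simp
  ultimately show False using b unfolding \<theta>_def by linarith
qed

section \<open>Space-time jets and the \<open>p\<close>-Laplacian\<close>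

definition outer :: "real ^ 'n \<Rightarrow> real ^ 'n \<Rightarrow> real ^ 'n ^ 'n"
  where "outer a b = (\<chi> i j. a $ i * b $ j)"

lemma outer_mult_vec: "outer a b *v h = (b \<bullet> h) *\<^sub>R a"
  by (simp add: outer_def matrix_vector_mult_def vec_eq_iff inner_vec_def sum_distrib_left mult_ac)

lemma trace_outer: "trace (outer a b) = a \<bullet> b"
  by (simp add: outer_def trace_def inner_vec_def)

lemma continuous_on_outer [continuous_intros]:
  "continuous_on S f \<Longrightarrow> continuous_on S g \<Longrightarrow> continuous_on S (\<lambda>z. outer (f z) (g z))"
  unfolding outer_def by (intro continuous_intros)

lemma scaleR_matrix_vector_mult: "(c *\<^sub>R A) *v h = c *\<^sub>R (A *v h)"
  for A :: "real ^ 'n ^ 'm"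
  by (simp add: matrix_vector_mult_def vec_eq_iff sum_distrib_left mult.assoc)

text \<open>The derivatives are explicit arguments, so that the jets of sums and compositions can be
  written down; two lemmas below translate to and from \<open>test_function\<close>.\<close>

definition C21_on :: "((real ^ 'n) \<times> real) set \<Rightarrow> ((real ^ 'n) \<times> real \<Rightarrow> real) \<Rightarrow>
    ((real ^ 'n) \<times> real \<Rightarrow> real ^ 'n) \<Rightarrow> ((real ^ 'n) \<times> real \<Rightarrow> real ^ 'n ^ 'n) \<Rightarrow>
    ((real ^ 'n) \<times> real \<Rightarrow> real) \<Rightarrow> bool"
  where "C21_on Q \<psi> g X \<tau> \<longleftrightarrow>
    (\<forall>x t. (x, t) \<in> Q \<longrightarrow>
      ((\<lambda>y. \<psi> (y, t)) has_derivative (\<lambda>h. g (x, t) \<bullet> h)) (at x) \<and>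
      ((\<lambda>y. g (y, t)) has_derivative (\<lambda>h. X (x, t) *v h)) (at x) \<and>
      ((\<lambda>s. \<psi> (x, s)) has_real_derivative \<tau> (x, t)) (at t)) \<and>
    continuous_on Q \<psi> \<and> continuous_on Q g \<and> continuous_on Q X \<and> continuous_on Q \<tau>"

lemma C21_onD:
  assumes "C21_on Q \<psi> g X \<tau>"
  shows "(x, t) \<in> Q \<Longrightarrow> ((\<lambda>y. \<psi> (y, t)) has_derivative (\<lambda>h. g (x, t) \<bullet> h)) (at x)"
    and "(x, t) \<in> Q \<Longrightarrow> ((\<lambda>y. g (y, t)) has_derivative (\<lambda>h. X (x, t) *v h)) (at x)"
    and "(x, t) \<in> Q \<Longrightarrow> ((\<lambda>s. \<psi> (x, s)) has_real_derivative \<tau> (x, t)) (at t)"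
    and "continuous_on Q \<psi>" "continuous_on Q g" "continuous_on Q X" "continuous_on Q \<tau>"
  using assms by (auto simp: C21_on_def)

lemma C21_on_subset: "C21_on Q \<psi> g X \<tau> \<Longrightarrow> R \<subseteq> Q \<Longrightarrow> C21_on R \<psi> g X \<tau>"
  unfolding C21_on_def by (meson continuous_on_subset subsetD)

lemma open_slice: "open Q \<Longrightarrow> open {y. (y, t) \<in> Q}"
  by (rule open_vimage[of Q "\<lambda>y. (y, t)", unfolded vimage_def]) (auto intro!: continuous_intros)

lemma C21_on_imp_test_function:
  fixes \<psi> :: "(real ^ 'n) \<times> real \<Rightarrow> real"
  assumes "open Q" and C: "C21_on Q \<psi> g X \<tau>"
  shows "test_function Q \<psi>"
    and "\<And>z. z \<in> Q \<Longrightarrow> space_grad \<psi> z = g z"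
    and "\<And>z. z \<in> Q \<Longrightarrow> space_hess \<psi> z = X z"
    and "\<And>z. z \<in> Q \<Longrightarrow> time_deriv \<psi> z = \<tau> z"
proof -
  note D = C21_onD[OF C]
  have G: "space_grad \<psi> z = g z" if "z \<in> Q" for z
    using D(1)[of "fst z" "snd z"] that
    by (simp add: space_grad_def split_beta frechet_derivative_at[symmetric] vec_eq_iff inner_axis)
  \<comment> \<open>\<open>space_grad \<psi>\<close> is known to equal \<open>g\<close> only on
    \<open>Q\<close>; as the slice of \<open>Q\<close> is open, this determines its derivative at
    \<open>x\<close>.\<close>
  have GH: "((\<lambda>y. space_grad \<psi> (y, t)) has_derivative (\<lambda>h. X (x, t) *v h)) (at x)"
    if "(x, t) \<in> Q" for x t
    by (rule has_derivative_transform_within_open[OF D(2)[OF that] open_slice[OF \<open>open Q\<close>, of t]])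
       (use that G in auto)
  have H: "space_hess \<psi> z = X z" if "z \<in> Q" for z
    using GH[of "fst z" "snd z"] that
    by (simp add: space_hess_def split_beta jacobian_def frechet_derivative_at[symmetric])
  have T: "time_deriv \<psi> z = \<tau> z" if "z \<in> Q" for z
    using D(3)[of "fst z" "snd z"] that by (simp add: time_deriv_def split_beta DERIV_imp_deriv)
  show "space_grad \<psi> z = g z" "space_hess \<psi> z = X z" "time_deriv \<psi> z = \<tau> z" if "z \<in> Q" for z
    using G H T that by auto
  show "test_function Q \<psi>"
    unfolding test_function_def
  proof (intro conjI ballI, clarify, intro conjI)
    fix x t assume xt: "(x, t) \<in> Q"
    show "(\<lambda>y. \<psi> (y, t)) differentiable (at x)"
      using D(1)[OF xt] by (auto simp: differentiable_def)
    show "(\<lambda>y. space_grad \<psi> (y, t)) differentiable (at x)"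
      using GH[OF xt] by (auto simp: differentiable_def)
    show "(\<lambda>s. \<psi> (x, s)) differentiable (at t)"
      using D(3)[OF xt] by (auto simp: differentiable_def has_field_derivative_def)
  qed (use D(4-7) G H T in \<open>auto cong: continuous_on_cong\<close>)
qed

lemma test_function_imp_C21_on:
  fixes \<psi> :: "(real ^ 'n) \<times> real \<Rightarrow> real"
  assumes "test_function Q \<psi>"
  shows "C21_on Q \<psi> (space_grad \<psi>) (space_hess \<psi>) (time_deriv \<psi>)"
  unfolding C21_on_def
proof (intro conjI allI impI)
  fix x t assume xt: "(x, t) \<in> Q"
  define f' where "f' = frechet_derivative (\<lambda>y. \<psi> (y, t)) (at x)"
  have d: "((\<lambda>y. \<psi> (y, t)) has_derivative f') (at x)"
    using assms xt unfolding test_function_def f'_def frechet_derivative_works[symmetric] by auto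
  have "f' h = space_grad \<psi> (x, t) \<bullet> h" for h
  proof -
    interpret linear f' using has_derivative_linear[OF d] .
    have "f' h = f' (\<Sum>i\<in>UNIV. h $ i *\<^sub>R axis i 1)"
      using basis_expansion[of h] by (simp add: scalar_mult_eq_scaleR)
    also have "\<dots> = (\<Sum>i\<in>UNIV. h $ i * f' (axis i 1))" by (simp add: sum scaleR)
    finally show ?thesis by (simp add: space_grad_def f'_def inner_vec_def mult.commute)
  qed
  then show "((\<lambda>y. \<psi> (y, t)) has_derivative (\<lambda>h. space_grad \<psi> (x, t) \<bullet> h)) (at x)"
    using d by (metis has_derivative_eq_rhs ext)
  show "((\<lambda>y. space_grad \<psi> (y, t)) has_derivative (\<lambda>h. space_hess \<psi> (x, t) *v h)) (at x)"
    using assms xt unfolding test_function_def space_hess_def by (auto simp: jacobian_works)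
  show "((\<lambda>s. \<psi> (x, s)) has_real_derivative time_deriv \<psi> (x, t)) (at t)"
    using assms xt unfolding test_function_def time_deriv_def
    by (auto simp: DERIV_deriv_iff_real_differentiable)
qed (use assms in \<open>auto simp: test_function_def\<close>)

lemma C21_on_add:
  assumes "C21_on Q \<psi>1 g1 X1 \<tau>1" "C21_on Q \<psi>2 g2 X2 \<tau>2"
  shows "C21_on Q (\<lambda>z. \<psi>1 z + \<psi>2 z) (\<lambda>z. g1 z + g2 z) (\<lambda>z. X1 z + X2 z) (\<lambda>z. \<tau>1 z + \<tau>2 z)"
proof -
  note D1 = C21_onD[OF assms(1)] and D2 = C21_onD[OF assms(2)]
  show ?thesis
    unfolding C21_on_def inner_add_left matrix_vector_mult_add_rdistrib
    by (intro conjI allI impI continuous_intros DERIV_add has_derivative_add D1 D2)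
qed

lemma C21_on_compose:
  assumes C: "C21_on Q \<psi> g X \<tau>"
    and \<phi>: "\<And>s. (\<phi> has_real_derivative \<phi>' s) (at s)" "\<And>s. (\<phi>' has_real_derivative \<phi>'' s) (at s)"
      "continuous_on UNIV \<phi>''"
  shows "C21_on Q (\<lambda>z. \<phi> (\<psi> z)) (\<lambda>z. \<phi>' (\<psi> z) *\<^sub>R g z)
    (\<lambda>z. \<phi>' (\<psi> z) *\<^sub>R X z + \<phi>'' (\<psi> z) *\<^sub>R outer (g z) (g z)) (\<lambda>z. \<phi>' (\<psi> z) * \<tau> z)"
proof -
  note D = C21_onD[OF C]
  have c: "continuous_on UNIV \<phi>" "continuous_on UNIV \<phi>'"
    using \<phi> by (meson DERIV_continuous continuous_at_imp_continuous_on)+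
  have cc: "continuous_on Q (\<lambda>z. f (\<psi> z))" if "continuous_on UNIV f" for f :: "real \<Rightarrow> real"
    using continuous_on_compose2[OF that D(4)] by simp
  note d0 = has_derivative_compose[OF _ \<phi>(1)[unfolded has_field_derivative_def]]
  note d1 = has_derivative_compose[OF _ \<phi>(2)[unfolded has_field_derivative_def]]
  show ?thesis
    unfolding C21_on_def
  proof (intro conjI allI impI)
    fix x t assume xt: "(x, t) \<in> Q"
    show "((\<lambda>y. \<phi> (\<psi> (y, t))) has_derivative (\<lambda>h. (\<phi>' (\<psi> (x, t)) *\<^sub>R g (x, t)) \<bullet> h)) (at x)"
      using d0[OF D(1)[OF xt]] by simp
    show "((\<lambda>y. \<phi>' (\<psi> (y, t)) *\<^sub>R g (y, t)) has_derivative
       (\<lambda>h. (\<phi>' (\<psi> (x, t)) *\<^sub>R X (x, t) + \<phi>'' (\<psi> (x, t)) *\<^sub>R outer (g (x, t)) (g (x, t))) *v h)) (at x)"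
      using has_derivative_scaleR[OF d1[OF D(1)[OF xt]] D(2)[OF xt]]
      by (simp add: matrix_vector_mult_add_rdistrib scaleR_matrix_vector_mult outer_mult_vec)
    show "((\<lambda>s. \<phi> (\<psi> (x, s))) has_real_derivative \<phi>' (\<psi> (x, t)) * \<tau> (x, t)) (at t)"
      using DERIV_chain2[OF \<phi>(1) D(3)[OF xt]] .
  qed (use cc[OF c(1)] cc[OF c(2)] cc[OF \<phi>(3)] D(5-7) in \<open>auto intro!: continuous_intros\<close>)
qed

lemma C21_on_time_mult:
  assumes C: "C21_on Q \<psi> g X \<tau>"
    and \<theta>: "\<And>s. (\<theta> has_real_derivative \<theta>' s) (at s)" "continuous_on UNIV \<theta>'"
  shows "C21_on Q (\<lambda>z. \<theta> (snd z) * \<psi> z) (\<lambda>z. \<theta> (snd z) *\<^sub>R g z) (\<lambda>z. \<theta> (snd z) *\<^sub>R X z)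
    (\<lambda>z. \<theta>' (snd z) * \<psi> z + \<theta> (snd z) * \<tau> z)"
proof -
  note D = C21_onD[OF C]
  have c: "continuous_on UNIV \<theta>"
    using \<theta> by (meson DERIV_continuous continuous_at_imp_continuous_on)
  have cc: "continuous_on Q (\<lambda>z. f (snd z))" if "continuous_on UNIV f" for f :: "real \<Rightarrow> real"
    using continuous_on_compose2[OF that continuous_on_snd[OF continuous_on_id]] by simp
  show ?thesis
    unfolding C21_on_def
  proof (intro conjI allI impI)
    fix x t assume xt: "(x, t) \<in> Q"
    show "((\<lambda>y. \<theta> (snd (y, t)) * \<psi> (y, t)) has_derivative (\<lambda>h. (\<theta> (snd (x, t)) *\<^sub>R g (x, t)) \<bullet> h)) (at x)"
      using has_derivative_mult_right[OF D(1)[OF xt], of "\<theta> t"] by simp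
    show "((\<lambda>y. \<theta> (snd (y, t)) *\<^sub>R g (y, t)) has_derivative (\<lambda>h. (\<theta> (snd (x, t)) *\<^sub>R X (x, t)) *v h)) (at x)"
      using has_derivative_scaleR_right[OF D(2)[OF xt], of "\<theta> t"] by (simp add: scaleR_matrix_vector_mult)
    show "((\<lambda>s. \<theta> (snd (x, s)) * \<psi> (x, s)) has_real_derivative
        \<theta>' (snd (x, t)) * \<psi> (x, t) + \<theta> (snd (x, t)) * \<tau> (x, t)) (at t)"
      using DERIV_mult[OF \<theta>(1) D(3)[OF xt]] by (simp add: mult.commute)
  qed (use cc[OF c] cc[OF \<theta>(2)] D(4-7) in \<open>auto intro!: continuous_intros\<close>)
qed

lemma C21_on_const:
  fixes Q :: "((real ^ 'n) \<times> real) set"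
  shows "C21_on Q (\<lambda>z. c) (\<lambda>z. 0) (\<lambda>z. 0) (\<lambda>z. 0)"
proof -
  have "(*v) 0 = (\<lambda>h::real ^ 'n. 0::real ^ 'n)" "(\<bullet>) 0 = (\<lambda>h::real ^ 'n. 0)"
    by (auto simp: fun_eq_iff matrix_vector_mult_def vec_eq_iff)
  then show ?thesis unfolding C21_on_def by simp
qed

lemma C21_on_time:
  assumes "\<And>s. (\<theta> has_real_derivative \<theta>' s) (at s)" "continuous_on UNIV \<theta>'"
  shows "C21_on Q (\<lambda>z. \<theta> (snd z)) (\<lambda>z. 0) (\<lambda>z. 0) (\<lambda>z. \<theta>' (snd z))"
  using C21_on_time_mult[OF C21_on_const[of Q 1] assms] by simp

lemma C21_on_dist_sq:
  "C21_on Q (\<lambda>z. (norm (fst z - a))\<^sup>2) (\<lambda>z. 2 *\<^sub>R (fst z - a)) (\<lambda>z. 2 *\<^sub>R mat 1) (\<lambda>z. 0)"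
  unfolding C21_on_def power2_norm_eq_inner
  by (auto intro!: derivative_eq_intros continuous_intros
      simp: scaleR_matrix_vector_mult inner_commute)

lemma C21_on_shift:
  assumes "C21_on UNIV \<psi> g X \<tau>"
  shows "C21_on UNIV (\<lambda>z. \<psi> (z + a)) (\<lambda>z. g (z + a)) (\<lambda>z. X (z + a)) (\<lambda>z. \<tau> (z + a))"
proof -
  note D = C21_onD[OF assms]
  obtain b c where a: "a = (b, c)" by force
  have c: "continuous_on UNIV (\<lambda>z. f (z + a))" if "continuous_on UNIV f"
    for f :: "(real ^ 'a) \<times> real \<Rightarrow> 'c::topological_space"
    using continuous_on_compose2[OF that, of UNIV "\<lambda>z. z + a"] by (simp add: continuous_on_add continuous_on_id)
  show ?thesis
    unfolding C21_on_def
  proof (intro conjI allI impI)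
    fix x t
    have s: "((\<lambda>y. y + b) has_derivative (\<lambda>h. h)) (at x)" by (auto intro!: derivative_eq_intros)
    show "((\<lambda>y. \<psi> ((y, t) + a)) has_derivative (\<lambda>h. g ((x, t) + a) \<bullet> h)) (at x)"
      using has_derivative_compose[OF s D(1)[of "x + b" "t + c"]] by (simp add: a)
    show "((\<lambda>y. g ((y, t) + a)) has_derivative (\<lambda>h. X ((x, t) + a) *v h)) (at x)"
      using has_derivative_compose[OF s D(2)[of "x + b" "t + c"]] by (simp add: a)
    show "((\<lambda>s. \<psi> ((x, s) + a)) has_real_derivative \<tau> ((x, t) + a)) (at t)"
      using DERIV_shift[of "\<lambda>s. \<psi> (x + b, s)" "\<tau> (x + b, t + c)" t c] D(3)[of "x + b" "t + c"] by (simp add: a)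
  qed (use c D(4-7) in auto)
qed

text \<open>Restriction to lines reduces everything to one variable. The Hessians are compared as
  quadratic forms, which is how \<open>plap_mono\<close> uses them. The time derivatives agree
  because \<open>Q\<close> is open in time as well.\<close>

lemma C21_on_local_max:
  assumes "open Q" "z \<in> Q" and C: "C21_on Q \<psi>1 g1 X1 \<tau>1" "C21_on Q \<psi>2 g2 X2 \<tau>2"
    and mx: "eventually (\<lambda>w. \<psi>1 w - \<psi>2 w \<le> \<psi>1 z - \<psi>2 z) (at z)"
  shows "g1 z = g2 z" "\<tau>1 z = \<tau>2 z" "\<xi> \<bullet> (X1 z *v \<xi>) \<le> \<xi> \<bullet> (X2 z *v \<xi>)"
proof -
  obtain x t where z: "z = (x, t)" by force
  obtain e1 where e1: "e1 > 0" "\<And>w. dist w z < e1 \<Longrightarrow> \<psi>1 w - \<psi>2 w \<le> \<psi>1 z - \<psi>2 z"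
    using mx unfolding eventually_at by (metis UNIV_I order_refl)
  obtain e2 where e2: "e2 > 0" "\<And>w. dist w z < e2 \<Longrightarrow> w \<in> Q"
    using assms(1,2) unfolding open_dist by blast
  define e where "e = min e1 e2"
  have e: "e > 0" "\<And>w. dist w z < e \<Longrightarrow> w \<in> Q" "\<And>w. dist w z < e \<Longrightarrow> \<psi>1 w - \<psi>2 w \<le> \<psi>1 z - \<psi>2 z"
    using e1 e2 by (auto simp: e_def)
  have main: "g1 z \<bullet> \<xi> = g2 z \<bullet> \<xi> \<and> \<xi> \<bullet> (X1 z *v \<xi>) \<le> \<xi> \<bullet> (X2 z *v \<xi>)" for \<xi>
  proof -
    define \<delta> where "\<delta> = e / (norm \<xi> + 1)"
    have \<delta>: "\<delta> > 0" unfolding \<delta>_def using e(1) by (simp add: add_nonneg_pos)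
    have near: "dist (x + s *\<^sub>R \<xi>, t) z < e" if "\<bar>s\<bar> < \<delta>" for s
    proof -
      have "\<bar>s\<bar> * norm \<xi> \<le> \<bar>s\<bar> * (norm \<xi> + 1)" by (simp add: mult_left_mono)
      also have "\<dots> < e" using that unfolding \<delta>_def by (simp add: pos_less_divide_eq add_nonneg_pos)
      finally show ?thesis by (simp add: z dist_Pair_Pair dist_norm)
    qed
    have line: "((\<lambda>s. x + s *\<^sub>R \<xi>) has_derivative (\<lambda>h. h *\<^sub>R \<xi>)) (at s)" for s
      by (auto intro!: derivative_eq_intros)
    have d1: "((\<lambda>s. \<psi>1 (x + s *\<^sub>R \<xi>, t) - \<psi>2 (x + s *\<^sub>R \<xi>, t)) has_real_derivative
        (g1 (x + s *\<^sub>R \<xi>, t) - g2 (x + s *\<^sub>R \<xi>, t)) \<bullet> \<xi>) (at s)" if "\<bar>s\<bar> < \<delta>" for s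
      by (rule has_derivative_imp_has_field_derivative[OF has_derivative_diff[OF
          has_derivative_compose[OF line C21_onD(1)[OF C(1) e(2)[OF near[OF that]]]]
          has_derivative_compose[OF line C21_onD(1)[OF C(2) e(2)[OF near[OF that]]]]]])
         (simp add: inner_diff_left algebra_simps)
    have "(x + 0 *\<^sub>R \<xi>, t) \<in> Q" using assms(2) z by simp
    then have "((\<lambda>s. (g1 (x + s *\<^sub>R \<xi>, t) - g2 (x + s *\<^sub>R \<xi>, t)) \<bullet> \<xi>) has_derivative
        (\<lambda>h. (X1 (x + 0 *\<^sub>R \<xi>, t) *v (h *\<^sub>R \<xi>) - X2 (x + 0 *\<^sub>R \<xi>, t) *v (h *\<^sub>R \<xi>)) \<bullet> \<xi>)) (at 0)"
      by (intro has_derivative_inner_left has_derivative_diff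
          has_derivative_compose[OF line C21_onD(2)[OF C(1)]]
          has_derivative_compose[OF line C21_onD(2)[OF C(2)]])
    then have d2: "((\<lambda>s. (g1 (x + s *\<^sub>R \<xi>, t) - g2 (x + s *\<^sub>R \<xi>, t)) \<bullet> \<xi>) has_real_derivative
        \<xi> \<bullet> (X1 z *v \<xi>) - \<xi> \<bullet> (X2 z *v \<xi>)) (at 0)"
      by (rule has_derivative_imp_has_field_derivative)
         (simp add: z matrix_vector_mult_scaleR inner_diff_left inner_commute[of \<xi>] algebra_simps)
    note second_derivative_at_max[OF \<delta> d1 d2]
    moreover have "\<psi>1 (x + s *\<^sub>R \<xi>, t) - \<psi>2 (x + s *\<^sub>R \<xi>, t) \<le> \<psi>1 (x + 0 *\<^sub>R \<xi>, t) - \<psi>2 (x + 0 *\<^sub>R \<xi>, t)"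
      if "\<bar>s\<bar> < \<delta>" for s
      using e(3)[OF near[OF that]] by (simp add: z)
    ultimately show ?thesis by (simp add: z inner_diff_left)
  qed
  then show "g1 z = g2 z" by (metis vector_eq_rdot)
  show "\<xi> \<bullet> (X1 z *v \<xi>) \<le> \<xi> \<bullet> (X2 z *v \<xi>)" using main by blast
  have "((\<lambda>s. \<psi>1 (x, s) - \<psi>2 (x, s)) has_real_derivative (\<tau>1 z - \<tau>2 z)) (at t)"
    using assms(2) unfolding z by (intro DERIV_diff C21_onD(3)[OF C(1)] C21_onD(3)[OF C(2)])
  moreover have "\<psi>1 (x, s) - \<psi>2 (x, s) \<le> \<psi>1 (x, t) - \<psi>2 (x, t)" if "\<bar>t - s\<bar> < e" for s
    using e(3)[of "(x, s)"] that by (simp add: z dist_Pair_Pair dist_real_def abs_minus_commute)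
  ultimately have "\<tau>1 z - \<tau>2 z = 0" using DERIV_local_max[of _ _ t e] e(1) by blast
  then show "\<tau>1 z = \<tau>2 z" by simp
qed

section \<open>The \<open>p\<close>-Laplacian as a function of gradient and Hessian\<close>

definition plap :: "real \<Rightarrow> real ^ 'n \<Rightarrow> real ^ 'n ^ 'n \<Rightarrow> real"
  where "plap p g X = (if g \<noteq> 0 then
        norm g powr (p - 2) * trace X
        + (p - 2) * norm g powr (p - 4) * (\<Sum>i\<in>UNIV. \<Sum>j\<in>UNIV. g $ i * g $ j * X $ i $ j)
      else if p = 2 then trace X else 0)"

lemma p_laplacian_eq_plap: "p_laplacian p \<psi> z = plap p (space_grad \<psi> z) (space_hess \<psi> z)"
  by (simp add: p_laplacian_def plap_def Let_def)

text \<open>The separate case \<open>p = 2\<close> is needed at \<open>g = 0\<close>, because \<open>0 powr 0 = 0\<close>.\<close>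

definition pweight :: "real \<Rightarrow> real ^ 'n \<Rightarrow> real"
  where "pweight p g = (if p = 2 then 1 else norm g powr (p - 2))"

lemma pweight_nonneg: "pweight p g \<ge> 0"
  by (simp add: pweight_def)

lemma plap_alt:
  "plap p g X = pweight p g * trace X + (p - 2) * norm g powr (p - 4) * (g \<bullet> (X *v g))"
proof -
  have "(\<Sum>i\<in>UNIV. \<Sum>j\<in>UNIV. g $ i * g $ j * X $ i $ j) = g \<bullet> (X *v g)"
    by (simp add: inner_vec_def matrix_vector_mult_def sum_distrib_left mult_ac)
  then show ?thesis by (auto simp: plap_def pweight_def)
qed

lemma plap_add: "plap p g (X + Y) = plap p g X + plap p g Y"
  by (simp add: plap_alt trace_add matrix_vector_mult_add_rdistrib inner_add_right algebra_simps)

lemma trace_scaleR: "trace (c *\<^sub>R X) = c * trace X" for X :: "real ^ 'n ^ 'n"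
  by (simp add: trace_def sum_distrib_left)

lemma plap_scaleR: "plap p g (c *\<^sub>R X) = c * plap p g X"
  by (simp add: plap_alt trace_scaleR scaleR_matrix_vector_mult algebra_simps)

lemma trace_eq_sum: "trace X = (\<Sum>i\<in>UNIV. axis i 1 \<bullet> (X *v axis i 1))" for X :: "real ^ 'n ^ 'n"
  by (simp add: trace_def matrix_vector_mult_basis column_def inner_axis' )

text \<open>Degenerate ellipticity: the coefficient of the trace and, as \<open>p \<ge> 2\<close>,
  that of the quadratic form at \<open>g\<close> are nonnegative, and the trace is a sum of values
  of the quadratic form.\<close>

lemma plap_mono:
  assumes "p \<ge> 2" "\<And>\<xi>. \<xi> \<bullet> (X *v \<xi>) \<le> \<xi> \<bullet> (Y *v \<xi>)"
  shows "plap p g X \<le> plap p g Y"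
  unfolding plap_alt trace_eq_sum
  using assms by (intro add_mono mult_left_mono sum_mono) (auto simp: pweight_nonneg)

lemma plap_minus: "plap p (- g) (- X) = - plap p g X"
proof -
  have "(- X) *v (- g) = X *v g" by (simp add: matrix_vector_mult_def vec_eq_iff)
  moreover have "trace (- X) = - trace X" using trace_scaleR[of "-1" X] by simp
  ultimately show ?thesis by (simp add: plap_alt pweight_def)
qed

text \<open>\<open>p - 1\<close> is also the degree of \<open>u powr (p - 2) * u_t\<close> in
  \<open>u\<close>, so positive factors cancel from the equation. Both the logarithm and the
  separated barriers depend on this.\<close>

lemma plap_homogeneous:
  assumes "k > 0"
  shows "plap p (k *\<^sub>R g) (k *\<^sub>R X) = k powr (p - 1) * plap p g X"
proof -
  have 1: "k powr (p - 2) * k = k powr (p - 1)"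
    using assms powr_add[of k "p - 2" 1] by simp
  have 2: "k powr (p - 4) * (k * k * k) = k powr (p - 1)"
    using assms powr_add[of k "p - 4" 3] by (simp add: power3_eq_cube)
  have w: "pweight p (k *\<^sub>R g) * k = k powr (p - 1) * pweight p g"
    using assms 1 by (auto simp: pweight_def powr_mult mult_ac)
  have "plap p (k *\<^sub>R g) (k *\<^sub>R X) = (pweight p (k *\<^sub>R g) * k) * trace X
      + (p - 2) * (k powr (p - 4) * (k * k * k)) * norm g powr (p - 4) * (g \<bullet> (X *v g))"
    using assms by (simp add: plap_alt trace_scaleR scaleR_matrix_vector_mult matrix_vector_mult_scaleR
        powr_mult algebra_simps)
  then show ?thesis unfolding w 2 by (simp add: plap_alt algebra_simps)
qed

lemma plap_scale_grad:
  assumes "k > 0"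
  shows "plap p (k *\<^sub>R g) X = k powr (p - 2) * plap p g X"
proof -
  have "plap p (k *\<^sub>R g) X = plap p (k *\<^sub>R g) (k *\<^sub>R ((1 / k) *\<^sub>R X))" using assms by simp
  also have "\<dots> = (k powr (p - 1) / k) * plap p g X"
    by (subst plap_homogeneous[OF assms], subst plap_scaleR) simp
  also have "k powr (p - 1) / k = k powr (p - 2)"
    using assms powr_diff[of k "p - 1" 1] by (simp add: algebra_simps)
  finally show ?thesis .
qed

text \<open>The Hessian of \<open>exp v\<close> contains the outer square of the gradient of
  \<open>v\<close>; this is the origin of the term \<open>(p - 1) * |Dv|^p\<close> in the
  logarithmic equation.\<close>

lemma plap_outer:
  assumes "p \<ge> 2"
  shows "plap p g (outer g g) = (p - 1) * norm g powr p"
proof (cases "g = 0")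
  case False
  have "norm g powr (p - 2) * (norm g)\<^sup>2 = norm g powr p" "norm g powr (p - 4) * (norm g) ^ 4 = norm g powr p"
    using False powr_add[of "norm g" "p - 2" 2] powr_add[of "norm g" "p - 4" 4] by simp_all
  moreover have "pweight p g * (norm g)\<^sup>2 = norm g powr (p - 2) * (norm g)\<^sup>2"
    using False by (simp add: pweight_def)
  moreover have "(g \<bullet> g) * (g \<bullet> g) = (norm g) ^ 4"
    by (simp add: power2_norm_eq_inner[symmetric] power_add[symmetric])
  ultimately show ?thesis
    by (simp add: plap_alt trace_outer outer_mult_vec mult.assoc power2_norm_eq_inner[symmetric])
      (simp add: algebra_simps)
qed (use assms in \<open>simp add: plap_alt outer_def trace_def\<close>)

lemma plap_mat_1: "plap p g (mat 1) = pweight p g * CARD('n) + (p - 2) * norm g powr (p - 4) * (norm g)\<^sup>2"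
  for g :: "real ^ 'n"
  by (simp add: plap_alt trace_I power2_norm_eq_inner)

text \<open>The coefficient matrix of \<open>plap\<close> as a linear form in the Hessian. For
  \<open>p \<ge> 2\<close> its entries are continuous also at \<open>g = 0\<close>, in contrast to
  the factor \<open>norm g powr (p - 4)\<close>.\<close>

definition pcoef :: "real \<Rightarrow> real ^ 'n \<Rightarrow> 'n \<Rightarrow> 'n \<Rightarrow> real"
  where "pcoef p g i j = (if i = j then pweight p g else 0) + (p - 2) * norm g powr (p - 4) * (g $ i * g $ j)"

lemma plap_eq_sum: "plap p g X = (\<Sum>i\<in>UNIV. \<Sum>j\<in>UNIV. pcoef p g i j * X $ i $ j)"
proof -
  have "(\<Sum>j\<in>UNIV. X $ i $ j * (if i = j then pweight p g else 0)) = pweight p g * X $ i $ i" for i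
    by (subst sum.cong[OF refl, of _ _ "\<lambda>j. if j = i then pweight p g * X $ i $ i else 0"]) auto
  then show ?thesis
    unfolding pcoef_def distrib_right sum.distrib plap_alt
    by (simp add: trace_def inner_vec_def matrix_vector_mult_def sum_distrib_left mult_ac)
qed

lemma continuous_pcoef:
  fixes i j :: "'n::finite"
  assumes "p \<ge> 2"
  shows "continuous_on UNIV (\<lambda>g. pcoef p g i j)"
proof (cases "p = 2")
  case True
  then show ?thesis by (cases "i = j") (simp_all add: pcoef_def pweight_def)
next
  case False
  then have p: "p > 2" using assms by simp
  have w: "continuous_on UNIV (\<lambda>g::real ^ 'n. norm g powr (p - 2))"
    using p by (intro continuous_on_powr' continuous_intros) auto
  have "isCont (\<lambda>g. norm g powr (p - 4) * (g $ i * g $ j)) g" for g :: "real ^ 'n"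
  proof (cases "g = 0")
    case False
    then show ?thesis by (intro continuous_intros) auto
  next
    case True
    \<comment> \<open>The two components of \<open>h\<close> compensate the possibly negative
      exponent \<open>p - 4\<close>, and the resulting bound tends to 0 because \<open>p > 2\<close>
      here.\<close>
    have b: "\<bar>norm h powr (p - 4) * (h $ i * h $ j)\<bar> \<le> norm h powr (p - 2)" for h :: "real ^ 'n"
    proof (cases "h = 0")
      case False
      have "\<bar>norm h powr (p - 4) * (h $ i * h $ j)\<bar> = norm h powr (p - 4) * (\<bar>h $ i\<bar> * \<bar>h $ j\<bar>)"
        by (simp add: abs_mult)
      also have "\<dots> \<le> norm h powr (p - 4) * (norm h * norm h)"
        by (intro mult_left_mono mult_mono component_le_norm_cart) auto
      also have "\<dots> = norm h powr (p - 2)"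
        using False powr_add[of "norm h" "p - 4" 2] by (simp add: power2_eq_square)
      finally show ?thesis .
    qed simp
    have "((\<lambda>h::real ^ 'n. norm h powr (p - 2)) \<longlongrightarrow> 0) (at 0)"
      using w p by (auto simp: continuous_on_eq_continuous_at isCont_def dest!: spec[of _ 0])
    then have "((\<lambda>h::real ^ 'n. norm h powr (p - 4) * (h $ i * h $ j)) \<longlongrightarrow> 0) (at 0)"
      by (rule Lim_null_comparison[rotated]) (use b in auto)
    then show ?thesis using True by (simp add: isCont_def)
  qed
  then have "continuous_on UNIV (\<lambda>g. norm g powr (p - 4) * (g $ i * g $ j))"
    by (simp add: continuous_at_imp_continuous_on)
  then show ?thesis
    unfolding pcoef_def pweight_def mult.assoc using False w
    by (cases "i = j") (auto intro!: continuous_intros)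
qed

lemma continuous_on_plap:
  assumes "p \<ge> 2" "continuous_on S g" "continuous_on S X"
  shows "continuous_on S (\<lambda>z. plap p (g z) (X z))"
  unfolding plap_eq_sum
  by (intro continuous_on_sum continuous_on_mult
      continuous_on_compose2[OF continuous_pcoef[OF assms(1)] assms(2)] continuous_intros assms) auto

section \<open>Semicontinuity and sup-convolution\<close>

lemma upper_semicont_onI:
  assumes "\<And>z c. z \<in> S \<Longrightarrow> u z < c \<Longrightarrow> \<exists>U. open U \<and> z \<in> U \<and> (\<forall>w\<in>U \<inter> S. u w < c)"
  shows "upper_semicont_on S u"
  unfolding upper_semicont_on_def eventually_at_topological
proof (intro ballI allI impI)
  fix z c assume "z \<in> S" "u z < c"
  then obtain U where "open U" "z \<in> U" "\<forall>w\<in>U \<inter> S. u w < c" using assms by blast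
  then show "\<exists>U. open U \<and> z \<in> U \<and> (\<forall>w\<in>U. w \<noteq> z \<longrightarrow> w \<in> S \<longrightarrow> u w < c)"
    by (intro exI[of _ U]) simp
qed

lemma upper_semicont_onD:
  assumes "upper_semicont_on S u" "z \<in> S" "u z < c"
  obtains U where "open U" "z \<in> U" "\<And>w. w \<in> U \<Longrightarrow> w \<in> S \<Longrightarrow> u w < c"
proof -
  obtain U where "open U" "z \<in> U" "\<forall>w\<in>U. w \<noteq> z \<longrightarrow> w \<in> S \<longrightarrow> u w < c"
    using assms unfolding upper_semicont_on_def eventually_at_topological by blast
  with assms(3) that show ?thesis by metis
qed

lemma lower_semicont_on_iff: "lower_semicont_on S u \<longleftrightarrow> upper_semicont_on S (\<lambda>z. - u z)"
proof -
  have "(\<forall>c<u z. eventually (\<lambda>w. c < u w) (at z within S)) \<longleftrightarrow>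
        (\<forall>c>- u z. eventually (\<lambda>w. - u w < c) (at z within S))" (is "?L \<longleftrightarrow> ?R") for z
  proof
    assume L: ?L
    show ?R
    proof (intro allI impI)
      fix c assume "- u z < c"
      then have "eventually (\<lambda>w. - c < u w) (at z within S)" using L[rule_format, of "- c"] by simp
      then show "eventually (\<lambda>w. - u w < c) (at z within S)" by eventually_elim simp
    qed
  next
    assume R: ?R
    show ?L
    proof (intro allI impI)
      fix c assume "c < u z"
      then have "eventually (\<lambda>w. - u w < - c) (at z within S)" using R[rule_format, of "- c"] by simp
      then show "eventually (\<lambda>w. c < u w) (at z within S)" by eventually_elim simp
    qed
  qed
  then show ?thesis by (simp add: lower_semicont_on_def upper_semicont_on_def)
qed

lemma upper_semicont_on_subset: "upper_semicont_on S u \<Longrightarrow> R \<subseteq> S \<Longrightarrow> upper_semicont_on R u"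
  unfolding upper_semicont_on_def
  by (meson at_le filter_leD subsetD)

lemma lower_semicont_on_subset: "lower_semicont_on S u \<Longrightarrow> R \<subseteq> S \<Longrightarrow> lower_semicont_on R u"
  unfolding lower_semicont_on_iff by (rule upper_semicont_on_subset)

lemma lower_semicont_on_cong:
  assumes eq: "\<And>z. z \<in> S \<Longrightarrow> v z = u z" and u: "lower_semicont_on S u"
  shows "lower_semicont_on S v"
  unfolding lower_semicont_on_def
proof (intro ballI allI impI)
  fix z c assume z: "z \<in> S" "c < v z"
  then have "eventually (\<lambda>w. c < u w) (at z within S)"
    using u eq unfolding lower_semicont_on_def by auto
  moreover have "eventually (\<lambda>w. w \<in> S) (at z within S)" by (simp add: eventually_at_filter)
  ultimately show "eventually (\<lambda>w. c < v w) (at z within S)" by eventually_elim (simp add: eq)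
qed

lemma eventually_within_open_ball:
  assumes "open Q" "z \<in> Q" "eventually P (at z within Q)" "P z"
  shows "\<exists>r>0. \<forall>w\<in>ball z r. P w"
proof -
  have "eventually P (nhds z)"
    using assms at_within_open[of z Q] by (simp add: eventually_nhds_conv_at)
  then show ?thesis unfolding eventually_nhds_metric by (simp add: dist_commute Ball_def)
qed

lemma continuous_on_imp_upper_semicont_on:
  fixes u :: "'a::topological_space \<Rightarrow> real"
  assumes "continuous_on S u"
  shows "upper_semicont_on S u"
proof (rule upper_semicont_onI)
  fix z c assume "z \<in> S" "u z < c"
  then obtain A where "open A" "z \<in> A" "\<forall>y\<in>S. y \<in> A \<longrightarrow> u y \<in> {..<c}"
    using assms unfolding continuous_on_topological by (metis lessThan_iff open_lessThan)
  then show "\<exists>U. open U \<and> z \<in> U \<and> (\<forall>w\<in>U \<inter> S. u w < c)" by auto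
qed

lemma continuous_on_imp_lower_semicont_on:
  "continuous_on S u \<Longrightarrow> lower_semicont_on S u"
  unfolding lower_semicont_on_iff
  by (intro continuous_on_imp_upper_semicont_on continuous_intros)

lemma upper_semicont_on_add:
  assumes "upper_semicont_on S f" "upper_semicont_on S g"
  shows "upper_semicont_on S (\<lambda>z. f z + g z)"
proof (rule upper_semicont_onI)
  fix z c assume z: "z \<in> S" and "f z + g z < c"
  define e where "e = (c - f z - g z) / 2"
  have "f z < f z + e" "g z < g z + e" using \<open>f z + g z < c\<close> by (auto simp: e_def)
  then obtain A B where "open A" "z \<in> A" "\<And>w. w \<in> A \<Longrightarrow> w \<in> S \<Longrightarrow> f w < f z + e"
    "open B" "z \<in> B" "\<And>w. w \<in> B \<Longrightarrow> w \<in> S \<Longrightarrow> g w < g z + e"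
    using upper_semicont_onD[OF assms(1) z] upper_semicont_onD[OF assms(2) z] by metis
  moreover have "(f z + e) + (g z + e) = c" by (simp add: e_def field_simps)
  ultimately show "\<exists>U. open U \<and> z \<in> U \<and> (\<forall>w\<in>U \<inter> S. f w + g w < c)"
    by (intro exI[of _ "A \<inter> B"]) (metis (no_types, lifting) IntE IntI add_strict_mono open_Int)
qed

lemma upper_semicont_on_compose:
  assumes f: "upper_semicont_on S f" and k: "continuous_on R k" "k ` R \<subseteq> S"
  shows "upper_semicont_on R (\<lambda>z. f (k z))"
proof (rule upper_semicont_onI)
  fix z c assume z: "z \<in> R" "f (k z) < c"
  then obtain A where A: "open A" "k z \<in> A" "\<And>w. w \<in> A \<Longrightarrow> w \<in> S \<Longrightarrow> f w < c"
    using upper_semicont_onD[OF f, of "k z" c] k(2) by blast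
  then obtain B where "open B" "z \<in> B" "\<forall>y\<in>R. y \<in> B \<longrightarrow> k y \<in> A"
    using k(1) z(1) unfolding continuous_on_topological by metis
  then show "\<exists>U. open U \<and> z \<in> U \<and> (\<forall>w\<in>U \<inter> R. f (k w) < c)"
    using A(3) k(2) by (intro exI[of _ B]) auto
qed

lemma upper_semicont_on_ln:
  assumes u: "upper_semicont_on S u" and pos: "\<And>z. z \<in> S \<Longrightarrow> 0 < u z"
  shows "upper_semicont_on S (\<lambda>z. ln (u z))"
proof (rule upper_semicont_onI)
  fix z c assume z: "z \<in> S" "ln (u z) < c"
  have "exp (ln (u z)) < exp c" using z(2) by (intro exp_less_mono) simp
  then have "u z < exp c" using pos[OF z(1)] by simp
  then obtain A where A: "open A" "z \<in> A" "\<And>w. w \<in> A \<Longrightarrow> w \<in> S \<Longrightarrow> u w < exp c"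
    using upper_semicont_onD[OF u z(1)] by metis
  have "ln (u w) < c" if "w \<in> A \<inter> S" for w
  proof -
    have "u w < exp c" "0 < u w" using A(3)[of w] pos[of w] that by auto
    then have "ln (u w) < ln (exp c)" by (subst ln_less_cancel_iff) auto
    then show ?thesis by simp
  qed
  then show "\<exists>U. open U \<and> z \<in> U \<and> (\<forall>w\<in>U \<inter> S. ln (u w) < c)"
    using A by (intro exI[of _ A]) auto
qed

lemma upper_semicont_on_minus_ln:
  assumes u: "lower_semicont_on S u" and pos: "\<And>z. z \<in> S \<Longrightarrow> 0 < u z"
  shows "upper_semicont_on S (\<lambda>z. - ln (u z))"
proof (rule upper_semicont_onI)
  fix z c assume z: "z \<in> S" "- ln (u z) < c"
  have "exp (- c) < exp (ln (u z))" using z(2) by (intro exp_less_mono) simp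
  then have "- u z < - exp (- c)" using pos[OF z(1)] by simp
  then obtain A where A: "open A" "z \<in> A" "\<And>w. w \<in> A \<Longrightarrow> w \<in> S \<Longrightarrow> - u w < - exp (- c)"
    using upper_semicont_onD[OF u[unfolded lower_semicont_on_iff] z(1)] by metis
  have "- ln (u w) < c" if "w \<in> A \<inter> S" for w
  proof -
    have "exp (- c) < u w" "0 < u w" using A(3)[of w] pos[of w] that by auto
    then have "ln (exp (- c)) < ln (u w)" by (subst ln_less_cancel_iff) auto
    then show ?thesis by simp
  qed
  then show "\<exists>U. open U \<and> z \<in> U \<and> (\<forall>w\<in>U \<inter> S. - ln (u w) < c)"
    using A by (intro exI[of _ A]) auto
qed

text \<open>Otherwise every \<open>z\<close> has a larger value at some \<open>s z\<close>, and the
  sets where \<open>u < u (s z)\<close> cover \<open>K\<close>. The largest \<open>u (s k)\<close>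
  of a finite subcover is the value at a point that one of these sets contains, a
  contradiction.\<close>

lemma upper_semicont_on_attains_sup:
  assumes "compact K" "K \<noteq> {}" and u: "upper_semicont_on K u"
  shows "\<exists>z\<in>K. \<forall>w\<in>K. u w \<le> u z"
proof (rule ccontr)
  assume "\<not> ?thesis"
  then obtain s where s: "\<And>z. z \<in> K \<Longrightarrow> s z \<in> K \<and> u z < u (s z)" by (metis not_le)
  have "\<exists>A. open A \<and> z \<in> A \<and> (\<forall>w\<in>A \<inter> K. u w < u (s z))" if "z \<in> K" for z
    using upper_semicont_onD[OF u that, of "u (s z)"] s[OF that] by (metis IntE)
  then obtain A where A: "\<And>z. z \<in> K \<Longrightarrow> open (A z)" "\<And>z. z \<in> K \<Longrightarrow> z \<in> A z"
    "\<And>z w. z \<in> K \<Longrightarrow> w \<in> A z \<Longrightarrow> w \<in> K \<Longrightarrow> u w < u (s z)" by (metis IntI)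
  obtain D where D: "D \<subseteq> K" "finite D" "K \<subseteq> \<Union> (A ` D)"
    using compactE_image[OF \<open>compact K\<close>, of K A] A by blast
  then have "D \<noteq> {}" using \<open>K \<noteq> {}\<close> by auto
  have "Max ((\<lambda>z. u (s z)) ` D) \<in> (\<lambda>z. u (s z)) ` D" using D \<open>D \<noteq> {}\<close> by (intro Max_in) auto
  then obtain k where "k \<in> D" and m: "Max ((\<lambda>z. u (s z)) ` D) = u (s k)" by auto
  have k: "k \<in> D" "\<And>z. z \<in> D \<Longrightarrow> u (s z) \<le> u (s k)"
    using \<open>k \<in> D\<close> D(2) by (auto simp flip: m)
  have "s k \<in> K" using s k(1) D(1) by blast
  then obtain z where "z \<in> D" "s k \<in> A z" using D(3) by auto
  then have "u (s k) < u (s z)" using A(3) D(1) \<open>s k \<in> K\<close> by blast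
  then show False using k(2)[OF \<open>z \<in> D\<close>] by simp
qed

text \<open>A relation rather than a function, because the contact points \<open>\<zeta>\<close> at
  which the supremum is attained are needed later. The quadratic penalty acts on space and time
  together, and \<open>S\<close> lives on the whole space.\<close>

definition is_supconv :: "'a::real_inner set \<Rightarrow> ('a \<Rightarrow> real) \<Rightarrow> real \<Rightarrow> ('a \<Rightarrow> real) \<Rightarrow> bool"
  where "is_supconv K f c S \<longleftrightarrow>
    (\<forall>z. (\<exists>\<zeta>\<in>K. S z = f \<zeta> - c / 2 * (norm (z - \<zeta>))\<^sup>2) \<and>
         (\<forall>\<zeta>\<in>K. f \<zeta> - c / 2 * (norm (z - \<zeta>))\<^sup>2 \<le> S z))"

lemma is_supconv_ex:
  assumes "compact K" "K \<noteq> {}" "upper_semicont_on K f"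
  shows "\<exists>S. is_supconv K f c S"
proof -
  have "\<exists>\<zeta>\<in>K. \<forall>\<xi>\<in>K. f \<xi> + - (c / 2 * (norm (z - \<xi>))\<^sup>2) \<le> f \<zeta> + - (c / 2 * (norm (z - \<zeta>))\<^sup>2)" for z
    by (intro upper_semicont_on_attains_sup assms upper_semicont_on_add
        continuous_on_imp_upper_semicont_on continuous_intros)
  then obtain \<zeta> where "\<And>z. \<zeta> z \<in> K" "\<And>z \<xi>. \<xi> \<in> K \<Longrightarrow>
      f \<xi> - c / 2 * (norm (z - \<xi>))\<^sup>2 \<le> f (\<zeta> z) - c / 2 * (norm (z - \<zeta> z))\<^sup>2"
    by (simp add: Bex_def) metis
  then show ?thesis
    by (intro exI[of _ "\<lambda>z. f (\<zeta> z) - c / 2 * (norm (z - \<zeta> z))\<^sup>2"]) (auto simp: is_supconv_def)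
qed

text \<open>\<open>S z + c / 2 * (norm z)\<^sup>2\<close> is a supremum of affine functions, hence
  convex on the whole space and therefore continuous.\<close>

lemma is_supconv_continuous:
  fixes S :: "'a::euclidean_space \<Rightarrow> real"
  assumes S: "is_supconv K f c S"
  shows "continuous_on UNIV S"
proof -
  have id: "f \<zeta> - c / 2 * (norm (z - \<zeta>))\<^sup>2 + c / 2 * (norm z)\<^sup>2 = f \<zeta> - c / 2 * (norm \<zeta>)\<^sup>2 + c * (z \<bullet> \<zeta>)" for z \<zeta>
    unfolding power2_norm_eq_inner by (simp add: inner_diff_left inner_diff_right inner_commute algebra_simps)
  have "convex_on UNIV (\<lambda>z. S z + c / 2 * (norm z)\<^sup>2)"
    unfolding convex_on_def
  proof (intro conjI ballI allI impI convex_UNIV)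
    fix x y :: 'a and a b :: real assume ab: "0 \<le> a" "0 \<le> b" "a + b = 1"
    define z where "z = a *\<^sub>R x + b *\<^sub>R y"
    obtain \<zeta> where \<zeta>: "\<zeta> \<in> K" "S z = f \<zeta> - c / 2 * (norm (z - \<zeta>))\<^sup>2"
      using S unfolding is_supconv_def by blast
    have le: "f \<zeta> - c / 2 * (norm \<zeta>)\<^sup>2 + c * (w \<bullet> \<zeta>) \<le> S w + c / 2 * (norm w)\<^sup>2" for w
      using S \<zeta>(1) unfolding is_supconv_def id[symmetric] by simp
    have "S z + c / 2 * (norm z)\<^sup>2 = f \<zeta> - c / 2 * (norm \<zeta>)\<^sup>2 + c * (z \<bullet> \<zeta>)"
      using id \<zeta>(2) by simp
    also have "\<dots> = (a + b) * (f \<zeta> - c / 2 * (norm \<zeta>)\<^sup>2) + c * (z \<bullet> \<zeta>)" by (simp add: ab(3))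
    also have "\<dots> = a * (f \<zeta> - c / 2 * (norm \<zeta>)\<^sup>2 + c * (x \<bullet> \<zeta>)) + b * (f \<zeta> - c / 2 * (norm \<zeta>)\<^sup>2 + c * (y \<bullet> \<zeta>))"
      by (simp add: z_def inner_add_left algebra_simps)
    also have "\<dots> \<le> a * (S x + c / 2 * (norm x)\<^sup>2) + b * (S y + c / 2 * (norm y)\<^sup>2)"
      by (rule add_mono[OF mult_left_mono[OF le[of x] ab(1)] mult_left_mono[OF le[of y] ab(2)]])
    finally show "S (a *\<^sub>R x + b *\<^sub>R y) + c / 2 * (norm (a *\<^sub>R x + b *\<^sub>R y))\<^sup>2
      \<le> a * (S x + c / 2 * (norm x)\<^sup>2) + b * (S y + c / 2 * (norm y)\<^sup>2)" by (simp add: z_def)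
  qed
  then have "continuous_on UNIV (\<lambda>z. (S z + c / 2 * (norm z)\<^sup>2) - c / 2 * (norm z)\<^sup>2)"
    by (intro continuous_on_diff convex_on_continuous continuous_intros) auto
  then show ?thesis by simp
qed

text \<open>Keeping the contact point of \<open>z\<close> while \<open>z\<close> moves gives a
  paraboloid below \<open>S\<close>; its gradient at \<open>z\<close> is
  \<open>c *\<^sub>R (\<zeta> - z)\<close>.\<close>

lemma is_supconv_lower:
  assumes S: "is_supconv K f c S" and \<zeta>: "\<zeta> \<in> K" "S z = f \<zeta> - c / 2 * (norm (z - \<zeta>))\<^sup>2"
  shows "S z + (c *\<^sub>R (\<zeta> - z)) \<bullet> k - c / 2 * (norm k)\<^sup>2 \<le> S (z + k)"
proof -
  have "f \<zeta> - c / 2 * (norm (z + k - \<zeta>))\<^sup>2 \<le> S (z + k)" using S \<zeta>(1) unfolding is_supconv_def by blast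
  then show ?thesis unfolding \<zeta>(2) power2_norm_eq_inner
    by (simp add: inner_diff_left inner_diff_right inner_add_left inner_add_right inner_commute algebra_simps)
qed

text \<open>A test function for \<open>S\<close> at \<open>z\<close>, translated by
  \<open>z - \<zeta>\<close>, tests \<open>f\<close> at the contact point: when \<open>\<xi>\<close>
  and \<open>\<xi> + (z - \<zeta>)\<close> move in parallel, the penalty stays constant.\<close>

lemma is_supconv_shift_test:
  assumes S: "is_supconv K f c S" and \<zeta>: "\<zeta> \<in> K" "S z = f \<zeta> - c / 2 * (norm (z - \<zeta>))\<^sup>2"
    and mx: "\<And>w. w \<in> ball z \<delta> \<Longrightarrow> S w - H w \<le> S z - H z"
    and \<xi>: "\<xi> \<in> K" "\<xi> \<in> ball \<zeta> \<delta>"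
  shows "f \<xi> - H (\<xi> + (z - \<zeta>)) \<le> f \<zeta> - H (\<zeta> + (z - \<zeta>))"
proof -
  have "f \<xi> - c / 2 * (norm (\<xi> + (z - \<zeta>) - \<xi>))\<^sup>2 \<le> S (\<xi> + (z - \<zeta>))"
    using S \<xi>(1) unfolding is_supconv_def by blast
  moreover have "\<xi> + (z - \<zeta>) \<in> ball z \<delta>" using \<xi>(2) by (simp add: dist_norm algebra_simps)
  ultimately show ?thesis using mx[of "\<xi> + (z - \<zeta>)"] \<zeta>(2) by simp
qed

text \<open>The lower paraboloid at \<open>z\<close> lies below the upper one at \<open>z0\<close>.
  Comparing them at distance \<open>r\<close> from \<open>z\<close> in the direction
  \<open>P - P0\<close>, where the quadratic terms are at most
  \<open>c / 2 * (r\<^sup>2 + (2 * r)\<^sup>2 + r\<^sup>2)\<close>, bounds the difference of the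
  slopes.\<close>

lemma touching_gradient_close:
  fixes P P0 :: "'a::real_inner"
  assumes lower: "\<And>k. S z + P \<bullet> k - c / 2 * (norm k)\<^sup>2 \<le> S (z + k)"
    and upper0: "\<And>k. S (z0 + k) \<le> S z0 + P0 \<bullet> k + c / 2 * (norm k)\<^sup>2"
    and lower0: "\<And>k. S z0 + P0 \<bullet> k - c / 2 * (norm k)\<^sup>2 \<le> S (z0 + k)"
    and r: "norm (z - z0) \<le> r" "r > 0" and "c \<ge> 0"
  shows "norm (P - P0) \<le> 3 * c * r"
proof (cases "P = P0")
  case False
  define h where "h = z - z0"
  define k where "k = (r / norm (P - P0)) *\<^sub>R (P - P0)"
  have nk: "norm k = r" using False r by (simp add: k_def)
  have hk: "norm (h + k) \<le> 2 * r" using norm_triangle_ineq[of h k] r nk by (simp add: h_def)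
  have "S z + P \<bullet> k - c / 2 * (norm k)\<^sup>2 \<le> S z0 + P0 \<bullet> (h + k) + c / 2 * (norm (h + k))\<^sup>2"
    using lower[of k] upper0[of "h + k"] by (simp add: h_def)
  moreover have "S z0 + P0 \<bullet> h - c / 2 * (norm h)\<^sup>2 \<le> S z" using lower0[of h] by (simp add: h_def)
  ultimately have "(P - P0) \<bullet> k \<le> c / 2 * ((norm k)\<^sup>2 + (norm (h + k))\<^sup>2 + (norm h)\<^sup>2)"
    by (simp add: inner_diff_left inner_add_right algebra_simps)
  also have "\<dots> \<le> c / 2 * (r\<^sup>2 + (2 * r)\<^sup>2 + r\<^sup>2)"
    using nk hk r \<open>c \<ge> 0\<close> by (intro mult_left_mono add_mono power_mono) (auto simp: h_def)
  also have "\<dots> = 3 * c * r * r" by (simp add: power2_eq_square)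
  also have "(P - P0) \<bullet> k = norm (P - P0) * r"
    using False by (simp add: k_def power2_norm_eq_inner[symmetric] power2_eq_square)
  finally show ?thesis using r by simp
qed (use r \<open>c \<ge> 0\<close> in simp)

section \<open>Freezing the coefficients\<close>

definition xgrad :: "((real ^ 'n) \<times> real \<Rightarrow> real) \<Rightarrow> (real ^ 'n) \<times> real \<Rightarrow> real ^ 'n"
  where "xgrad H z = (\<chi> i. pd (axis i 1, 0) H z)"

definition xhess :: "((real ^ 'n) \<times> real \<Rightarrow> real) \<Rightarrow> (real ^ 'n) \<times> real \<Rightarrow> real ^ 'n ^ 'n"
  where "xhess H z = (\<chi> i j. pd (axis j 1, 0) (pd (axis i 1, 0) H) z)"

lemma polyd_pd_space:
  fixes H :: "(real ^ 'n) \<times> real \<Rightarrow> real"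
  assumes "polyd d H"
  shows "pd (v, 0) H z = (\<Sum>i\<in>UNIV. v $ i * pd (axis i 1, 0) H z)"
proof -
  interpret linear "\<lambda>\<xi>. pd \<xi> H z" using has_derivative_linear[OF polyd_has_derivative[OF assms]] .
  have "(v, 0::real) = (\<Sum>i\<in>UNIV. v $ i *\<^sub>R (axis i 1, 0))"
    using basis_expansion[of v] by (simp add: scalar_mult_eq_scaleR prod_eq_iff fst_sum snd_sum)
  then have "pd (v, 0) H z = pd (\<Sum>i\<in>UNIV. v $ i *\<^sub>R (axis i 1, 0)) H z" by simp
  then show ?thesis by (simp only: sum scaleR real_scaleR_def)
qed

lemma polyd_pd_xgrad: "polyd d H \<Longrightarrow> pd (v, 0) H z = xgrad H z \<bullet> v"
  by (subst polyd_pd_space) (simp_all add: xgrad_def inner_vec_def mult.commute)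

lemma polyd_pd_xhess:
  assumes "polyd d H"
  shows "pd (v, 0) (pd (v, 0) H) z = v \<bullet> (xhess H z *v v)"
proof -
  note p = polyd_pd_polyd[OF assms]
  have s: "pd \<xi> (\<lambda>z. \<Sum>i\<in>I. v $ i * pd (axis i 1, 0) H z) z = (\<Sum>i\<in>I. v $ i * pd \<xi> (pd (axis i 1, 0) H) z)"
    for \<xi> and I :: "'a set"
    by (induction I rule: infinite_finite_induct)
      (simp_all add: pd_const pd_add[OF polyd_cmult[OF p] polyd_sum[OF polyd_cmult[OF p]]] pd_cmult[OF p])
  have "pd (v, 0) H = (\<lambda>z. \<Sum>i\<in>UNIV. v $ i * pd (axis i 1, 0) H z)"
    by (rule ext) (rule polyd_pd_space[OF assms])
  then have "pd (v, 0) (pd (v, 0) H) z = (\<Sum>i\<in>UNIV. v $ i * pd (v, 0) (pd (axis i 1, 0) H) z)"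
    using s by simp
  also have "\<dots> = (\<Sum>i\<in>UNIV. v $ i * (\<Sum>j\<in>UNIV. v $ j * xhess H z $ i $ j))"
    by (simp add: polyd_pd_space[OF p, of v] xhess_def)
  finally show ?thesis
    by (simp add: inner_vec_def matrix_vector_mult_def mult.commute)
qed

lemma polyd_C21_on:
  fixes H :: "(real ^ 'n) \<times> real \<Rightarrow> real"
  assumes "polyd d H"
  shows "C21_on Q H (xgrad H) (xhess H) (pd (0, 1) H)"
  unfolding C21_on_def
proof (intro conjI allI impI)
  fix x :: "real ^ 'n" and t :: real
  have lx: "((\<lambda>y. (y, t)) has_derivative (\<lambda>h. (h, 0))) (at x)" by (auto intro!: derivative_eq_intros)
  have lt: "((\<lambda>s. (x, s)) has_derivative (\<lambda>h. (0, h))) (at t)" by (auto intro!: derivative_eq_intros)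
  show "((\<lambda>y. H (y, t)) has_derivative (\<lambda>h. xgrad H (x, t) \<bullet> h)) (at x)"
    using has_derivative_compose[OF lx polyd_has_derivative[OF assms]]
    unfolding polyd_pd_xgrad[OF assms] .
  have "((\<lambda>y. \<chi> i. pd (axis i 1, 0) H (y, t)) has_derivative
      (\<lambda>h. \<chi> i. pd (h, 0) (pd (axis i 1, 0) H) (x, t))) (at x)"
    by (subst has_derivative_componentwise_within)
       (auto simp: Basis_vec_def inner_axis
         intro!: has_derivative_compose[OF lx polyd_has_derivative[OF polyd_pd_polyd[OF assms]]])
  moreover have "(\<chi> i. pd (h, 0) (pd (axis i 1, 0) H) (x, t)) = xhess H (x, t) *v h" for h
    by (simp add: vec_eq_iff xhess_def matrix_vector_mult_def mult.commute
        polyd_pd_space[OF polyd_pd_polyd[OF assms], of h])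
  ultimately show "((\<lambda>y. xgrad H (y, t)) has_derivative (\<lambda>h. xhess H (x, t) *v h)) (at x)"
    by (simp add: xgrad_def)
  have "h * pd (0, 1) H (x, t) = pd (0, h) H (x, t)" for h
    using linear_scale[OF has_derivative_linear[OF polyd_has_derivative[OF assms, of "(x, t)"]], of h "(0, 1)"]
    by simp
  then show "((\<lambda>s. H (x, s)) has_real_derivative pd (0, 1) H (x, t)) (at t)"
    by (rule has_derivative_imp_has_field_derivative[OF
          has_derivative_compose[OF lt polyd_has_derivative[OF assms]]])
qed (auto simp: xgrad_def xhess_def intro!: continuous_intros polyd_continuous_on[OF assms]
    polyd_continuous_on[OF polyd_pd_polyd[OF assms]]
    polyd_continuous_on[OF polyd_pd_polyd[OF polyd_pd_polyd[OF assms]]])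

text \<open>Positivity on \<open>axis i 1 + axis j 1\<close> and \<open>axis i 1 - axis j 1\<close>
  bounds each symmetrised entry of \<open>S\<close> by two diagonal ones. The symmetry of
  \<open>D\<close> is what allows \<open>S\<close> to be symmetrised.\<close>

lemma psd_double_sum_le:
  fixes S :: "real ^ 'n ^ 'n"
  assumes psd: "\<And>\<xi>. 0 \<le> \<xi> \<bullet> (S *v \<xi>)" and sym: "\<And>i j. D i j = D j i"
    and D: "\<And>i j. \<bar>D i j\<bar> \<le> e"
  shows "(\<Sum>i\<in>UNIV. \<Sum>j\<in>UNIV. D i j * S $ i $ j) \<le> e * CARD('n) * trace S"
proof -
  have bil: "axis i 1 \<bullet> (S *v axis j 1) = S $ i $ j" for i j
    by (simp add: matrix_vector_mult_basis column_def inner_axis')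
  have cross: "\<bar>S $ i $ j + S $ j $ i\<bar> \<le> S $ i $ i + S $ j $ j" for i j
    using psd[of "axis i 1 + axis j 1"] psd[of "axis i 1 - axis j 1"]
    by (simp add: matrix_vector_right_distrib matrix_vector_mult_diff_distrib
        inner_add_left inner_diff_left inner_add_right inner_diff_right bil)
  have "2 * (\<Sum>i\<in>UNIV. \<Sum>j\<in>UNIV. D i j * S $ i $ j)
      = (\<Sum>i\<in>UNIV. \<Sum>j\<in>UNIV. D i j * S $ i $ j) + (\<Sum>j\<in>UNIV. \<Sum>i\<in>UNIV. D i j * S $ i $ j)"
    using sum.swap[of "\<lambda>i j. D i j * S $ i $ j" UNIV UNIV] by simp
  also have "(\<Sum>j\<in>UNIV. \<Sum>i\<in>UNIV. D i j * S $ i $ j) = (\<Sum>i\<in>UNIV. \<Sum>j\<in>UNIV. D i j * S $ j $ i)"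
    by (intro sum.cong refl) (metis sym)
  also have "(\<Sum>i\<in>UNIV. \<Sum>j\<in>UNIV. D i j * S $ i $ j) + \<dots>
      = (\<Sum>i\<in>UNIV. \<Sum>j\<in>UNIV. D i j * (S $ i $ j + S $ j $ i))"
    by (simp add: distrib_left sum.distrib)
  also have "\<dots> \<le> (\<Sum>i\<in>UNIV. \<Sum>j\<in>UNIV. e * (S $ i $ i + S $ j $ j))"
  proof (intro sum_mono)
    fix i j
    have "D i j * (S $ i $ j + S $ j $ i) \<le> \<bar>D i j\<bar> * \<bar>S $ i $ j + S $ j $ i\<bar>"
      by (metis abs_ge_self abs_mult)
    also have "\<dots> \<le> e * (S $ i $ i + S $ j $ j)"
      using D[of i j] cross[of i j] by (intro mult_mono) auto
    finally show "D i j * (S $ i $ j + S $ j $ i) \<le> e * (S $ i $ i + S $ j $ j)" .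
  qed
  also have "\<dots> = 2 * (e * CARD('n) * trace S)"
    by (simp add: trace_def sum.distrib sum_distrib_left[symmetric] algebra_simps)
  finally show ?thesis by simp
qed

lemma pcoef_sym: "pcoef p g i j = pcoef p g j i"
  by (simp add: pcoef_def)

lemma plap_minus_grad: "plap p (- g) X = plap p g X"
proof -
  have "X *v (- g) = - (X *v g)" by (simp add: matrix_vector_mult_def vec_eq_iff sum_negf)
  then show ?thesis by (simp add: plap_alt pweight_def)
qed

text \<open>The lower bound \<open>- c\<close> on the Hessian lets the coefficients be frozen at \<open>g0\<close>, because a small
  multiple of the trace then absorbs the error.\<close>

lemma plap_freeze_coefficients:
  fixes g0 :: "real ^ 'n"
  assumes p: "p \<ge> 2" and "c \<ge> 0" and "\<omega> > 0"
  shows "\<exists>\<delta>>0. \<forall>g X \<tau> \<kappa>. norm (g - g0) < \<delta> \<longrightarrow> \<bar>\<tau> - \<tau>0\<bar> < \<delta> \<longrightarrow>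
    (\<forall>\<xi>. - c * (norm \<xi>)\<^sup>2 \<le> \<xi> \<bullet> (X *v \<xi>)) \<longrightarrow>
    \<kappa> \<le> plap p g X + \<sigma> * norm g powr p - (p - 1) * \<tau> \<longrightarrow>
    \<kappa> - \<sigma> * norm g0 powr p + (p - 1) * \<tau>0 - \<omega> * (2 * c * CARD('n) + 2) \<le> plap p g0 X + \<omega> * trace X"
proof -
  define N where "N = real CARD('n)"
  have N: "N > 0" by (simp add: N_def)
  \<comment> \<open>The bound for positive semidefinite matrices loses a factor \<open>N\<close>, so
    this tolerance for the entries yields exactly \<open>\<omega>\<close> times the trace.\<close>
  define e where "e = \<omega> / N"
  have e: "e > 0" using \<open>\<omega> > 0\<close> N by (simp add: e_def)
  have "\<forall>\<^sub>F g in nhds g0. \<forall>i j. \<bar>pcoef p g i j - pcoef p g0 i j\<bar> < e"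
  proof (intro eventually_all_finite)
    fix i j
    have "isCont (\<lambda>g. pcoef p g i j) g0"
      using continuous_pcoef[OF p, of i j] by (simp add: continuous_on_eq_continuous_at)
    then have "((\<lambda>g. pcoef p g i j) \<longlongrightarrow> pcoef p g0 i j) (nhds g0)"
      by (simp add: isCont_def tendsto_nhds_iff)
    from tendstoD[OF this e] show "\<forall>\<^sub>F g in nhds g0. \<bar>pcoef p g i j - pcoef p g0 i j\<bar> < e"
      by (simp add: dist_real_def)
  qed
  moreover have "\<forall>\<^sub>F g in nhds g0. \<bar>\<sigma> * norm g powr p - \<sigma> * norm g0 powr p\<bar> < \<omega>"
  proof -
    have "continuous_on UNIV (\<lambda>g::real ^ 'n. \<sigma> * norm g powr p)"
      using p by (intro continuous_on_powr' continuous_intros) auto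
    then have "isCont (\<lambda>g. \<sigma> * norm g powr p) g0" by (simp add: continuous_on_eq_continuous_at)
    then have "((\<lambda>g. \<sigma> * norm g powr p) \<longlongrightarrow> \<sigma> * norm g0 powr p) (nhds g0)"
      by (simp add: isCont_def tendsto_nhds_iff)
    from tendstoD[OF this \<open>\<omega> > 0\<close>] show ?thesis by (simp add: dist_real_def)
  qed
  ultimately have "\<forall>\<^sub>F g in nhds g0. (\<forall>i j. \<bar>pcoef p g i j - pcoef p g0 i j\<bar> < e) \<and>
      \<bar>\<sigma> * norm g powr p - \<sigma> * norm g0 powr p\<bar> < \<omega>" by (rule eventually_conj)
  then obtain \<delta>1 where \<delta>1: "\<delta>1 > 0" "\<And>g. dist g g0 < \<delta>1 \<Longrightarrow> (\<forall>i j. \<bar>pcoef p g i j - pcoef p g0 i j\<bar> < e) \<and>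
      \<bar>\<sigma> * norm g powr p - \<sigma> * norm g0 powr p\<bar> < \<omega>"
    unfolding eventually_nhds_metric by blast
  define \<delta> where "\<delta> = min \<delta>1 (\<omega> / (p - 1))"
  have "\<delta> > 0" using \<delta>1 p \<open>\<omega> > 0\<close> by (simp add: \<delta>_def)
  moreover have "\<kappa> - \<sigma> * norm g0 powr p + (p - 1) * \<tau>0 - \<omega> * (2 * c * N + 2) \<le> plap p g0 X + \<omega> * trace X"
    if g: "norm (g - g0) < \<delta>" and \<tau>: "\<bar>\<tau> - \<tau>0\<bar> < \<delta>"
      and X: "\<And>\<xi>. - c * (norm \<xi>)\<^sup>2 \<le> \<xi> \<bullet> (X *v \<xi>)"
      and \<kappa>: "\<kappa> \<le> plap p g X + \<sigma> * norm g powr p - (p - 1) * \<tau>" for g X \<tau> \<kappa>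
  proof -
    have d: "\<bar>pcoef p g i j - pcoef p g0 i j\<bar> \<le> e" "\<bar>\<sigma> * norm g powr p - \<sigma> * norm g0 powr p\<bar> \<le> \<omega>" for i j
      using \<delta>1(2)[of g] g by (auto simp: dist_norm \<delta>_def less_imp_le)
    have t: "(p - 1) * (\<tau>0 - \<tau>) \<le> \<omega>"
    proof -
      have "\<bar>\<tau> - \<tau>0\<bar> < \<omega> / (p - 1)" using \<tau> by (simp add: \<delta>_def)
      then have "\<tau>0 - \<tau> \<le> \<omega> / (p - 1)" by linarith
      then show ?thesis using p by (simp add: pos_le_divide_eq mult.commute)
    qed
    \<comment> \<open>Adding \<open>c\<close> times the identity makes the Hessian positive
      semidefinite. Comparing coefficients on \<open>S\<close>, and then on \<open>mat 1\<close> to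
      undo the shift, costs \<open>c * \<omega> * N\<close> each time; the remaining
      \<open>2 * \<omega>\<close> pays for the gradient and time terms.\<close>
    define S where "S = X + c *\<^sub>R mat 1"
    have psd: "0 \<le> \<xi> \<bullet> (S *v \<xi>)" for \<xi>
      using X[of \<xi>] by (simp add: S_def matrix_vector_mult_add_rdistrib scaleR_matrix_vector_mult
          inner_add_right power2_norm_eq_inner)
    have psd1: "0 \<le> \<xi> \<bullet> (mat 1 *v \<xi>)" for \<xi> :: "real ^ 'n" by simp
    have diff: "plap p g1 Y - plap p g2 Y \<le> \<omega> * trace Y"
      if "\<And>\<xi>. 0 \<le> \<xi> \<bullet> (Y *v \<xi>)" "\<And>i j. \<bar>pcoef p g1 i j - pcoef p g2 i j\<bar> \<le> e" for Y :: "real ^ 'n ^ 'n" and g1 g2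
    proof -
      have "plap p g1 Y - plap p g2 Y = (\<Sum>i\<in>UNIV. \<Sum>j\<in>UNIV. (pcoef p g1 i j - pcoef p g2 i j) * Y $ i $ j)"
        by (simp add: plap_eq_sum sum_subtractf left_diff_distrib)
      also have "\<dots> \<le> e * N * trace Y"
        unfolding N_def
        by (rule psd_double_sum_le[where D="\<lambda>i j. pcoef p g1 i j - pcoef p g2 i j", OF that(1) _ that(2)])
           (simp add: pcoef_sym)
      finally show ?thesis using N by (simp add: e_def)
    qed
    have "plap p g S - plap p g0 S \<le> \<omega> * trace S" by (rule diff[OF psd d(1)])
    moreover have "plap p g0 (mat 1) - plap p g (mat 1) \<le> \<omega> * N"
      using diff[OF psd1, of g0 g] d(1) by (simp add: abs_minus_commute trace_I N_def)
    then have "c * (plap p g0 (mat 1) - plap p g (mat 1)) \<le> c * (\<omega> * N)" 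
      using \<open>c \<ge> 0\<close> by (rule mult_left_mono)
    ultimately have "plap p g X \<le> plap p g0 X + \<omega> * trace X + 2 * (c * \<omega> * N)"
      by (simp add: S_def plap_add plap_scaleR trace_add trace_scaleR trace_I N_def algebra_simps)
    moreover have "\<omega> * (2 * c * N + 2) = 2 * (c * \<omega> * N) + 2 * \<omega>" by (simp add: algebra_simps)
    moreover have "(p - 1) * \<tau>0 - (p - 1) * \<tau> \<le> \<omega>" using t by (simp add: algebra_simps)
    ultimately show ?thesis using \<kappa> d(2) by linarith
  qed
  ultimately show ?thesis unfolding N_def by blast
qed

text \<open>The lower paraboloid minus \<open>H\<close> has a local maximum at \<open>z\<close>, so
  \<open>H\<close> shares its gradient there and has second derivatives at least
  \<open>- c\<close>.\<close>

lemma touching_polynomial_jet: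
  fixes P z :: "'a::euclidean_space"
  assumes H: "polyd d H" and "\<delta> > 0"
    and lower: "\<And>k. S z + P \<bullet> k - c / 2 * (norm k)\<^sup>2 \<le> S (z + k)"
    and mx: "\<And>w. w \<in> ball z \<delta> \<Longrightarrow> S w - H w \<le> S z - H z"
  shows "pd \<xi> H z = P \<bullet> \<xi>" "- c * (norm \<xi>)\<^sup>2 \<le> pd \<xi> (pd \<xi> H) z"
proof -
  define e where "e = max d 2"
  define f where "f w = (1 * ((w - z) \<bullet> P) + (- c / 2) * (norm (w - z))\<^sup>2) + (- 1) * H w" for w
  have p1: "polyd e (\<lambda>w. 1 * ((w - z) \<bullet> P))" unfolding inner_diff_left e_def
    by (intro polyd_cmult polyd_diff polyd.const polyd_mono[OF polyd_inner]) simp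
  have p2: "polyd e (\<lambda>w. (- c / 2) * (norm (w - z))\<^sup>2)" unfolding e_def
    by (intro polyd_cmult polyd_mono[OF polyd_norm_sq]) simp
  have p3: "polyd e (\<lambda>w. (- 1) * H w)" unfolding e_def
    by (intro polyd_cmult polyd_mono[OF H]) simp
  have pf: "polyd e f" unfolding f_def by (intro polyd.add p1 p2 p3)
  have d1: "pd \<xi> f = (\<lambda>w. (1 * (\<xi> \<bullet> P) + (- c / 2) * (2 * ((w - z) \<bullet> \<xi>))) + (- 1) * pd \<xi> H w)"
    unfolding f_def pd_add[OF polyd.add[OF p1 p2] p3] pd_add[OF p1 p2] pd_inner
      pd_cmult[OF polyd_norm_sq] pd_norm_sq pd_cmult[OF H] ..
  have q1: "polyd e (\<lambda>w. 1 * (\<xi> \<bullet> P))" by (rule polyd.const)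
  have q2: "polyd e (\<lambda>w. (- c / 2) * (2 * ((w - z) \<bullet> \<xi>)))" unfolding inner_diff_left e_def
    by (intro polyd_cmult polyd_diff polyd.const polyd_mono[OF polyd_inner]) simp
  have q2': "polyd e (\<lambda>w. 2 * ((w - z) \<bullet> \<xi>))" unfolding inner_diff_left e_def
    by (intro polyd_cmult polyd_diff polyd.const polyd_mono[OF polyd_inner]) simp
  have q3: "polyd e (\<lambda>w. (- 1) * pd \<xi> H w)" unfolding e_def
    by (intro polyd_cmult polyd_mono[OF polyd_pd_polyd[OF H]]) simp
  have d2: "pd \<xi> (pd \<xi> f) = (\<lambda>w. (0 + (- c / 2) * (2 * (\<xi> \<bullet> \<xi>))) + (- 1) * pd \<xi> (pd \<xi> H) w)"
    unfolding d1 pd_add[OF polyd.add[OF q1 q2] q3] pd_add[OF q1 q2] pd_const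
      pd_cmult[OF q2'] pd_inner pd_cmult[OF polyd_pd_polyd[OF H]] ..
  have "f w \<le> f z" if "w \<in> ball z \<delta>" for w
    using lower[of "w - z"] mx[OF that] by (simp add: f_def inner_commute)
  from polyd_at_max[OF pf \<open>\<delta> > 0\<close> this, where \<xi>=\<xi>]
  have "pd \<xi> f z = 0" "pd \<xi> (pd \<xi> f) z \<le> 0" by auto
  then show "pd \<xi> H z = P \<bullet> \<xi>" "- c * (norm \<xi>)\<^sup>2 \<le> pd \<xi> (pd \<xi> H) z"
    unfolding d2 by (simp_all add: d1 inner_commute power2_norm_eq_inner)
qed

text \<open>For \<open>\<sigma> = p - 1\<close> this is the residual of the equation for
  \<open>v = ln u\<close>, for \<open>\<sigma> = - (p - 1)\<close> that of the equation for
  \<open>- v\<close>; subsolution and negated supersolution thus both satisfy lower bounds.\<close>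

definition log_residual :: "real \<Rightarrow> real \<Rightarrow> ((real ^ 'n) \<times> real \<Rightarrow> real) \<Rightarrow> (real ^ 'n) \<times> real \<Rightarrow> real"
  where "log_residual p \<sigma> H z =
    plap p (xgrad H z) (xhess H z) + \<sigma> * norm (xgrad H z) powr p - (p - 1) * pd (0, 1) H z"

text \<open>The trace term absorbs the freezing error and makes the operator nondegenerate in space
  even if \<open>g = 0\<close>.\<close>

definition frozen_op :: "real \<Rightarrow> real \<Rightarrow> real ^ 'n \<Rightarrow> ((real ^ 'n) \<times> real \<Rightarrow> real) \<Rightarrow> (real ^ 'n) \<times> real \<Rightarrow> real"
  where "frozen_op p \<omega> g H z = plap p g (xhess H z) + \<omega> * trace (xhess H z)"

text \<open>A polynomial touching \<open>S\<close> at \<open>z\<close> has gradient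
  \<open>c *\<^sub>R (\<zeta> - z)\<close> for a contact point \<open>\<zeta>\<close>, close to
  \<open>P0\<close> if \<open>z\<close> is close to \<open>z0\<close>, and second derivatives at
  least \<open>- c\<close>. Hence one ball serves for freezing with all such polynomials.\<close>

lemma supconv_frozen_inequality:
  fixes S f :: "(real ^ 'n) \<times> real \<Rightarrow> real"
  assumes p: "p \<ge> 2" and c: "c > 0" and \<omega>: "\<omega> > 0" and S: "is_supconv K f c S"
    and upper0: "\<And>k. S (z0 + k) \<le> S z0 + P0 \<bullet> k + c / 2 * (norm k)\<^sup>2"
    and lower0: "\<And>k. S z0 + P0 \<bullet> k - c / 2 * (norm k)\<^sup>2 \<le> S (z0 + k)"
    and r0: "r0 > 0"
    and test: "\<And>d H z \<zeta>. polyd d H \<Longrightarrow> z \<in> ball z0 r0 \<Longrightarrow> \<zeta> \<in> K \<Longrightarrow>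
        S z = f \<zeta> - c / 2 * (norm (z - \<zeta>))\<^sup>2 \<Longrightarrow> touches_above S H z \<Longrightarrow> \<kappa> \<le> log_residual p \<sigma> H z"
  shows "\<exists>r>0. r \<le> r0 \<and> (\<forall>d H z. polyd d H \<longrightarrow> z \<in> ball z0 r \<longrightarrow> touches_above S H z \<longrightarrow>
      \<kappa> - \<sigma> * norm (fst P0) powr p + (p - 1) * snd P0 - \<omega> * (2 * c * CARD('n) + 2)
        \<le> frozen_op p \<omega> (fst P0) H z)"
proof -
  obtain \<delta>0 where \<delta>0: "\<delta>0 > 0" and fr: "\<And>g X \<tau> \<kappa>. norm (g - fst P0) < \<delta>0 \<Longrightarrow> \<bar>\<tau> - snd P0\<bar> < \<delta>0 \<Longrightarrow>
    (\<And>\<xi>. - c * (norm \<xi>)\<^sup>2 \<le> \<xi> \<bullet> (X *v \<xi>)) \<Longrightarrow>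
    \<kappa> \<le> plap p g X + \<sigma> * norm g powr p - (p - 1) * \<tau> \<Longrightarrow>
    \<kappa> - \<sigma> * norm (fst P0) powr p + (p - 1) * snd P0 - \<omega> * (2 * c * CARD('n) + 2)
      \<le> plap p (fst P0) X + \<omega> * trace X"
    using plap_freeze_coefficients[OF p less_imp_le[OF c] \<omega>, of "fst P0" "snd P0" \<sigma>] by metis
  \<comment> \<open>Gradients at points of this ball differ from \<open>P0\<close> by at most
    \<open>3 * c * r\<close>, hence by at most \<open>\<delta>0 / 2\<close>.\<close>
  define r where "r = min r0 (\<delta>0 / (6 * c))"
  have r: "r > 0" "r \<le> r0" using r0 \<delta>0 c by (auto simp: r_def)
  have "r \<le> \<delta>0 / (6 * c)" by (simp add: r_def)
  then have "3 * c * r \<le> \<delta>0 / 2" using c by (simp add: pos_le_divide_eq mult_ac)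
  then have r3: "3 * c * r < \<delta>0" using \<delta>0 by simp
  have "\<kappa> - \<sigma> * norm (fst P0) powr p + (p - 1) * snd P0 - \<omega> * (2 * c * CARD('n) + 2)
        \<le> frozen_op p \<omega> (fst P0) H z"
    if H: "polyd d H" and z: "z \<in> ball z0 r" and touch: "touches_above S H z" for d H z
  proof -
    obtain \<delta> where \<delta>: "\<delta> > 0" and mx: "\<And>w. w \<in> ball z \<delta> \<Longrightarrow> S w - H w \<le> S z - H z"
      using touch unfolding touches_above_def by blast
    obtain \<zeta> where \<zeta>: "\<zeta> \<in> K" "S z = f \<zeta> - c / 2 * (norm (z - \<zeta>))\<^sup>2"
      using S unfolding is_supconv_def by blast
    define P where "P = c *\<^sub>R (\<zeta> - z)"
    have lower: "S z + P \<bullet> k - c / 2 * (norm k)\<^sup>2 \<le> S (z + k)" for k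
      unfolding P_def by (rule is_supconv_lower[OF S \<zeta>])
    note jet = touching_polynomial_jet[where S=S, OF H \<delta> lower mx]
    have "norm (P - P0) \<le> 3 * c * r"
      using z r c by (intro touching_gradient_close[OF lower upper0 lower0])
        (auto simp: dist_norm norm_minus_commute)
    then have PP: "norm (P - P0) < \<delta>0" using r3 by simp
    have g: "xgrad H z = fst P"
    proof -
      have "xgrad H z \<bullet> v = fst P \<bullet> v" for v
        using jet(1)[of "(v, 0)"] by (simp add: polyd_pd_xgrad[OF H] inner_prod_def)
      then show ?thesis by (metis vector_eq_rdot)
    qed
    have t: "pd (0, 1) H z = snd P" using jet(1)[of "(0, 1)"] by (simp add: inner_prod_def)
    have X: "- c * (norm \<xi>)\<^sup>2 \<le> \<xi> \<bullet> (xhess H z *v \<xi>)" for \<xi>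
      using jet(2)[of "(\<xi>, 0)"] by (simp add: polyd_pd_xhess[OF H])
    have "norm (fst P - fst P0) < \<delta>0" "\<bar>snd P - snd P0\<bar> < \<delta>0"
      using PP norm_fst_le[of "fst (P - P0)" "snd (P - P0)"] norm_snd_le[of "snd (P - P0)" "fst (P - P0)"]
      unfolding prod.collapse by simp_all
    moreover have "\<kappa> \<le> plap p (fst P) (xhess H z) + \<sigma> * norm (fst P) powr p - (p - 1) * snd P"
      using test[OF H _ \<zeta> touch] z r(2) unfolding log_residual_def g t by auto
    ultimately show ?thesis unfolding frozen_op_def using fr X by blast
  qed
  with r show ?thesis by (intro exI[of _ r]) blast
qed

text \<open>The directions are \<open>g\<close> (index \<open>None\<close>) and the coordinate axes
  (\<open>Some i\<close>), scaled by the square roots of their coefficients. All are purely spatial: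
  the time derivative has been frozen to the constant \<open>snd P0\<close>.\<close>

lemma frozen_operator_as_lop:
  fixes g :: "real ^ 'n"
  assumes p: "p \<ge> 2" and "\<omega> > 0"
  shows "\<exists>X :: 'n option \<Rightarrow> (real ^ 'n) \<times> real. X (Some i) \<noteq> 0 \<and>
    (\<forall>d H z. polyd d H \<longrightarrow> lop UNIV X H z = frozen_op p \<omega> g H z)"
proof -
  define X :: "'n option \<Rightarrow> (real ^ 'n) \<times> real" where
    "X k = (case k of None \<Rightarrow> (sqrt ((p - 2) * norm g powr (p - 4)) *\<^sub>R g, 0)
       | Some i \<Rightarrow> (sqrt (pweight p g + \<omega>) *\<^sub>R axis i 1, 0))" for k
  have w: "pweight p g + \<omega> > 0" using \<open>\<omega> > 0\<close> pweight_nonneg[of p g] by simp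
  have "lop UNIV X H z = frozen_op p \<omega> g H z" if "polyd d H" for d H z
  proof -
    have q: "pd (a *\<^sub>R v, 0) (pd (a *\<^sub>R v, 0) H) z = a\<^sup>2 * (v \<bullet> (xhess H z *v v))" for a v
      by (simp add: polyd_pd_xhess[OF that] matrix_vector_mult_scaleR power2_eq_square)
    have "lop UNIV X H z = pd (X None) (pd (X None) H) z + (\<Sum>i\<in>UNIV. pd (X (Some i)) (pd (X (Some i)) H) z)"
      by (simp add: lop_def UNIV_option_conv sum.reindex)
    also have "\<dots> = (p - 2) * norm g powr (p - 4) * (g \<bullet> (xhess H z *v g))
        + (\<Sum>i\<in>UNIV. (pweight p g + \<omega>) * (axis i 1 \<bullet> (xhess H z *v axis i 1)))"
      using p w by (simp add: X_def q)
    also have "(\<Sum>i\<in>UNIV. (pweight p g + \<omega>) * (axis i 1 \<bullet> (xhess H z *v axis i 1)))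
        = (pweight p g + \<omega>) * trace (xhess H z)"
      by (simp only: trace_eq_sum sum_distrib_left)
    finally show ?thesis by (simp add: frozen_op_def plap_alt algebra_simps)
  qed
  moreover have "X (Some i) \<noteq> 0" using w by (auto simp: X_def prod_eq_iff axis_eq_0_iff)
  ultimately show ?thesis by blast
qed

text \<open>At the maximum \<open>z0\<close> the semiconvex functions \<open>S1\<close> and \<open>S2\<close> are trapped between paraboloids with
  opposite gradients \<open>P0\<close> and \<open>- P0\<close>. Near \<open>z0\<close> every test gradient is therefore close to
  \<open>\<plusminus>P0\<close>, the equation can be frozen there, and no second-order differentiability of the \<open>S i\<close>
  is needed.\<close>

lemma supconv_sum_no_max:
  fixes S1 S2 f1 f2 :: "(real ^ 'n) \<times> real \<Rightarrow> real"
  assumes p: "p \<ge> 2" and c: "c > 0" and \<kappa>: "\<kappa> > 0"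
    and S: "is_supconv K f1 c S1" "is_supconv K f2 c S2"
    and \<zeta>0: "\<zeta>0 \<in> K" "S1 z0 = f1 \<zeta>0 - c / 2 * (norm (z0 - \<zeta>0))\<^sup>2"
    and \<xi>0: "\<xi>0 \<in> K" "S2 z0 = f2 \<xi>0 - c / 2 * (norm (z0 - \<xi>0))\<^sup>2"
    and mid: "\<xi>0 - z0 = - (\<zeta>0 - z0)"
    and mx: "\<And>z. S1 z + S2 z \<le> S1 z0 + S2 z0"
    and r0: "r0 > 0"
    and test1: "\<And>d H z \<zeta>. polyd d H \<Longrightarrow> z \<in> ball z0 r0 \<Longrightarrow> \<zeta> \<in> K \<Longrightarrow>
        S1 z = f1 \<zeta> - c / 2 * (norm (z - \<zeta>))\<^sup>2 \<Longrightarrow> touches_above S1 H z \<Longrightarrow>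
        \<kappa> \<le> log_residual p (p - 1) H z"
    and test2: "\<And>d H z \<zeta>. polyd d H \<Longrightarrow> z \<in> ball z0 r0 \<Longrightarrow> \<zeta> \<in> K \<Longrightarrow>
        S2 z = f2 \<zeta> - c / 2 * (norm (z - \<zeta>))\<^sup>2 \<Longrightarrow> touches_above S2 H z \<Longrightarrow>
        0 \<le> log_residual p (- (p - 1)) H z"
  shows False
proof -
  define P0 where "P0 = c *\<^sub>R (\<zeta>0 - z0)"
  define N where "N = 2 * c * CARD('n) + 2"
  have N: "N > 0" using c by (simp add: N_def add_pos_pos)
  \<comment> \<open>Each of the two freezings loses \<open>\<omega> * N\<close>, a third of the
    surplus \<open>\<kappa>\<close>.\<close>
  define \<omega> where "\<omega> = \<kappa> / (3 * N)"
  have \<omega>: "\<omega> > 0" using \<kappa> N by (simp add: \<omega>_def)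
  have lower1: "S1 z0 + P0 \<bullet> k - c / 2 * (norm k)\<^sup>2 \<le> S1 (z0 + k)" for k
    unfolding P0_def by (rule is_supconv_lower[OF S(1) \<zeta>0])
  have lower2: "S2 z0 + (- P0) \<bullet> k - c / 2 * (norm k)\<^sup>2 \<le> S2 (z0 + k)" for k
    using is_supconv_lower[OF S(2) \<xi>0, of k] unfolding mid P0_def
    by (simp add: inner_diff_left algebra_simps)
  have upper1: "S1 (z0 + k) \<le> S1 z0 + P0 \<bullet> k + c / 2 * (norm k)\<^sup>2" for k
    using lower2[of k] mx[of "z0 + k"] by simp
  have upper2: "S2 (z0 + k) \<le> S2 z0 + (- P0) \<bullet> k + c / 2 * (norm k)\<^sup>2" for k
    using lower1[of k] mx[of "z0 + k"] by simp
  have "\<exists>r>0. r \<le> r0 \<and> (\<forall>d H z. polyd d H \<longrightarrow> z \<in> ball z0 r \<longrightarrow> touches_above S1 H z \<longrightarrow>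
      \<kappa> - (p - 1) * norm (fst P0) powr p + (p - 1) * snd P0 - \<omega> * (2 * c * CARD('n) + 2)
        \<le> frozen_op p \<omega> (fst P0) H z)"
    by (rule supconv_frozen_inequality[OF p c \<omega> S(1) upper1 lower1 r0]) (rule test1)
  then obtain r1 where r1: "r1 > 0" and fr1: "\<And>d H z. polyd d H \<Longrightarrow> z \<in> ball z0 r1 \<Longrightarrow> touches_above S1 H z \<Longrightarrow>
      \<kappa> - (p - 1) * norm (fst P0) powr p + (p - 1) * snd P0 - \<omega> * N \<le> frozen_op p \<omega> (fst P0) H z"
    unfolding N_def by blast
  have "\<exists>r>0. r \<le> r0 \<and> (\<forall>d H z. polyd d H \<longrightarrow> z \<in> ball z0 r \<longrightarrow> touches_above S2 H z \<longrightarrow>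
      0 - (- (p - 1)) * norm (fst (- P0)) powr p + (p - 1) * snd (- P0) - \<omega> * (2 * c * CARD('n) + 2)
        \<le> frozen_op p \<omega> (fst (- P0)) H z)"
    by (rule supconv_frozen_inequality[OF p c \<omega> S(2) upper2 lower2 r0]) (rule test2)
  then obtain r2 where r2: "r2 > 0" and fr2: "\<And>d H z. polyd d H \<Longrightarrow> z \<in> ball z0 r2 \<Longrightarrow> touches_above S2 H z \<Longrightarrow>
      0 - (- (p - 1)) * norm (fst (- P0)) powr p + (p - 1) * snd (- P0) - \<omega> * N \<le> frozen_op p \<omega> (fst (- P0)) H z"
    unfolding N_def by blast
  fix i :: 'n
  obtain X :: "'n option \<Rightarrow> (real ^ 'n) \<times> real" where X: "X (Some i) \<noteq> 0"
    "\<And>d H z. polyd d H \<Longrightarrow> lop UNIV X H z = frozen_op p \<omega> (fst P0) H z"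
    using frozen_operator_as_lop[OF p \<omega>, of i "fst P0"] by blast
  define r where "r = min r1 r2"
  \<comment> \<open>As the jets are opposite, the gradient and time terms cancel in
    \<open>\<beta>1 + \<beta>2\<close>, which leaves
    \<open>\<kappa> - 2 * \<omega> * N = \<kappa> / 3\<close>.\<close>
  define \<beta>1 where "\<beta>1 = \<kappa> - (p - 1) * norm (fst P0) powr p + (p - 1) * snd P0 - \<omega> * N"
  define \<beta>2 where "\<beta>2 = (p - 1) * norm (fst P0) powr p - (p - 1) * snd P0 - \<omega> * N"
  show False
  proof (rule no_max_of_viscosity_sum[where I=UNIV and X=X and k="Some i" and a=z0 and r=r and ?\<beta>1.0=\<beta>1 and ?\<beta>2.0=\<beta>2])
    show "r > 0" using r1 r2 by (simp add: r_def)
    show "continuous_on (cball z0 r) S1" "continuous_on (cball z0 r) S2"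
      using is_supconv_continuous[OF S(1)] is_supconv_continuous[OF S(2)] continuous_on_subset by blast+
    show "\<beta>1 + \<beta>2 > 0" using \<kappa> N by (simp add: \<beta>1_def \<beta>2_def \<omega>_def)
    show "\<beta>1 \<le> lop UNIV X H z" if "polyd d H" "z \<in> ball z0 r" "touches_above S1 H z" for d H z
      unfolding X(2)[OF that(1)] \<beta>1_def using that(2) by (intro fr1[OF that(1) _ that(3)]) (simp add: r_def)
    show "\<beta>2 \<le> lop UNIV X H z" if "polyd d H" "z \<in> ball z0 r" "touches_above S2 H z" for d H z
    proof -
      have "z \<in> ball z0 r2" using that(2) by (simp add: r_def)
      from fr2[OF that(1) this that(3)] show ?thesis
        unfolding X(2)[OF that(1)] \<beta>2_def by (simp add: frozen_op_def plap_minus_grad left_diff_distrib)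
    qed
  qed (use mx X in auto)
qed

section \<open>Test functions for the logarithm of a solution\<close>

lemma plap_exp:
  assumes "p \<ge> 2" "k > 0"
  shows "plap p (k *\<^sub>R g) (k *\<^sub>R X + k *\<^sub>R outer g g) = k powr (p - 1) * (plap p g X + (p - 1) * norm g powr p)"
proof -
  have "k *\<^sub>R X + k *\<^sub>R outer g g = k *\<^sub>R (X + outer g g)" by (simp add: scaleR_add_right)
  then show ?thesis using assms by (simp add: plap_homogeneous plap_add plap_outer)
qed

lemma polyd_exp_C21_on:
  fixes H :: "(real ^ 'n) \<times> real \<Rightarrow> real" and a :: "(real ^ 'n) \<times> real"
  assumes H: "polyd d H"
    and \<theta>: "\<And>s. (\<theta> has_real_derivative \<theta>' s) (at s)" "continuous_on UNIV \<theta>'"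
  defines "E \<equiv> \<lambda>z. exp (H (z + a) + \<theta> (snd z))"
  shows "C21_on Q E (\<lambda>z. E z *\<^sub>R xgrad H (z + a))
    (\<lambda>z. E z *\<^sub>R xhess H (z + a) + E z *\<^sub>R outer (xgrad H (z + a)) (xgrad H (z + a)))
    (\<lambda>z. E z * (pd (0, 1) H (z + a) + \<theta>' (snd z)))"
proof -
  have "C21_on UNIV (\<lambda>z. H (z + a) + \<theta> (snd z)) (\<lambda>z. xgrad H (z + a) + 0) (\<lambda>z. xhess H (z + a) + 0)
      (\<lambda>z. pd (0, 1) H (z + a) + \<theta>' (snd z))"
    by (intro C21_on_add C21_on_shift polyd_C21_on[OF H] C21_on_time \<theta>)
  then have "C21_on UNIV (\<lambda>z. H (z + a) + \<theta> (snd z)) (\<lambda>z. xgrad H (z + a)) (\<lambda>z. xhess H (z + a))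
      (\<lambda>z. pd (0, 1) H (z + a) + \<theta>' (snd z))" by simp
  then have "C21_on Q (\<lambda>z. H (z + a) + \<theta> (snd z)) (\<lambda>z. xgrad H (z + a)) (\<lambda>z. xhess H (z + a))
      (\<lambda>z. pd (0, 1) H (z + a) + \<theta>' (snd z))" by (rule C21_on_subset) simp
  from C21_on_compose[OF this, of exp exp exp] show ?thesis
    unfolding E_def by (simp add: DERIV_exp continuous_on_exp continuous_on_id)
qed

text \<open>Because \<open>\<theta>\<close> depends on time alone, subtracting it from
  \<open>ln U\<close> affects only the time derivative and leaves the surplus
  \<open>(p - 1) * \<theta>'\<close> in the residual.\<close>

lemma subsolution_log_test:
  fixes H :: "(real ^ 'n) \<times> real \<Rightarrow> real"
  assumes p: "p \<ge> 2" and Q: "open Q" "\<zeta> \<in> Q" and U: "viscosity_subsolution p Q U" and H: "polyd d H"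
    and \<theta>: "\<And>s. (\<theta> has_real_derivative \<theta>' s) (at s)" "continuous_on UNIV \<theta>'"
    and mx: "eventually (\<lambda>w. ln (U w) - \<theta> (snd w) - H (w + a) \<le> ln (U \<zeta>) - \<theta> (snd \<zeta>) - H (\<zeta> + a)) (at \<zeta> within Q)"
  shows "(p - 1) * \<theta>' (snd \<zeta>) \<le> log_residual p (p - 1) H (\<zeta> + a)"
proof -
  \<comment> \<open>This constant makes the exponential test function equal to \<open>U\<close> at
    \<open>\<zeta>\<close>. The maximum of the difference of logarithms then becomes one of
    \<open>U - E\<close>, and the coefficient \<open>U \<zeta> powr (p - 2)\<close> matches the
    powers of \<open>E\<close>.\<close>
  define C where "C = ln (U \<zeta>) - \<theta> (snd \<zeta>) - H (\<zeta> + a)"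
  define \<eta> where "\<eta> s = \<theta> s + C" for s
  define E where "E z = exp (H (z + a) + \<eta> (snd z))" for z
  have \<eta>: "(\<eta> has_real_derivative \<theta>' s) (at s)" for s
    unfolding \<eta>_def using DERIV_add[OF \<theta>(1) DERIV_const] by simp
  note E = C21_on_imp_test_function[OF Q(1) polyd_exp_C21_on[OF H \<eta> \<theta>(2), of Q a, folded E_def]]
  have pos: "U z > 0" if "z \<in> Q" for z using U that by (simp add: viscosity_subsolution_def)
  have E\<zeta>: "E \<zeta> = U \<zeta>" using pos[OF Q(2)] by (simp add: E_def \<eta>_def C_def)
  have "eventually (\<lambda>w. w \<in> Q) (at \<zeta> within Q)" by (simp add: eventually_at_filter)
  then have "eventually (\<lambda>w. U w - E w \<le> U \<zeta> - E \<zeta>) (at \<zeta> within Q)"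
    using mx
  proof eventually_elim
    case (elim w)
    have "exp (ln (U w)) \<le> exp (H (w + a) + \<eta> (snd w))"
      using elim(2) by (intro exp_le_cancel_iff[THEN iffD2]) (simp add: \<eta>_def C_def)
    then show ?case using pos[OF elim(1)] E\<zeta> by (simp add: E_def)
  qed
  then have "0 \<le> p_laplacian p E \<zeta> - (p - 1) * U \<zeta> powr (p - 2) * time_deriv E \<zeta>"
    using U E(1) Q(2) unfolding viscosity_subsolution_def local_max_at_def by blast
  moreover have "p_laplacian p E \<zeta> = U \<zeta> powr (p - 1) * (plap p (xgrad H (\<zeta> + a)) (xhess H (\<zeta> + a))
    + (p - 1) * norm (xgrad H (\<zeta> + a)) powr p)"
    unfolding p_laplacian_eq_plap E(2)[OF Q(2)] E(3)[OF Q(2)] E\<zeta> by (rule plap_exp[OF p pos[OF Q(2)]])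
  moreover have "U \<zeta> powr (p - 2) * time_deriv E \<zeta> = U \<zeta> powr (p - 1) * (pd (0, 1) H (\<zeta> + a) + \<theta>' (snd \<zeta>))"
    unfolding E(4)[OF Q(2)] E\<zeta> using pos[OF Q(2)] powr_add[of "U \<zeta>" "p - 2" 1] by simp
  ultimately have "0 \<le> U \<zeta> powr (p - 1) * (plap p (xgrad H (\<zeta> + a)) (xhess H (\<zeta> + a))
    + (p - 1) * norm (xgrad H (\<zeta> + a)) powr p - (p - 1) * (pd (0, 1) H (\<zeta> + a) + \<theta>' (snd \<zeta>)))"
    by (simp add: algebra_simps)
  moreover have "U \<zeta> powr (p - 1) > 0" using pos[OF Q(2)] by simp
  ultimately have "0 \<le> plap p (xgrad H (\<zeta> + a)) (xhess H (\<zeta> + a))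
    + (p - 1) * norm (xgrad H (\<zeta> + a)) powr p - (p - 1) * (pd (0, 1) H (\<zeta> + a) + \<theta>' (snd \<zeta>))"
    by (meson not_le mult_pos_neg)
  then show ?thesis by (simp add: log_residual_def distrib_left)
qed

text \<open>\<open>H\<close> touches \<open>- ln V\<close> from above, so up to a factor
  \<open>exp (- H)\<close> touches \<open>V\<close> from below. \<open>plap\<close> is odd in the
  jet while \<open>norm g powr p\<close> is even, whence the sign of
  \<open>- (p - 1)\<close>.\<close>

lemma supersolution_log_test:
  fixes H :: "(real ^ 'n) \<times> real \<Rightarrow> real"
  assumes p: "p \<ge> 2" and Q: "open Q" "\<zeta> \<in> Q" and V: "viscosity_supersolution p Q V" and H: "polyd d H"
    and mx: "eventually (\<lambda>w. - ln (V w) - H (w + a) \<le> - ln (V \<zeta>) - H (\<zeta> + a)) (at \<zeta> within Q)"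
  shows "0 \<le> log_residual p (- (p - 1)) H (\<zeta> + a)"
proof -
  define C where "C = ln (V \<zeta>) + H (\<zeta> + a)"
  define H' where "H' = (\<lambda>z. (- 1) * H z)"
  define E where "E z = exp (H' (z + a) + C)" for z
  have H': "polyd d H'" unfolding H'_def by (rule polyd_cmult[OF H])
  have g': "xgrad H' z = - xgrad H z" "xhess H' z = - xhess H z" "pd (0, 1) H' z = - pd (0, 1) H z" for z
    by (simp_all only: H'_def xgrad_def xhess_def pd_cmult[OF H] pd_cmult[OF polyd_pd_polyd[OF H]])
       (simp_all add: vec_eq_iff)
  have "((\<lambda>s. C) has_real_derivative 0) (at s)" "continuous_on UNIV (\<lambda>s::real. 0::real)" for s :: real by auto
  note E = C21_on_imp_test_function[OF Q(1) polyd_exp_C21_on[OF H' this, of Q a, folded E_def]]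
  have pos: "V z > 0" if "z \<in> Q" for z using V that by (simp add: viscosity_supersolution_def)
  have E\<zeta>: "E \<zeta> = V \<zeta>" using pos[OF Q(2)] by (simp add: E_def H'_def C_def)
  have "eventually (\<lambda>w. w \<in> Q) (at \<zeta> within Q)" by (simp add: eventually_at_filter)
  then have "eventually (\<lambda>w. V \<zeta> - E \<zeta> \<le> V w - E w) (at \<zeta> within Q)"
    using mx
  proof eventually_elim
    case (elim w)
    have "exp (H' (w + a) + C) \<le> exp (ln (V w))"
      using elim(2) by (intro exp_le_cancel_iff[THEN iffD2]) (simp add: H'_def C_def)
    then show ?case using pos[OF elim(1)] E\<zeta> by (simp add: E_def)
  qed
  then have "p_laplacian p E \<zeta> - (p - 1) * V \<zeta> powr (p - 2) * time_deriv E \<zeta> \<le> 0"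
    using V E(1) Q(2) unfolding viscosity_supersolution_def local_min_at_def by blast
  moreover have "p_laplacian p E \<zeta> = V \<zeta> powr (p - 1) * (plap p (xgrad H' (\<zeta> + a)) (xhess H' (\<zeta> + a))
    + (p - 1) * norm (xgrad H' (\<zeta> + a)) powr p)"
    unfolding p_laplacian_eq_plap E(2)[OF Q(2)] E(3)[OF Q(2)] E\<zeta> by (rule plap_exp[OF p pos[OF Q(2)]])
  moreover have "V \<zeta> powr (p - 2) * time_deriv E \<zeta> = V \<zeta> powr (p - 1) * pd (0, 1) H' (\<zeta> + a)"
    unfolding E(4)[OF Q(2)] E\<zeta> using pos[OF Q(2)] powr_add[of "V \<zeta>" "p - 2" 1] by simp
  ultimately have "V \<zeta> powr (p - 1) * (plap p (xgrad H' (\<zeta> + a)) (xhess H' (\<zeta> + a))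
    + (p - 1) * norm (xgrad H' (\<zeta> + a)) powr p - (p - 1) * pd (0, 1) H' (\<zeta> + a)) \<le> 0"
    by (simp add: algebra_simps)
  moreover have "V \<zeta> powr (p - 1) > 0" using pos[OF Q(2)] by simp
  ultimately have "plap p (xgrad H' (\<zeta> + a)) (xhess H' (\<zeta> + a))
    + (p - 1) * norm (xgrad H' (\<zeta> + a)) powr p - (p - 1) * pd (0, 1) H' (\<zeta> + a) \<le> 0"
    by (meson not_le mult_pos_pos)
  then show ?thesis unfolding g' by (simp add: log_residual_def plap_minus algebra_simps)
qed

section \<open>The comparison principle\<close>

text \<open>Equality holds when \<open>z\<close> is the midpoint of \<open>a\<close> and
  \<open>b\<close>; this links the maximum of a sum of two sup-convolutions to doubling of variables
  with the constant \<open>c / 4\<close>.\<close>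

lemma parallelogram_dist:
  fixes z a b :: "'a::real_inner"
  shows "(norm (a - b))\<^sup>2 / 2 \<le> (norm (z - a))\<^sup>2 + (norm (z - b))\<^sup>2"
proof -
  have "(norm (z - a))\<^sup>2 + (norm (z - b))\<^sup>2 - (norm (a - b))\<^sup>2 / 2 = (norm (2 *\<^sub>R z - (a + b)))\<^sup>2 / 2"
    unfolding power2_norm_eq_inner
    by (simp add: inner_diff_left inner_diff_right inner_add_left inner_add_right inner_commute field_simps)
  moreover have "(norm (2 *\<^sub>R z - (a + b)))\<^sup>2 / 2 \<ge> 0" by simp
  ultimately show ?thesis by linarith
qed

lemma open_cylinder: "open \<Omega> \<Longrightarrow> open (cylinder \<Omega> T)"
  unfolding cylinder_def by (intro open_Times) auto

lemma closed_cylinder_cases: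
  assumes "open \<Omega>" "z \<in> closure \<Omega> \<times> {0..<T}"
  shows "z \<in> cylinder \<Omega> T \<or> z \<in> parabolic_boundary \<Omega> T"
  using assms
  by (auto simp: cylinder_def parabolic_boundary_def frontier_def interior_open)

text \<open>The penalty \<open>\<theta>\<close> makes the subsolution strict, keeps it below the supersolution at the final time
  \<open>T'\<close>, and is smooth up to time \<open>T\<close>, as required of a test function.\<close>

theorem viscosity_comparison:
  fixes \<Omega> :: "(real ^ 'n) set"
  assumes \<Omega>: "open \<Omega>" "bounded \<Omega>" and p: "p \<ge> 2" and T: "0 < T'" "T' < T"
    and usc: "upper_semicont_on (closure \<Omega> \<times> {0..T'}) U"
    and lsc: "lower_semicont_on (closure \<Omega> \<times> {0..T'}) V"
    and pos: "\<And>z. z \<in> closure \<Omega> \<times> {0..T'} \<Longrightarrow> 0 < U z" "\<And>z. z \<in> closure \<Omega> \<times> {0..T'} \<Longrightarrow> 0 < V z"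
    and sub: "viscosity_subsolution p (cylinder \<Omega> T) U"
    and super: "viscosity_supersolution p (cylinder \<Omega> T) V"
    and bd: "\<And>z. z \<in> parabolic_boundary \<Omega> T \<Longrightarrow> snd z \<le> T' \<Longrightarrow> U z \<le> V z"
    and z: "z \<in> closure \<Omega> \<times> {0..<T'}"
  shows "U z \<le> V z"
proof (rule ccontr)
  assume "\<not> U z \<le> V z"
  define K where "K = closure \<Omega> \<times> {0..T'}"
  define Q where "Q = \<Omega> \<times> {0<..<T'}"
  have zK: "z \<in> K" using z by (auto simp: K_def)
  then have "K \<noteq> {}" by blast
  have cK: "compact K" unfolding K_def using \<Omega>(2) by (intro compact_Times) auto
  have oQ: "open Q" unfolding Q_def using \<Omega>(1) by (intro open_Times) auto
  have QK: "Q \<subseteq> K" unfolding Q_def K_def using closure_subset by force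
  have QC: "Q \<subseteq> cylinder \<Omega> T" using T by (auto simp: Q_def cylinder_def)
  note posK = pos[folded K_def]
  define F where "F w = ln (U w)" for w
  define f2 where "f2 w = - ln (V w)" for w
  have uF: "upper_semicont_on K F" unfolding F_def
    by (rule upper_semicont_on_ln[OF usc[folded K_def] posK(1)])
  have u2: "upper_semicont_on K f2" unfolding f2_def
    by (rule upper_semicont_on_minus_ln[OF lsc[folded K_def] posK(2)])
  obtain w1 where w1: "w1 \<in> K" "\<And>w. w \<in> K \<Longrightarrow> F w \<le> F w1"
    using upper_semicont_on_attains_sup[OF cK \<open>K \<noteq> {}\<close> uF] by blast
  obtain w2 where w2: "w2 \<in> K" "\<And>w. w \<in> K \<Longrightarrow> f2 w \<le> f2 w2"
    using upper_semicont_on_attains_sup[OF cK \<open>K \<noteq> {}\<close> u2] by blast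
  define M where "M = F w1 + f2 w2"
  have Mle: "F a + f2 b \<le> M" if "a \<in> K" "b \<in> K" for a b
    using w1(2)[OF that(1)] w2(2)[OF that(2)] by (simp add: M_def)
  \<comment> \<open>Half of the gap \<open>ln (U z) - ln (V z)\<close>. As \<open>\<theta>\<close>
    equals \<open>m\<close> at the time of \<open>z\<close>, the other half survives the
    penalty.\<close>
  define m where "m = (F z + f2 z) / 2"
  have "V z > 0" "V z < U z" using posK(2)[OF zK] \<open>\<not> U z \<le> V z\<close> by auto
  then have "ln (V z) < ln (U z)" by (subst ln_less_cancel_iff) auto
  then have m: "m > 0" by (simp add: m_def F_def f2_def)
  have M: "M \<ge> 2 * m" using Mle[OF zK zK] by (simp add: m_def)
  \<comment> \<open>Determined by \<open>\<theta> T' = M\<close>, which makes \<open>f1 + f2\<close>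
    nonpositive at the final time.\<close>
  define \<mu> where "\<mu> = ln (M / m) / (T' - snd z)"
  have tz: "0 \<le> snd z" "snd z < T'" using z by auto
  have "M / m > 1" using M m by (simp add: less_divide_eq)
  then have \<mu>: "\<mu> > 0" unfolding \<mu>_def using tz by (intro divide_pos_pos ln_gt_zero) auto
  define \<theta> where "\<theta> s = m * exp (\<mu> * (s - snd z))" for s
  define \<theta>' where "\<theta>' s = m * exp (\<mu> * (s - snd z)) * \<mu>" for s
  have d\<theta>: "(\<theta> has_real_derivative \<theta>' s) (at s)" for s
    unfolding \<theta>_def \<theta>'_def by (auto intro!: derivative_eq_intros)
  have c\<theta>': "continuous_on UNIV \<theta>'" unfolding \<theta>'_def by (intro continuous_intros)
  have c\<theta>: "continuous_on UNIV \<theta>" unfolding \<theta>_def by (intro continuous_intros)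
  have \<theta>pos: "\<theta> s > 0" for s using m by (simp add: \<theta>_def)
  have \<theta>z: "\<theta> (snd z) = m" by (simp add: \<theta>_def)
  have \<theta>T: "\<theta> T' = M"
  proof -
    have "\<mu> * (T' - snd z) = ln (M / m)" using tz by (simp add: \<mu>_def)
    then show ?thesis using m M by (simp add: \<theta>_def)
  qed
  \<comment> \<open>The least value of \<open>(p - 1) * \<theta>'\<close> over nonnegative times,
    taken at time 0.\<close>
  define \<kappa> where "\<kappa> = (p - 1) * (m * exp (- \<mu> * snd z) * \<mu>)"
  have \<kappa>: "\<kappa> > 0" using p m \<mu> by (simp add: \<kappa>_def)
  have \<kappa>\<theta>: "\<kappa> \<le> (p - 1) * \<theta>' s" if "s \<ge> 0" for s
    unfolding \<kappa>_def \<theta>'_def using that p m \<mu>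
    by (intro mult_left_mono mult_right_mono) (auto simp: algebra_simps)
  define f1 where "f1 w = F w + - \<theta> (snd w)" for w
  have u1: "upper_semicont_on K f1" unfolding f1_def
    by (intro upper_semicont_on_add[OF uF] continuous_on_imp_upper_semicont_on
        continuous_on_minus continuous_on_compose2[OF c\<theta>] continuous_intros) auto
  have f12z: "f1 z + f2 z = m" unfolding f1_def \<theta>z by (simp add: m_def field_simps)
  \<comment> \<open>The parabolic boundary up to \<open>T'\<close> together with the final time
    slice.\<close>
  define B where "B = K - Q"
  have cB: "compact B" unfolding B_def by (rule compact_diff[OF cK oQ])
  have B: "f1 w + f2 w \<le> 0" if "w \<in> B" for w
  proof -
    have wK: "w \<in> K" "w \<notin> Q" using that by (auto simp: B_def)
    show ?thesis
    proof (cases "snd w = T'")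
      case True
      then show ?thesis using Mle[OF wK(1) wK(1)] by (simp add: f1_def \<theta>T)
    next
      case False
      then have "w \<in> closure \<Omega> \<times> {0..<T'}" using wK(1) by (auto simp: K_def)
      then have "w \<in> parabolic_boundary \<Omega> T'" using closed_cylinder_cases[OF \<Omega>(1)] wK(2)
        by (auto simp: Q_def cylinder_def)
      then have "w \<in> parabolic_boundary \<Omega> T" "snd w \<le> T'" using T by (auto simp: parabolic_boundary_def)
      then have "U w \<le> V w" by (rule bd)
      then have "ln (U w) \<le> ln (V w)" using posK[OF wK(1)] by (subst ln_le_cancel_iff) auto
      then show ?thesis using \<theta>pos[of "snd w"] by (simp add: f1_def F_def f2_def)
    qed
  qed
  \<comment> \<open>The sum of \<open>f1\<close> and \<open>f2\<close> stays below
    \<open>m / 2\<close> even at two different points near the same point of \<open>B\<close>; a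
    Lebesgue number \<open>\<rho>\<close> of this cover makes that uniform.\<close>
  define G where "G = {A. open A \<and> (\<forall>a\<in>A \<inter> K. \<forall>b\<in>A \<inter> K. f1 a + f2 b < m / 2)}"
  have "B \<subseteq> \<Union> G"
  proof
    fix b assume b: "b \<in> B"
    then have bK: "b \<in> K" by (simp add: B_def)
    obtain A1 where A1: "open A1" "b \<in> A1" "\<And>w. w \<in> A1 \<Longrightarrow> w \<in> K \<Longrightarrow> f1 w < f1 b + m / 4"
      using upper_semicont_onD[OF u1 bK, of "f1 b + m / 4"] m by auto
    obtain A2 where A2: "open A2" "b \<in> A2" "\<And>w. w \<in> A2 \<Longrightarrow> w \<in> K \<Longrightarrow> f2 w < f2 b + m / 4"
      using upper_semicont_onD[OF u2 bK, of "f2 b + m / 4"] m by auto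
    have "A1 \<inter> A2 \<in> G" unfolding G_def
    proof (intro CollectI conjI ballI)
      fix a c assume "a \<in> A1 \<inter> A2 \<inter> K" "c \<in> A1 \<inter> A2 \<inter> K"
      then show "f1 a + f2 c < m / 2" using A1(3)[of a] A2(3)[of c] B[OF b] by auto
    qed (use A1 A2 in auto)
    then show "b \<in> \<Union> G" using A1 A2 by blast
  qed
  moreover have "open A" if "A \<in> G" for A using that by (simp add: G_def)
  ultimately obtain \<rho> where \<rho>: "\<rho> > 0" "\<And>b. b \<in> B \<Longrightarrow> \<exists>A\<in>G. ball b \<rho> \<subseteq> A"
    using Heine_Borel_lemma[OF cB] by metis
  have far: "f1 a + f2 b < m / 2"
    if x: "x \<in> B" "a \<in> ball x \<rho>" "b \<in> ball x \<rho>" "a \<in> K" "b \<in> K" for x a b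
  proof -
    obtain A where A: "A \<in> G" "ball x \<rho> \<subseteq> A" using \<rho>(2)[OF x(1)] by blast
    then have "a \<in> A \<inter> K" "b \<in> A \<inter> K" using x by blast+
    then show ?thesis using A(1) unfolding G_def by blast
  qed
  have close: "a \<in> Q \<and> b \<in> Q" if "a \<in> K" "b \<in> K" "norm (a - b) < \<rho>" "f1 a + f2 b \<ge> m / 2" for a b
  proof (rule ccontr)
    have ab: "a \<in> ball b \<rho>" "b \<in> ball a \<rho>" "a \<in> ball a \<rho>" "b \<in> ball b \<rho>"
      using that(3) \<rho>(1) by (simp_all add: dist_norm norm_minus_commute)
    assume "\<not> (a \<in> Q \<and> b \<in> Q)"
    then have "a \<in> B \<or> b \<in> B" using that by (auto simp: B_def)
    then have "f1 a + f2 b < m / 2" using far ab that(1,2) by blast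
    then show False using that(4) by simp
  qed
  \<comment> \<open>Large enough that the two contact points of any \<open>w\<close> with
    \<open>S1 w + S2 w > m / 2\<close> are closer than \<open>\<rho>\<close>: the total penalty is
    at least \<open>c / 4 * (norm (a - b))\<^sup>2\<close> and less than \<open>M\<close>.\<close>
  define c where "c = 8 * M / \<rho>\<^sup>2"
  have Mpos: "M > 0" using M m by simp
  have c: "c > 0" using Mpos \<rho> by (simp add: c_def)
  obtain S1 where S1: "is_supconv K f1 c S1" using is_supconv_ex[OF cK \<open>K \<noteq> {}\<close> u1] by blast
  obtain S2 where S2: "is_supconv K f2 c S2" using is_supconv_ex[OF cK \<open>K \<noteq> {}\<close> u2] by blast
  have f1M: "f1 a + f2 b \<le> M" if "a \<in> K" "b \<in> K" for a b
    using Mle[OF that] \<theta>pos[of "snd a"] by (simp add: f1_def)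
  have contact: "a \<in> Q \<and> b \<in> Q" if w: "S1 w + S2 w > m / 2"
    and a: "a \<in> K" "S1 w = f1 a - c / 2 * (norm (w - a))\<^sup>2"
    and b: "b \<in> K" "S2 w = f2 b - c / 2 * (norm (w - b))\<^sup>2" for w a b
  proof (rule close[OF a(1) b(1)])
    have s: "f1 a + f2 b - c / 2 * ((norm (w - a))\<^sup>2 + (norm (w - b))\<^sup>2) > m / 2"
      using w a(2) b(2) by (simp add: algebra_simps)
    have "c / 2 * ((norm (a - b))\<^sup>2 / 2) \<le> c / 2 * ((norm (w - a))\<^sup>2 + (norm (w - b))\<^sup>2)"
      using c by (intro mult_left_mono parallelogram_dist) auto
    also have "\<dots> < M" using s f1M[OF a(1) b(1)] m by linarith
    finally have "c * (norm (a - b))\<^sup>2 < 4 * M" by simp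
    then have "8 * M * (norm (a - b))\<^sup>2 < 4 * M * \<rho>\<^sup>2" using \<rho>(1) by (simp add: c_def divide_less_eq)
    then have "(norm (a - b))\<^sup>2 * 2 < \<rho>\<^sup>2" using Mpos by simp
    then have "(norm (a - b))\<^sup>2 < \<rho>\<^sup>2" using zero_le_power2[of "norm (a - b)"] by linarith
    then show "norm (a - b) < \<rho>" using \<rho>(1) by (simp add: power_less_imp_less_base)
    have "c / 2 * ((norm (w - a))\<^sup>2 + (norm (w - b))\<^sup>2) \<ge> 0" using c by simp
    then show "f1 a + f2 b \<ge> m / 2" using s by linarith
  qed
  \<comment> \<open>Doubling of variables. The maximum of \<open>\<Phi>\<close> bounds
    \<open>S1 + S2\<close> everywhere and is attained by that sum at the midpoint \<open>z0\<close>,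
    whose contact points \<open>\<zeta>0\<close> and \<open>\<xi>0\<close> lie symmetrically about
    it; hence the opposite gradients.\<close>
  define \<Phi> where "\<Phi> w = f1 (fst w) + f2 (snd w) + - (c / 4 * (norm (fst w - snd w))\<^sup>2)" for w
  have "upper_semicont_on (K \<times> K) \<Phi>" unfolding \<Phi>_def
    by (intro upper_semicont_on_add upper_semicont_on_compose[OF u1] upper_semicont_on_compose[OF u2]
        continuous_on_imp_upper_semicont_on continuous_intros) auto
  then obtain w0 where w0: "w0 \<in> K \<times> K" "\<And>w. w \<in> K \<times> K \<Longrightarrow> \<Phi> w \<le> \<Phi> w0"
    using upper_semicont_on_attains_sup[OF compact_Times[OF cK cK]] \<open>K \<noteq> {}\<close> by blast
  define \<zeta>0 where "\<zeta>0 = fst w0"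
  define \<xi>0 where "\<xi>0 = snd w0"
  define z0 where "z0 = (1/2) *\<^sub>R (\<zeta>0 + \<xi>0)"
  have in0: "\<zeta>0 \<in> K" "\<xi>0 \<in> K" using w0(1) by (auto simp: \<zeta>0_def \<xi>0_def)
  have \<Phi>0: "\<Phi> w0 = f1 \<zeta>0 + f2 \<xi>0 - c / 4 * (norm (\<zeta>0 - \<xi>0))\<^sup>2" by (simp add: \<Phi>_def \<zeta>0_def \<xi>0_def)
  have "\<Phi> (z, z) = m" using f12z by (simp add: \<Phi>_def)
  then have \<Phi>m: "\<Phi> w0 \<ge> m" using w0(2)[of "(z, z)"] zK by auto
  have le: "S1 w + S2 w \<le> \<Phi> w0" for w
  proof -
    obtain a b where a: "a \<in> K" "S1 w = f1 a - c / 2 * (norm (w - a))\<^sup>2"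
      and b: "b \<in> K" "S2 w = f2 b - c / 2 * (norm (w - b))\<^sup>2"
      using S1 S2 unfolding is_supconv_def by blast
    have "c / 2 * ((norm (a - b))\<^sup>2 / 2) \<le> c / 2 * ((norm (w - a))\<^sup>2 + (norm (w - b))\<^sup>2)"
      using c by (intro mult_left_mono parallelogram_dist) auto
    then have "S1 w + S2 w \<le> \<Phi> (a, b)" using a(2) b(2) by (simp add: \<Phi>_def algebra_simps)
    also have "\<dots> \<le> \<Phi> w0" using a b by (intro w0(2)) auto
    finally show ?thesis .
  qed
  have half: "z0 - \<zeta>0 = (1/2) *\<^sub>R (\<xi>0 - \<zeta>0)" "z0 - \<xi>0 = (1/2) *\<^sub>R (\<zeta>0 - \<xi>0)"
  proof -
    have "z0 - (1/2) *\<^sub>R (\<zeta>0 + \<zeta>0) = (1/2) *\<^sub>R (\<xi>0 - \<zeta>0)" "z0 - (1/2) *\<^sub>R (\<xi>0 + \<xi>0) = (1/2) *\<^sub>R (\<zeta>0 - \<xi>0)"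
      unfolding z0_def scaleR_diff_right[symmetric] by simp_all
    then show "z0 - \<zeta>0 = (1/2) *\<^sub>R (\<xi>0 - \<zeta>0)" "z0 - \<xi>0 = (1/2) *\<^sub>R (\<zeta>0 - \<xi>0)"
      by (simp_all add: scaleR_half_double)
  qed
  have q: "c / 2 * (norm (z0 - \<zeta>0))\<^sup>2 = c / 8 * (norm (\<zeta>0 - \<xi>0))\<^sup>2"
    "c / 2 * (norm (z0 - \<xi>0))\<^sup>2 = c / 8 * (norm (\<zeta>0 - \<xi>0))\<^sup>2"
    unfolding half by (simp_all add: power_divide norm_minus_commute)
  have ge: "f1 \<zeta>0 - c / 2 * (norm (z0 - \<zeta>0))\<^sup>2 \<le> S1 z0" "f2 \<xi>0 - c / 2 * (norm (z0 - \<xi>0))\<^sup>2 \<le> S2 z0"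
    using S1 S2 in0 unfolding is_supconv_def by blast+
  have eq: "S1 z0 + S2 z0 = \<Phi> w0" "S1 z0 = f1 \<zeta>0 - c / 2 * (norm (z0 - \<zeta>0))\<^sup>2"
    "S2 z0 = f2 \<xi>0 - c / 2 * (norm (z0 - \<xi>0))\<^sup>2"
    using ge le[of z0] unfolding q \<Phi>0 by linarith+
  have "open {w. m / 2 < S1 w + S2 w}"
    using is_supconv_continuous[OF S1] is_supconv_continuous[OF S2]
    by (intro open_Collect_less continuous_intros)
  moreover have "z0 \<in> {w. m / 2 < S1 w + S2 w}" using eq(1) \<Phi>m m by simp
  ultimately obtain r0 where r0: "r0 > 0" "ball z0 r0 \<subseteq> {w. m / 2 < S1 w + S2 w}"
    using openE by blast
  \<comment> \<open>The inequality is known on \<open>K\<close>, whereas the viscosity property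
    quantifies over \<open>cylinder \<Omega> T\<close>. Contact points lie in the open set
    \<open>Q \<subseteq> K\<close>, so a small neighbourhood serves both.\<close>
  have localize: "eventually (\<lambda>w. f w - H (w + (y - \<zeta>)) \<le> f \<zeta> - H (\<zeta> + (y - \<zeta>))) (at \<zeta> within cylinder \<Omega> T)"
    if "\<zeta> \<in> Q" "\<delta> > 0" and *: "\<And>\<xi>. \<xi> \<in> K \<Longrightarrow> \<xi> \<in> ball \<zeta> \<delta> \<Longrightarrow> f \<xi> - H (\<xi> + (y - \<zeta>)) \<le> f \<zeta> - H (\<zeta> + (y - \<zeta>))"
    for f H :: "(real ^ 'n) \<times> real \<Rightarrow> real" and \<zeta> y \<delta>
    unfolding eventually_at_topological
    using that QK oQ by (intro exI[of _ "Q \<inter> ball \<zeta> \<delta>"]) auto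
  show False
  proof (rule supconv_sum_no_max[OF p c \<kappa> S1 S2 in0(1) eq(2) in0(2) eq(3) _ _ r0(1)])
    show "\<xi>0 - z0 = - (\<zeta>0 - z0)" using half by (metis minus_diff_eq scaleR_minus_right)
    show "S1 w + S2 w \<le> S1 z0 + S2 z0" for w using le eq(1) by simp
  next
    fix d H y \<zeta> assume H: "polyd d H" and y: "y \<in> ball z0 r0"
      and \<zeta>: "\<zeta> \<in> K" "S1 y = f1 \<zeta> - c / 2 * (norm (y - \<zeta>))\<^sup>2" and "touches_above S1 H y"
    then obtain \<delta> where \<delta>: "\<delta> > 0" and mx: "\<And>w. w \<in> ball y \<delta> \<Longrightarrow> S1 w - H w \<le> S1 y - H y"
      unfolding touches_above_def by blast
    obtain b where b: "b \<in> K" "S2 y = f2 b - c / 2 * (norm (y - b))\<^sup>2"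
      using S2 unfolding is_supconv_def by blast
    have \<zeta>Q: "\<zeta> \<in> Q" using contact[OF _ \<zeta> b] r0(2) y by auto
    have "\<zeta> \<in> cylinder \<Omega> T" using \<zeta>Q QC by blast
    moreover have "eventually (\<lambda>w. f1 w - H (w + (y - \<zeta>)) \<le> f1 \<zeta> - H (\<zeta> + (y - \<zeta>))) (at \<zeta> within cylinder \<Omega> T)"
      by (rule localize[OF \<zeta>Q \<delta>]) (rule is_supconv_shift_test[OF S1 \<zeta> mx])
    ultimately have "(p - 1) * \<theta>' (snd \<zeta>) \<le> log_residual p (p - 1) H (\<zeta> + (y - \<zeta>))"
      unfolding f1_def F_def
      by (intro subsolution_log_test[OF p open_cylinder[OF \<Omega>(1)] _ sub H d\<theta> c\<theta>']) (simp_all add: algebra_simps)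
    moreover have "\<kappa> \<le> (p - 1) * \<theta>' (snd \<zeta>)" using \<zeta>Q by (intro \<kappa>\<theta>) (auto simp: Q_def)
    ultimately show "\<kappa> \<le> log_residual p (p - 1) H y"
      by simp
  next
    fix d H y \<zeta> assume H: "polyd d H" and y: "y \<in> ball z0 r0"
      and \<zeta>: "\<zeta> \<in> K" "S2 y = f2 \<zeta> - c / 2 * (norm (y - \<zeta>))\<^sup>2" and "touches_above S2 H y"
    then obtain \<delta> where \<delta>: "\<delta> > 0" and mx: "\<And>w. w \<in> ball y \<delta> \<Longrightarrow> S2 w - H w \<le> S2 y - H y"
      unfolding touches_above_def by blast
    obtain b where b: "b \<in> K" "S1 y = f1 b - c / 2 * (norm (y - b))\<^sup>2"
      using S1 unfolding is_supconv_def by blast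
    have \<zeta>Q: "\<zeta> \<in> Q" using contact[OF _ b \<zeta>] r0(2) y by auto
    have "\<zeta> \<in> cylinder \<Omega> T" using \<zeta>Q QC by blast
    moreover have "eventually (\<lambda>w. f2 w - H (w + (y - \<zeta>)) \<le> f2 \<zeta> - H (\<zeta> + (y - \<zeta>))) (at \<zeta> within cylinder \<Omega> T)"
      by (rule localize[OF \<zeta>Q \<delta>]) (rule is_supconv_shift_test[OF S2 \<zeta> mx])
    ultimately have "0 \<le> log_residual p (- (p - 1)) H (\<zeta> + (y - \<zeta>))"
      unfolding f2_def by (intro supersolution_log_test[OF p open_cylinder[OF \<Omega>(1)] _ super H])
    then show "0 \<le> log_residual p (- (p - 1)) H y"
      by simp
  qed
qed

section \<open>Barriers\<close>

lemma plap_zero [simp]: "plap p g 0 = 0"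
  using plap_scaleR[of p g 0 0] by simp

text \<open>If \<open>W\<close> touches \<open>u\<close> from below where \<open>\<psi>\<close>
  touches it from above, then \<open>\<psi>\<close> touches \<open>W\<close> from above, and the
  inequality can be read off from the smooth \<open>W\<close>. This serves the truncated barriers
  and the bump in Perron's method.\<close>

lemma touching_subsolution_test:
  fixes \<psi> :: "(real ^ 'n) \<times> real \<Rightarrow> real"
  assumes p: "p \<ge> 2" and Q: "open Q" "z \<in> Q" and W: "C21_on Q W g X \<tau>" and \<psi>: "test_function Q \<psi>"
    and mx: "local_max_at Q (\<lambda>w. u w - \<psi> w) z"
    and le: "eventually (\<lambda>w. W w \<le> u w) (at z)" and eq: "u z = W z"
  shows "time_deriv \<psi> z = \<tau> z" "plap p (g z) (X z) \<le> p_laplacian p \<psi> z"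
proof -
  have "eventually (\<lambda>w. u w - \<psi> w \<le> u z - \<psi> z) (at z)"
    using mx unfolding local_max_at_def at_within_open[OF Q(2,1)] by blast
  with le have ev: "eventually (\<lambda>w. W w - \<psi> w \<le> W z - \<psi> z) (at z)"
    by eventually_elim (use eq in linarith)
  note touch = C21_on_local_max[OF Q W test_function_imp_C21_on[OF \<psi>] ev]
  show "time_deriv \<psi> z = \<tau> z" using touch(2) by simp
  show "plap p (g z) (X z) \<le> p_laplacian p \<psi> z"
    unfolding p_laplacian_eq_plap touch(1)[symmetric] by (rule plap_mono[OF p touch(3)])
qed

lemma touching_supersolution_test:
  fixes \<psi> :: "(real ^ 'n) \<times> real \<Rightarrow> real"
  assumes p: "p \<ge> 2" and Q: "open Q" "z \<in> Q" and W: "C21_on Q W g X \<tau>" and \<psi>: "test_function Q \<psi>"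
    and mn: "local_min_at Q (\<lambda>w. u w - \<psi> w) z"
    and le: "eventually (\<lambda>w. u w \<le> W w) (at z)" and eq: "u z = W z"
  shows "time_deriv \<psi> z = \<tau> z" "p_laplacian p \<psi> z \<le> plap p (g z) (X z)"
proof -
  have "eventually (\<lambda>w. u z - \<psi> z \<le> u w - \<psi> w) (at z)"
    using mn unfolding local_min_at_def at_within_open[OF Q(2,1)] by blast
  with le have ev: "eventually (\<lambda>w. \<psi> w - W w \<le> \<psi> z - W z) (at z)"
    by eventually_elim (use eq in linarith)
  note touch = C21_on_local_max[OF Q test_function_imp_C21_on[OF \<psi>] W ev]
  show "time_deriv \<psi> z = \<tau> z" using touch(2) by simp
  show "p_laplacian p \<psi> z \<le> plap p (g z) (X z)"
    unfolding p_laplacian_eq_plap touch(1) by (rule plap_mono[OF p touch(3)])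
qed

text \<open>At each point the larger of \<open>m\<close> and \<open>W\<close> touches the maximum
  from below, and constants solve the equation. The differential inequality for \<open>W\<close> is
  therefore asked only where \<open>W \<ge> m\<close>.\<close>

lemma viscosity_subsolution_max_const:
  fixes W :: "(real ^ 'n) \<times> real \<Rightarrow> real"
  assumes p: "p \<ge> 2" and Q: "open Q" and W: "C21_on Q W g X \<tau>" and "m > 0"
    and cl: "\<And>z. z \<in> Q \<Longrightarrow> m \<le> W z \<Longrightarrow> (p - 1) * W z powr (p - 2) * \<tau> z \<le> plap p (g z) (X z)"
  shows "viscosity_subsolution p Q (\<lambda>z. max m (W z))"
  unfolding viscosity_subsolution_def
proof (intro conjI ballI allI impI)
  show "0 < max m (W z)" for z using \<open>m > 0\<close> by simp
  show "upper_semicont_on Q (\<lambda>z. max m (W z))"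
    by (intro continuous_on_imp_upper_semicont_on continuous_intros C21_onD(4)[OF W])
  fix \<psi> z assume "test_function Q \<psi> \<and> local_max_at Q (\<lambda>w. max m (W w) - \<psi> w) z"
  then have \<psi>: "test_function Q \<psi>" and mx: "local_max_at Q (\<lambda>w. max m (W w) - \<psi> w) z" by auto
  have z: "z \<in> Q" using mx by (simp add: local_max_at_def)
  show "0 \<le> p_laplacian p \<psi> z - (p - 1) * max m (W z) powr (p - 2) * time_deriv \<psi> z"
  proof (cases "m \<le> W z")
    case True
    then have eq: "max m (W z) = W z" by simp
    have "eventually (\<lambda>w. W w \<le> max m (W w)) (at z)" by simp
    from touching_subsolution_test[OF p Q z W \<psi> mx this eq] cl[OF z True] show ?thesis
      unfolding eq by simp
  next
    case False
    then have eq: "max m (W z) = m" by simp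
    have "eventually (\<lambda>w. m \<le> max m (W w)) (at z)" by simp
    from touching_subsolution_test[OF p Q z C21_on_const[of Q m] \<psi> mx this eq] show ?thesis by simp
  qed
qed

lemma viscosity_supersolution_min_const:
  fixes W :: "(real ^ 'n) \<times> real \<Rightarrow> real"
  assumes p: "p \<ge> 2" and Q: "open Q" and W: "C21_on Q W g X \<tau>" and "M > 0" and pos: "\<And>z. z \<in> Q \<Longrightarrow> W z > 0"
    and cl: "\<And>z. z \<in> Q \<Longrightarrow> W z \<le> M \<Longrightarrow> plap p (g z) (X z) \<le> (p - 1) * W z powr (p - 2) * \<tau> z"
  shows "viscosity_supersolution p Q (\<lambda>z. min M (W z))"
  unfolding viscosity_supersolution_def
proof (intro conjI ballI allI impI)
  show "0 < min M (W z)" if "z \<in> Q" for z using \<open>M > 0\<close> pos[OF that] by simp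
  show "lower_semicont_on Q (\<lambda>z. min M (W z))"
    by (intro continuous_on_imp_lower_semicont_on continuous_intros C21_onD(4)[OF W])
  fix \<psi> z assume "test_function Q \<psi> \<and> local_min_at Q (\<lambda>w. min M (W w) - \<psi> w) z"
  then have \<psi>: "test_function Q \<psi>" and mn: "local_min_at Q (\<lambda>w. min M (W w) - \<psi> w) z" by auto
  have z: "z \<in> Q" using mn by (simp add: local_min_at_def)
  show "p_laplacian p \<psi> z - (p - 1) * min M (W z) powr (p - 2) * time_deriv \<psi> z \<le> 0"
  proof (cases "W z \<le> M")
    case True
    then have eq: "min M (W z) = W z" by simp
    have "eventually (\<lambda>w. min M (W w) \<le> W w) (at z)" by simp
    from touching_supersolution_test[OF p Q z W \<psi> mn this eq] cl[OF z True] show ?thesis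
      unfolding eq by simp
  next
    case False
    then have eq: "min M (W z) = M" by simp
    have "eventually (\<lambda>w. min M (W w) \<le> M) (at z)" by simp
    from touching_supersolution_test[OF p Q z C21_on_const[of Q M] \<psi> mn this eq] show ?thesis by simp
  qed
qed

section \<open>Separated radial barriers\<close>

lemma plap_radial:
  fixes v :: "real ^ 'n" and p b e :: real
  assumes p: "p \<ge> 2" and "b \<noteq> 0" "v \<noteq> 0"
  shows "plap p (b *\<^sub>R v) (b *\<^sub>R mat 1 + e *\<^sub>R outer v v)
    = (\<bar>b\<bar> * norm v) powr (p - 2) * (b * (CARD('n) + p - 2) + e * (p - 1) * (norm v)\<^sup>2)"
proof -
  have A: "plap p (b *\<^sub>R v) Y = \<bar>b\<bar> powr (p - 2) * plap p v Y" for Y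
  proof (cases "b > 0")
    case False
    then have "plap p (b *\<^sub>R v) Y = plap p ((- b) *\<^sub>R v) Y"
      using plap_minus_grad[of p "b *\<^sub>R v" Y] by simp
    then show ?thesis using False \<open>b \<noteq> 0\<close> plap_scale_grad[of "- b" p v Y] by simp
  qed (simp add: plap_scale_grad)
  have "norm v powr (p - 4) * (norm v)\<^sup>2 = norm v powr (p - 2)"
    using \<open>v \<noteq> 0\<close> powr_add[of "norm v" "p - 4" 2] by simp
  then have B: "plap p v (mat 1) = norm v powr (p - 2) * (CARD('n) + p - 2)"
    using \<open>v \<noteq> 0\<close> by (simp add: plap_mat_1 pweight_def mult.assoc algebra_simps)
  have C: "norm v powr p = norm v powr (p - 2) * (norm v)\<^sup>2"
    using \<open>v \<noteq> 0\<close> powr_add[of "norm v" "p - 2" 2] by simp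
  show ?thesis
    unfolding plap_add plap_scaleR A B plap_outer[OF p] C
    by (simp add: powr_mult algebra_simps)
qed

text \<open>The profile takes the squared distance as its argument, so the function is smooth also
  at the centre \<open>a\<close>.\<close>

lemma radial_C21_on:
  assumes \<phi>: "\<And>s. (\<phi> has_real_derivative \<phi>' s) (at s)" "\<And>s. (\<phi>' has_real_derivative \<phi>'' s) (at s)"
      "continuous_on UNIV \<phi>''"
    and \<theta>: "\<And>s. (\<theta> has_real_derivative \<theta>' s) (at s)" "continuous_on UNIV \<theta>'"
  shows "C21_on Q (\<lambda>z. exp (\<theta> (snd z)) * \<phi> ((norm (fst z - a))\<^sup>2))
    (\<lambda>z. exp (\<theta> (snd z)) *\<^sub>R ((2 * \<phi>' ((norm (fst z - a))\<^sup>2)) *\<^sub>R (fst z - a)))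
    (\<lambda>z. exp (\<theta> (snd z)) *\<^sub>R ((2 * \<phi>' ((norm (fst z - a))\<^sup>2)) *\<^sub>R mat 1
        + (4 * \<phi>'' ((norm (fst z - a))\<^sup>2)) *\<^sub>R outer (fst z - a) (fst z - a)))
    (\<lambda>z. exp (\<theta> (snd z)) * \<phi> ((norm (fst z - a))\<^sup>2) * \<theta>' (snd z))"
proof -
  have o: "outer (2 *\<^sub>R v) (2 *\<^sub>R v) = 4 *\<^sub>R outer v v" for v :: "real ^ 'a"
    by (simp add: outer_def vec_eq_iff)
  have d: "((\<lambda>s. exp (\<theta> s)) has_real_derivative exp (\<theta> s) * \<theta>' s) (at s)" for s
    by (auto intro!: derivative_eq_intros \<theta>)
  have c: "continuous_on UNIV (\<lambda>s. exp (\<theta> s) * \<theta>' s)"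
    using \<theta> by (intro continuous_intros) (meson DERIV_continuous continuous_at_imp_continuous_on)
  show ?thesis
    using C21_on_time_mult[OF C21_on_compose[OF C21_on_dist_sq \<phi>] d c, of Q a] o by (simp add: mult_ac)
qed

text \<open>By homogeneity the factor \<open>k = exp (\<theta> t)\<close> splits off, leaving an
  inequality for the profile in which time enters only through
  \<open>l = \<theta>' t\<close>.\<close>

lemma radial_residual:
  fixes v :: "real ^ 'n"
  assumes p: "p \<ge> 2" and "k > 0" "f > 0"
  shows "plap p (k *\<^sub>R g) (k *\<^sub>R Y) - (p - 1) * (k * f) powr (p - 2) * (k * f * l)
    = k powr (p - 1) * (plap p g Y - (p - 1) * f powr (p - 1) * l)"
proof -
  have "(k * f) powr (p - 2) * (k * f) = (k * f) powr (p - 1)"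
    using assms powr_add[of "k * f" "p - 2" 1] by simp
  then have "(p - 1) * (k * f) powr (p - 2) * (k * f * l) = (p - 1) * l * (k * f) powr (p - 1)"
    by (simp add: mult_ac)
  then show ?thesis using assms by (simp add: plap_homogeneous powr_mult algebra_simps)
qed

text \<open>The \<open>p\<close>-Laplacian of \<open>\<phi> (|x - a|^2)\<close> at
  \<open>x = a + v\<close>, where \<open>b\<close> and \<open>e\<close> are the first and second
  derivatives of \<open>\<phi>\<close> at \<open>|v|^2\<close>; the factors 2 and 4 come from the
  chain rule.\<close>

definition radial_plap :: "real \<Rightarrow> real \<Rightarrow> real \<Rightarrow> real ^ 'n \<Rightarrow> real"
  where "radial_plap p b e v = plap p ((2 * b) *\<^sub>R v) ((2 * b) *\<^sub>R mat 1 + (4 * e) *\<^sub>R outer v v)"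

lemma radial_subsolution:
  fixes a :: "real ^ 'n"
  assumes p: "p \<ge> 2" and Q: "open Q" and "m > 0"
    and \<phi>: "\<And>s. (\<phi> has_real_derivative \<phi>' s) (at s)" "\<And>s. (\<phi>' has_real_derivative \<phi>'' s) (at s)"
      "continuous_on UNIV \<phi>''"
    and \<theta>: "\<And>s. (\<theta> has_real_derivative \<theta>' s) (at s)" "continuous_on UNIV \<theta>'"
    and le: "\<And>x t. (x, t) \<in> Q \<Longrightarrow> m \<le> exp (\<theta> t) * \<phi> ((norm (x - a))\<^sup>2) \<Longrightarrow> 0 < \<phi> ((norm (x - a))\<^sup>2) \<Longrightarrow>
      (p - 1) * \<phi> ((norm (x - a))\<^sup>2) powr (p - 1) * \<theta>' t
        \<le> radial_plap p (\<phi>' ((norm (x - a))\<^sup>2)) (\<phi>'' ((norm (x - a))\<^sup>2)) (x - a)"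
  shows "viscosity_subsolution p Q (\<lambda>z. max m (exp (\<theta> (snd z)) * \<phi> ((norm (fst z - a))\<^sup>2)))"
proof (rule viscosity_subsolution_max_const[OF p Q radial_C21_on[OF \<phi> \<theta>] \<open>m > 0\<close>], goal_cases)
  case (1 z)
  define s where "s = (norm (fst z - a))\<^sup>2"
  have pos: "\<phi> s > 0" using 1(2) \<open>m > 0\<close> unfolding s_def[symmetric]
    by (metis exp_gt_zero less_le_trans zero_less_mult_pos)
  have "0 \<le> exp (\<theta> (snd z)) powr (p - 1) *
      (radial_plap p (\<phi>' s) (\<phi>'' s) (fst z - a) - (p - 1) * \<phi> s powr (p - 1) * \<theta>' (snd z))"
    using le[of "fst z" "snd z"] 1 pos unfolding s_def by (intro mult_nonneg_nonneg) auto
  then show ?case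
    unfolding s_def[symmetric] radial_plap_def radial_residual[OF p exp_gt_zero pos, symmetric] by simp
qed

lemma radial_supersolution:
  fixes a :: "real ^ 'n"
  assumes p: "p \<ge> 2" and Q: "open Q" and "M > 0"
    and \<phi>: "\<And>s. (\<phi> has_real_derivative \<phi>' s) (at s)" "\<And>s. (\<phi>' has_real_derivative \<phi>'' s) (at s)"
      "continuous_on UNIV \<phi>''"
    and \<theta>: "\<And>s. (\<theta> has_real_derivative \<theta>' s) (at s)" "continuous_on UNIV \<theta>'"
    and pos: "\<And>x t. (x, t) \<in> Q \<Longrightarrow> 0 < \<phi> ((norm (x - a))\<^sup>2)"
    and le: "\<And>x t. (x, t) \<in> Q \<Longrightarrow> exp (\<theta> t) * \<phi> ((norm (x - a))\<^sup>2) \<le> M \<Longrightarrow>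
      radial_plap p (\<phi>' ((norm (x - a))\<^sup>2)) (\<phi>'' ((norm (x - a))\<^sup>2)) (x - a)
        \<le> (p - 1) * \<phi> ((norm (x - a))\<^sup>2) powr (p - 1) * \<theta>' t"
  shows "viscosity_supersolution p Q (\<lambda>z. min M (exp (\<theta> (snd z)) * \<phi> ((norm (fst z - a))\<^sup>2)))"
proof (rule viscosity_supersolution_min_const[OF p Q radial_C21_on[OF \<phi> \<theta>] \<open>M > 0\<close>], goal_cases)
  case (1 z)
  then show ?case using pos[of "fst z" "snd z"] by simp
next
  case (2 z)
  define s where "s = (norm (fst z - a))\<^sup>2"
  have pos: "\<phi> s > 0" using pos[of "fst z" "snd z"] 2(1) unfolding s_def by simp
  have "exp (\<theta> (snd z)) powr (p - 1) *
      (radial_plap p (\<phi>' s) (\<phi>'' s) (fst z - a) - (p - 1) * \<phi> s powr (p - 1) * \<theta>' (snd z)) \<le> 0"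
    using le[of "fst z" "snd z"] 2 unfolding s_def by (intro mult_nonneg_nonpos) auto
  then show ?case
    unfolding s_def[symmetric] radial_plap_def radial_residual[OF p exp_gt_zero pos, symmetric] by simp
qed

text \<open>For a steep exponential profile the second derivative is of order
  \<open>\<alpha>\<^sup>2\<close> and the first of order \<open>\<alpha>\<close>; where
  \<open>q \<ge> 1/2\<close> the former wins and exceeds any given \<open>L\<close>.\<close>

lemma boundary_layer_estimate:
  fixes p E R N L :: real
  assumes "p \<ge> 2" "E > 0" "R > 0" "N \<ge> 0"
  shows "\<exists>\<alpha>0\<ge>1. \<forall>\<alpha>\<ge>\<alpha>0. \<forall>q\<ge>1/2. \<forall>r\<ge>R.
    L \<le> (2 * E * \<alpha> * q * r) powr (p - 2) * (2 * E * \<alpha> * q * (2 * \<alpha> * (p - 1) * r\<^sup>2 - N))"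
proof -
  define K where "K = (E * R) powr (p - 2)"
  have K: "K > 0" using assms by (simp add: K_def)
  \<comment> \<open>The second entry makes the bracket containing \<open>- N\<close> at least 1, the
    third makes \<open>K * E * \<alpha>\<close> at least \<open>L\<close>.\<close>
  define \<alpha>0 where "\<alpha>0 = max 1 (max ((N + 1) / (2 * (p - 1) * R\<^sup>2)) (L / (E * K)))"
  have "L \<le> (2 * E * \<alpha> * q * r) powr (p - 2) * (2 * E * \<alpha> * q * (2 * \<alpha> * (p - 1) * r\<^sup>2 - N))"
    if \<alpha>: "\<alpha> \<ge> \<alpha>0" and q: "q \<ge> 1/2" and r: "r \<ge> R" for \<alpha> q r
  proof -
    have \<alpha>1: "\<alpha> \<ge> 1" "\<alpha> \<ge> (N + 1) / (2 * (p - 1) * R\<^sup>2)" "\<alpha> \<ge> L / (E * K)" using \<alpha> by (auto simp: \<alpha>0_def)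
    have "N + 1 \<le> \<alpha> * (2 * (p - 1) * R\<^sup>2)" using \<alpha>1(2) assms by (simp add: pos_divide_le_eq)
    also have "\<dots> \<le> \<alpha> * (2 * (p - 1) * r\<^sup>2)"
      using \<alpha>1 assms r by (intro mult_left_mono power_mono) auto
    finally have b: "1 \<le> 2 * \<alpha> * (p - 1) * r\<^sup>2 - N" by (simp add: algebra_simps)
    have q2: "1 \<le> 2 * q" using q by simp
    have a: "E * \<alpha> * 1 \<le> E * \<alpha> * (2 * q)" using q2 \<alpha>1 assms by (intro mult_left_mono) auto
    have c: "E * R \<le> 2 * E * \<alpha> * q * r"
    proof -
      have "1 * 1 \<le> \<alpha> * (2 * q)" using \<alpha>1 q2 by (intro mult_mono) auto
      then have "E * R * 1 \<le> E * r * (\<alpha> * (2 * q))" using assms r by (intro mult_mono) auto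
      then show ?thesis by (simp add: mult_ac)
    qed
    have "L \<le> K * (E * \<alpha> * 1)" using \<alpha>1(3) K assms by (simp add: pos_divide_le_eq mult_ac)
    also have "\<dots> \<le> (2 * E * \<alpha> * q * r) powr (p - 2) * (2 * E * \<alpha> * q * (2 * \<alpha> * (p - 1) * r\<^sup>2 - N))"
    proof (rule mult_mono)
      show "K \<le> (2 * E * \<alpha> * q * r) powr (p - 2)" unfolding K_def using c assms by (intro powr_mono2) auto
      have "E * \<alpha> * 1 \<le> (E * \<alpha> * (2 * q)) * 1" using a by simp
      also have "\<dots> \<le> (E * \<alpha> * (2 * q)) * (2 * \<alpha> * (p - 1) * r\<^sup>2 - N)"
        using b \<alpha>1 assms q by (intro mult_left_mono) auto
      finally show "E * \<alpha> * 1 \<le> 2 * E * \<alpha> * q * (2 * \<alpha> * (p - 1) * r\<^sup>2 - N)" by (simp add: mult_ac)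
    qed (use \<alpha>1 assms in auto)
    finally show ?thesis .
  qed
  moreover have "\<alpha>0 \<ge> 1" by (simp add: \<alpha>0_def)
  ultimately show ?thesis by blast
qed

text \<open>With \<open>\<epsilon> = 1\<close> the profile \<open>1 + \<epsilon> E (1 - exp (- \<alpha> (s - R\<^sup>2)))\<close> gives upper, with \<open>\<epsilon> = - 1\<close> lower
  barriers.\<close>

lemma radial_plap_exp_profile:
  fixes v :: "real ^ 'n" and p E \<alpha> q \<epsilon> :: real
  assumes "p \<ge> 2" "E > 0" "\<alpha> > 0" "q > 0" "v \<noteq> 0" "\<bar>\<epsilon>\<bar> = 1"
  shows "radial_plap p (\<epsilon> * E * \<alpha> * q) (- \<epsilon> * E * \<alpha>\<^sup>2 * q) v
    = - \<epsilon> * ((2 * E * \<alpha> * q * norm v) powr (p - 2) *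
        (2 * E * \<alpha> * q * (2 * \<alpha> * (p - 1) * (norm v)\<^sup>2 - (CARD('n) + p - 2))))"
proof -
  have b: "2 * (\<epsilon> * E * \<alpha> * q) \<noteq> 0" "\<bar>2 * (\<epsilon> * E * \<alpha> * q)\<bar> = 2 * E * \<alpha> * q"
    using assms by (auto simp: abs_mult)
  show ?thesis
    unfolding radial_plap_def plap_radial[OF assms(1) b(1) assms(5)] b(2)
    by (simp add: power2_eq_square algebra_simps)
qed

lemma exp_profile_derivatives:
  fixes E \<alpha> \<epsilon> R :: real
  defines "\<phi> \<equiv> \<lambda>s. 1 + \<epsilon> * (E * (1 - exp (- \<alpha> * (s - R\<^sup>2))))"
    and "\<phi>' \<equiv> \<lambda>s. \<epsilon> * E * \<alpha> * exp (- \<alpha> * (s - R\<^sup>2))"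
    and "\<phi>'' \<equiv> \<lambda>s. - \<epsilon> * E * \<alpha>\<^sup>2 * exp (- \<alpha> * (s - R\<^sup>2))"
  shows "(\<phi> has_real_derivative \<phi>' s) (at s)" "(\<phi>' has_real_derivative \<phi>'' s) (at s)"
    "continuous_on UNIV \<phi>''"
  unfolding \<phi>_def \<phi>'_def \<phi>''_def
  by (auto intro!: derivative_eq_intros continuous_intros simp: power2_eq_square algebra_simps)

text \<open>The closed ball of half the radius, tangent at \<open>y\<close> from inside the outer
  ball, meets the closure of \<open>\<Omega>\<close> only at \<open>y\<close>. The median identity,
  with \<open>a\<close> the midpoint of \<open>z\<close> and \<open>y\<close>, quantifies the gap by
  \<open>|x - y|^2 / 2\<close>.\<close>

lemma outer_ball_halved:
  fixes \<Omega> :: "(real ^ 'n) set"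
  assumes "uniform_outer_ball \<Omega>" and y: "y \<in> frontier \<Omega>"
  obtains a R where "R > 0" "(norm (y - a))\<^sup>2 = R\<^sup>2"
    "\<And>x. x \<in> closure \<Omega> \<Longrightarrow> R\<^sup>2 + (norm (x - y))\<^sup>2 / 2 \<le> (norm (x - a))\<^sup>2"
proof -
  obtain \<rho>0 z where \<rho>0: "\<rho>0 > 0" and z: "ball z \<rho>0 \<subseteq> - \<Omega>" "y \<in> frontier (ball z \<rho>0)"
    using assms unfolding uniform_outer_ball_def by (metis IntD1 order_refl)
  have yz: "norm (y - z) = \<rho>0"
    using z(2) \<rho>0 by (simp add: dist_norm norm_minus_commute)
  define a where "a = (1/2) *\<^sub>R (z + y)"
  have xz: "\<rho>0 \<le> norm (x - z)" if "x \<in> closure \<Omega>" for x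
  proof -
    have "closure \<Omega> \<subseteq> - ball z \<rho>0" using z(1) by (intro closure_minimal) auto
    then show ?thesis using that by (auto simp: dist_norm norm_minus_commute)
  qed
  have id: "(norm (x - a))\<^sup>2 = (norm (x - z))\<^sup>2 / 2 + (norm (x - y))\<^sup>2 / 2 - (norm (y - z))\<^sup>2 / 4" for x
    unfolding a_def power2_norm_eq_inner
    by (simp add: inner_diff_left inner_diff_right inner_add_left inner_add_right inner_commute field_simps)
  show ?thesis
  proof (rule that[of "\<rho>0 / 2" a])
    show "(norm (y - a))\<^sup>2 = (\<rho>0 / 2)\<^sup>2" unfolding id yz by (simp add: power2_eq_square)
    show "(\<rho>0 / 2)\<^sup>2 + (norm (x - y))\<^sup>2 / 2 \<le> (norm (x - a))\<^sup>2" if "x \<in> closure \<Omega>" for x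
      using power_mono[OF xz[OF that], of 2] \<rho>0 unfolding id yz by (simp add: power2_eq_square field_simps)
  qed (use \<rho>0 in simp)
qed

lemma plap_mat_1_bounded:
  assumes "p \<ge> 2"
  shows "\<exists>D\<ge>0. \<forall>v::real ^ 'n. norm v \<le> r \<longrightarrow> plap p v (mat 1) \<le> D"
proof -
  have "continuous_on (cball 0 r) (\<lambda>v::real ^ 'n. plap p v (mat 1))"
    by (intro continuous_on_plap assms continuous_intros)
  then have "bounded ((\<lambda>v::real ^ 'n. plap p v (mat 1)) ` cball 0 r)"
    by (intro compact_imp_bounded compact_continuous_image) auto
  then obtain D where "\<forall>v\<in>cball (0::real ^ 'n) r. \<bar>plap p v (mat 1)\<bar> \<le> D"
    unfolding bounded_iff by auto
  then have "plap p v (mat 1) \<le> max 0 D" if "norm v \<le> r" for v :: "real ^ 'n"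
    using that abs_le_D1 by (metis dist_0_norm max.coboundedI2 mem_cball)
  then show ?thesis by (intro exI[of _ "max 0 D"]) simp
qed

text \<open>For the barriers at initial points, whose profiles \<open>1 + \<epsilon> * E * s\<close>
  are affine in the squared distance; the sign comes out because \<open>plap\<close> is odd in the
  jet.\<close>

lemma radial_plap_quadratic_profile:
  fixes v :: "real ^ 'n"
  assumes "E > 0" "\<bar>\<epsilon>\<bar> = 1"
  shows "radial_plap p (\<epsilon> * E) 0 v = \<epsilon> * ((2 * E) powr (p - 1) * plap p v (mat 1))"
proof -
  have "plap p ((2 * E) *\<^sub>R v) ((2 * E) *\<^sub>R mat 1) = (2 * E) powr (p - 1) * plap p v (mat 1)"
    using assms by (intro plap_homogeneous) simp
  moreover have "\<epsilon> = 1 \<or> \<epsilon> = - 1" using assms by auto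
  ultimately show ?thesis
    using plap_minus[of p "(2 * E) *\<^sub>R v" "(2 * E) *\<^sub>R mat 1"] by (auto simp: radial_plap_def)
qed

lemma boundary_layer:
  fixes \<Omega> :: "(real ^ 'n) set"
  assumes "uniform_outer_ball \<Omega>" and y: "y \<in> frontier \<Omega>" and p: "p \<ge> 2" and E: "E > 0" and \<delta>: "\<delta> > 0"
  obtains a R \<alpha> q where "\<And>s. q s = exp (- \<alpha> * (s - R\<^sup>2))" "(norm (y - a))\<^sup>2 = R\<^sup>2"
    "\<And>x. x \<in> closure \<Omega> \<Longrightarrow> q ((norm (x - a))\<^sup>2) \<le> 1"
    "\<And>x. x \<in> closure \<Omega> \<Longrightarrow> \<delta> \<le> norm (x - y) \<Longrightarrow> q ((norm (x - a))\<^sup>2) \<le> 1/2"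
    "\<And>x \<epsilon>. x \<in> closure \<Omega> \<Longrightarrow> 1/2 \<le> q ((norm (x - a))\<^sup>2) \<Longrightarrow> \<bar>\<epsilon>\<bar> = 1 \<Longrightarrow> L \<le> - \<epsilon> *
      radial_plap p (\<epsilon> * E * \<alpha> * q ((norm (x - a))\<^sup>2)) (- \<epsilon> * E * \<alpha>\<^sup>2 * q ((norm (x - a))\<^sup>2)) (x - a)"
proof -
  obtain a R where aR: "R > 0" "(norm (y - a))\<^sup>2 = R\<^sup>2"
    "\<And>x. x \<in> closure \<Omega> \<Longrightarrow> R\<^sup>2 + (norm (x - y))\<^sup>2 / 2 \<le> (norm (x - a))\<^sup>2"
    using outer_ball_halved[OF assms(1) y] by metis
  obtain \<alpha>0 where \<alpha>0: "\<alpha>0 \<ge> 1" "\<And>\<alpha> q r. \<alpha> \<ge> \<alpha>0 \<Longrightarrow> q \<ge> 1/2 \<Longrightarrow> r \<ge> R \<Longrightarrow>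
    L \<le> (2 * E * \<alpha> * q * r) powr (p - 2) * (2 * E * \<alpha> * q * (2 * \<alpha> * (p - 1) * r\<^sup>2 - (CARD('n) + p - 2)))"
    using boundary_layer_estimate[OF p E aR(1), of "CARD('n) + p - 2" L] p by auto
  \<comment> \<open>The second entry makes \<open>q\<close> at most \<open>1/2\<close> from distance
    \<open>\<delta>\<close> on, so the layer \<open>q > 1/2\<close> lies within distance
    \<open>\<delta>\<close> of \<open>y\<close>.\<close>
  define \<alpha> where "\<alpha> = max \<alpha>0 (2 * ln 2 / \<delta>\<^sup>2)"
  have \<alpha>: "\<alpha> \<ge> \<alpha>0" "\<alpha> > 0" "\<alpha> \<ge> 2 * ln 2 / \<delta>\<^sup>2" using \<alpha>0 by (auto simp: \<alpha>_def)
  define q where "q s = exp (- \<alpha> * (s - R\<^sup>2))" for s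
  have s: "R\<^sup>2 \<le> (norm (x - a))\<^sup>2" "R \<le> norm (x - a)" if "x \<in> closure \<Omega>" for x
  proof -
    show 1: "R\<^sup>2 \<le> (norm (x - a))\<^sup>2" using aR(3)[OF that] zero_le_power2[of "norm (x - y)"] by linarith
    show "R \<le> norm (x - a)" using power2_le_imp_le[OF 1] by simp
  qed
  show ?thesis
  proof (rule that[of q \<alpha> R a])
    show "q s = exp (- \<alpha> * (s - R\<^sup>2))" for s by (rule q_def)
    show "(norm (y - a))\<^sup>2 = R\<^sup>2" by (rule aR(2))
  next
    fix x assume x: "x \<in> closure \<Omega>"
    show "q ((norm (x - a))\<^sup>2) \<le> 1" using s(1)[OF x] \<alpha> by (simp add: q_def)
  next
    fix x assume x: "x \<in> closure \<Omega>" and "\<delta> \<le> norm (x - y)"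
    then have "\<delta>\<^sup>2 \<le> (norm (x - y))\<^sup>2" using \<delta> by (intro power_mono) auto
    then have "\<delta>\<^sup>2 / 2 \<le> (norm (x - a))\<^sup>2 - R\<^sup>2" using aR(3)[OF x] by linarith
    then have "\<alpha> * (\<delta>\<^sup>2 / 2) \<le> \<alpha> * ((norm (x - a))\<^sup>2 - R\<^sup>2)" using \<alpha> by (intro mult_left_mono) auto
    moreover have "ln 2 \<le> \<alpha> * (\<delta>\<^sup>2 / 2)" using \<alpha>(3) \<delta> by (simp add: pos_divide_le_eq)
    ultimately have "- \<alpha> * ((norm (x - a))\<^sup>2 - R\<^sup>2) \<le> - ln 2" by linarith
    then have "q ((norm (x - a))\<^sup>2) \<le> exp (- ln 2)" unfolding q_def by (rule exp_le_cancel_iff[THEN iffD2])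
    then show "q ((norm (x - a))\<^sup>2) \<le> 1/2" by (simp add: exp_minus)
  next
    fix x \<epsilon> assume x: "x \<in> closure \<Omega>" and q: "1/2 \<le> q ((norm (x - a))\<^sup>2)" and \<epsilon>: "\<bar>\<epsilon>\<bar> = (1::real)"
    then have "x - a \<noteq> 0" "\<epsilon> * \<epsilon> = 1" using s(2)[OF x] aR(1) by (auto simp: abs_if split: if_splits)
    then show "L \<le> - \<epsilon> * radial_plap p (\<epsilon> * E * \<alpha> * q ((norm (x - a))\<^sup>2))
        (- \<epsilon> * E * \<alpha>\<^sup>2 * q ((norm (x - a))\<^sup>2)) (x - a)"
      using \<alpha>0(2)[OF \<alpha>(1) q s(2)[OF x]] q p E \<alpha>(2) \<epsilon>
      by (subst radial_plap_exp_profile) (auto simp: mult.assoc[symmetric])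
  qed
qed

text \<open>At a lateral point a steep exponential profile rises in space and
  \<open>exp (B * (t - t0)\<^sup>2)\<close> rises in time, on both sides of \<open>t0\<close>;
  truncation at \<open>M\<close> leaves the differential inequality to be checked only in the
  boundary layer. At an initial point inside \<open>\<Omega>\<close>, where only later times occur,
  a quadratic profile and an exponential factor in time serve.\<close>

lemma upper_barrier:
  fixes \<Omega> :: "(real ^ 'n) set"
  assumes \<Omega>: "open \<Omega>" "bounded \<Omega>" "uniform_outer_ball \<Omega>" and p: "p \<ge> 2" and T: "T > 0"
    and y: "(y, t0) \<in> parabolic_boundary \<Omega> T" and C: "0 < C" "C \<le> M" and \<delta>: "\<delta> > 0"
  shows "\<exists>V. continuous_on UNIV V \<and> viscosity_supersolution p (cylinder \<Omega> T) V \<and> V (y, t0) \<le> C \<and>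
    (\<forall>x\<in>closure \<Omega>. \<forall>t\<in>{0..T}. C \<le> V (x, t) \<and>
      (\<delta> \<le> norm (x - y) \<or> \<delta> \<le> \<bar>t - t0\<bar> \<longrightarrow> M \<le> V (x, t)))"
proof (cases "y \<in> frontier \<Omega>")
  case True
  have t0: "0 \<le> t0" "t0 < T" using True y \<Omega>(1)
    by (auto simp: parabolic_boundary_def frontier_def interior_open)
  have M: "M > 0" using C by simp
  \<comment> \<open>With this amplitude \<open>\<phi> \<le> M / C\<close> forces
    \<open>q \<ge> 1/2\<close>, and \<open>q \<le> 1/2\<close> forces
    \<open>\<phi> \<ge> M / C\<close>.\<close>
  define E where "E = 2 * (M / C)"
  have MC: "M / C \<ge> 1" using C by simp
  have E: "E > 0" using C M by (simp add: E_def)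
  \<comment> \<open>Makes the time factor reach \<open>M / C\<close> when \<open>t\<close> is at
    distance \<open>\<delta>\<close> from \<open>t0\<close>.\<close>
  define B where "B = ln (M / C) / \<delta>\<^sup>2"
  have B: "B \<ge> 0" using MC by (simp add: B_def)
  \<comment> \<open>Before \<open>t0\<close> the time factor decreases, with
    \<open>\<theta>' t \<ge> - 2 * B * T\<close>, while \<open>\<phi> \<le> 1 + E\<close>; the
    spatial layer has to compensate this much.\<close>
  define L where "L = (p - 1) * (1 + E) powr (p - 1) * (2 * B * T)"
  obtain a R \<alpha> q where q: "\<And>s. q s = exp (- \<alpha> * (s - R\<^sup>2))" and aR: "(norm (y - a))\<^sup>2 = R\<^sup>2"
    and q1: "\<And>x. x \<in> closure \<Omega> \<Longrightarrow> q ((norm (x - a))\<^sup>2) \<le> 1"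
    and q_far: "\<And>x. x \<in> closure \<Omega> \<Longrightarrow> \<delta> \<le> norm (x - y) \<Longrightarrow> q ((norm (x - a))\<^sup>2) \<le> 1/2"
    and layer: "\<And>x \<epsilon>. x \<in> closure \<Omega> \<Longrightarrow> 1/2 \<le> q ((norm (x - a))\<^sup>2) \<Longrightarrow> \<bar>\<epsilon>\<bar> = 1 \<Longrightarrow> L \<le> - \<epsilon> *
      radial_plap p (\<epsilon> * E * \<alpha> * q ((norm (x - a))\<^sup>2)) (- \<epsilon> * E * \<alpha>\<^sup>2 * q ((norm (x - a))\<^sup>2)) (x - a)"
    using boundary_layer[OF \<Omega>(3) True p E \<delta>, of L] by metis
  define \<phi> where "\<phi> s = 1 + 1 * (E * (1 - exp (- \<alpha> * (s - R\<^sup>2))))" for s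
  define \<phi>' where "\<phi>' s = 1 * E * \<alpha> * exp (- \<alpha> * (s - R\<^sup>2))" for s
  define \<phi>'' where "\<phi>'' s = - 1 * E * \<alpha>\<^sup>2 * exp (- \<alpha> * (s - R\<^sup>2))" for s
  have d\<phi>: "(\<phi> has_real_derivative \<phi>' s) (at s)" "(\<phi>' has_real_derivative \<phi>'' s) (at s)"
    "continuous_on UNIV \<phi>''" for s
    using exp_profile_derivatives[of 1 E \<alpha> R] unfolding \<phi>_def[abs_def] \<phi>'_def[abs_def] \<phi>''_def[abs_def] .
  define \<theta> where "\<theta> t = ln C + B * (t - t0)\<^sup>2" for t
  define \<theta>' where "\<theta>' t = B * (2 * (t - t0))" for t
  have d\<theta>: "(\<theta> has_real_derivative \<theta>' t) (at t)" for t
    unfolding \<theta>_def \<theta>'_def by (auto intro!: derivative_eq_intros)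
  have c\<theta>': "continuous_on UNIV \<theta>'" unfolding \<theta>'_def by (intro continuous_intros)
  have e\<theta>: "exp (\<theta> t) = C * exp (B * (t - t0)\<^sup>2)" for t using C by (simp add: \<theta>_def exp_add)
  have e\<theta>C: "C \<le> exp (\<theta> t)" for t unfolding e\<theta> using B C by simp
  have \<phi>q: "\<phi> s = 1 + E * (1 - q s)" for s by (simp add: \<phi>_def q)
  have \<phi>1: "1 \<le> \<phi> ((norm (x - a))\<^sup>2)" if "x \<in> closure \<Omega>" for x
    unfolding \<phi>q using q1[OF that] E by simp
  define W where "W z = exp (\<theta> (snd z)) * \<phi> ((norm (fst z - a))\<^sup>2)" for z
  have "viscosity_supersolution p (cylinder \<Omega> T) (\<lambda>z. min M (W z))"
    unfolding W_def
  proof (rule radial_supersolution[OF p open_cylinder[OF \<Omega>(1)] M d\<phi> d\<theta> c\<theta>'])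
    fix x t assume "(x, t) \<in> cylinder \<Omega> T"
    then have x: "x \<in> closure \<Omega>" and t: "0 < t" "t < T" using closure_subset by (auto simp: cylinder_def)
    show "0 < \<phi> ((norm (x - a))\<^sup>2)" using \<phi>1[OF x] by simp
    define r where "r = norm (x - a)"
    assume "exp (\<theta> t) * \<phi> ((norm (x - a))\<^sup>2) \<le> M"
    then have "exp (\<theta> t) * \<phi> (r\<^sup>2) \<le> M" by (simp add: r_def)
    moreover have "C * \<phi> (r\<^sup>2) \<le> exp (\<theta> t) * \<phi> (r\<^sup>2)"
      using e\<theta>C[of t] \<phi>1[OF x] by (intro mult_right_mono) (auto simp: r_def)
    ultimately have "\<phi> (r\<^sup>2) \<le> M / C" using C by (simp add: pos_le_divide_eq mult.commute)
    then have "2 * (M / C) * (1 - q (r\<^sup>2)) \<le> (M / C) * 1" unfolding \<phi>q E_def by simp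
    then have qh: "q (r\<^sup>2) \<ge> 1/2" using C M by (simp add: field_simps)
    have "radial_plap p (\<phi>' ((norm (x - a))\<^sup>2)) (\<phi>'' ((norm (x - a))\<^sup>2)) (x - a) \<le> - L"
      using layer[OF x, of 1] qh unfolding \<phi>'_def \<phi>''_def r_def q by simp
    also have "\<dots> \<le> (p - 1) * \<phi> ((norm (x - a))\<^sup>2) powr (p - 1) * \<theta>' t"
    proof -
      have "- \<theta>' t \<le> 2 * B * T" unfolding \<theta>'_def using B t t0
        using mult_left_mono[of "t0 - t" T "2 * B"] by (simp add: algebra_simps)
      have "\<phi> (r\<^sup>2) \<le> 1 + E" unfolding \<phi>q using E by (simp add: q)
      then have "\<phi> (r\<^sup>2) powr (p - 1) \<le> (1 + E) powr (p - 1)"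
        using \<phi>1[OF x] p by (intro powr_mono2) (auto simp: r_def)
      then have "\<phi> (r\<^sup>2) powr (p - 1) * (- \<theta>' t) \<le> (1 + E) powr (p - 1) * (2 * B * T)"
        using \<open>- \<theta>' t \<le> 2 * B * T\<close> B T
        by (intro order_trans[OF mult_left_mono mult_right_mono]) auto
      then have "(p - 1) * (\<phi> (r\<^sup>2) powr (p - 1) * (- \<theta>' t)) \<le> (p - 1) * ((1 + E) powr (p - 1) * (2 * B * T))"
        using p by (intro mult_left_mono) auto
      then show ?thesis unfolding L_def r_def by simp
    qed
    finally show "radial_plap p (\<phi>' ((norm (x - a))\<^sup>2)) (\<phi>'' ((norm (x - a))\<^sup>2)) (x - a)
      \<le> (p - 1) * \<phi> ((norm (x - a))\<^sup>2) powr (p - 1) * \<theta>' t" .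
  qed
  moreover have "continuous_on UNIV (\<lambda>z. min M (W z))"
    unfolding W_def \<theta>_def \<phi>_def by (intro continuous_intros)
  moreover have "W (y, t0) = C" using C by (simp add: W_def \<theta>_def \<phi>_def aR)
  moreover have "C \<le> W (x, t)" if "x \<in> closure \<Omega>" for x t
    using mult_mono[OF e\<theta>C[of t] \<phi>1[OF that]] C by (simp add: W_def)
  moreover have "M \<le> W (x, t)" if x: "x \<in> closure \<Omega>" and far: "\<delta> \<le> norm (x - y) \<or> \<delta> \<le> \<bar>t - t0\<bar>" for x t
    using far
  proof
    assume "\<delta> \<le> norm (x - y)"
    from q_far[OF x this]
    have "E * (1/2) \<le> E * (1 - q ((norm (x - a))\<^sup>2))" using E by (intro mult_left_mono) auto
    then have "M / C \<le> \<phi> ((norm (x - a))\<^sup>2)" unfolding \<phi>q by (simp add: E_def)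
    then have "C * (M / C) \<le> W (x, t)" unfolding W_def using e\<theta>C[of t] C M by (intro mult_mono) auto
    then show ?thesis using C by simp
  next
    assume "\<delta> \<le> \<bar>t - t0\<bar>"
    then have "\<delta>\<^sup>2 \<le> (t - t0)\<^sup>2" using \<delta> by (metis abs_le_square_iff abs_of_pos)
    then have "B * \<delta>\<^sup>2 \<le> B * (t - t0)\<^sup>2" using B by (intro mult_left_mono)
    then have "ln (M / C) \<le> B * (t - t0)\<^sup>2" using \<delta> by (simp add: B_def)
    then have "M / C \<le> exp (B * (t - t0)\<^sup>2)" using C M by (metis divide_pos_pos exp_le_cancel_iff exp_ln)
    then have "C * (M / C) \<le> exp (\<theta> t)" unfolding e\<theta> using C by (intro mult_left_mono) auto
    then have "M * 1 \<le> W (x, t)" unfolding W_def using \<phi>1[OF x] C M by (intro mult_mono) auto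
    then show ?thesis by simp
  qed
  ultimately show ?thesis
    using C by (intro exI[of _ "\<lambda>z. min M (W z)"]) auto
next
  case False
  then have t0: "t0 = 0" and y\<Omega>: "y \<in> \<Omega>" using y by (auto simp: parabolic_boundary_def)
  have M: "M > 0" using C by simp
  have MC: "M / C \<ge> 1" using C by simp
  \<comment> \<open>Makes \<open>E * s\<close> equal to \<open>M / C\<close> at distance
    \<open>\<delta>\<close> from \<open>y\<close>.\<close>
  define E where "E = M / (C * \<delta>\<^sup>2)"
  have E: "E > 0" using C M \<delta> by (simp add: E_def)
  obtain r where r: "\<And>x. x \<in> \<Omega> \<Longrightarrow> norm (x - y) \<le> r"
    using \<Omega>(2) unfolding bounded_any_center[of _ y] by (auto simp: dist_norm norm_minus_commute)
  obtain D where D: "D \<ge> 0" "\<And>v::real ^ 'n. norm v \<le> r \<Longrightarrow> plap p v (mat 1) \<le> D"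
    using plap_mat_1_bounded[OF p, of r] by blast
  \<comment> \<open>The first entry dominates the \<open>p\<close>-Laplacian of the quadratic
    profile; the second makes the time factor reach \<open>M / C\<close> after time
    \<open>\<delta>\<close>.\<close>
  define \<mu> where "\<mu> = max ((2 * E) powr (p - 1) * D / (p - 1)) (ln (M / C) / \<delta>)"
  have \<mu>: "\<mu> \<ge> (2 * E) powr (p - 1) * D / (p - 1)" "\<mu> \<ge> ln (M / C) / \<delta>" by (auto simp: \<mu>_def)
  have "ln (M / C) \<ge> 0" using MC by simp
  then have \<mu>0: "\<mu> \<ge> 0" using \<mu>(2) \<delta> by (meson divide_nonneg_pos order_trans)
  define \<phi> where "\<phi> s = 1 + E * s" for s
  have d\<phi>: "(\<phi> has_real_derivative 1 * E) (at s)" "((\<lambda>s. 1 * E) has_real_derivative 0) (at s)"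
    "continuous_on UNIV (\<lambda>s::real. 0::real)" for s :: real
    unfolding \<phi>_def by (auto intro!: derivative_eq_intros)
  define \<theta> where "\<theta> t = ln C + \<mu> * t" for t
  have d\<theta>: "(\<theta> has_real_derivative \<mu>) (at t)" "continuous_on UNIV (\<lambda>t::real. \<mu>)" for t
    unfolding \<theta>_def by (auto intro!: derivative_eq_intros)
  have e\<theta>: "exp (\<theta> t) = C * exp (\<mu> * t)" for t using C by (simp add: \<theta>_def exp_add)
  have e\<theta>C: "C \<le> exp (\<theta> t)" if "t \<ge> 0" for t unfolding e\<theta> using \<mu>0 C that by simp
  have \<phi>1: "1 \<le> \<phi> ((norm (x - y))\<^sup>2)" for x using E by (simp add: \<phi>_def)
  define W where "W z = exp (\<theta> (snd z)) * \<phi> ((norm (fst z - y))\<^sup>2)" for z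
  have "viscosity_supersolution p (cylinder \<Omega> T) (\<lambda>z. min M (W z))"
    unfolding W_def
  proof (rule radial_supersolution[OF p open_cylinder[OF \<Omega>(1)] M d\<phi> d\<theta>])
    fix x t assume "(x, t) \<in> cylinder \<Omega> T"
    then have x: "x \<in> \<Omega>" by (auto simp: cylinder_def)
    show "0 < \<phi> ((norm (x - y))\<^sup>2)" using \<phi>1[of x] by simp
    have "radial_plap p (1 * E) 0 (x - y)
      = 1 * ((2 * E) powr (p - 1) * plap p (x - y) (mat 1))"
      by (rule radial_plap_quadratic_profile[OF E]) simp
    also have "\<dots> \<le> (2 * E) powr (p - 1) * D" using D(2)[OF r[OF x]] by (simp add: mult_left_mono)
    also have "\<dots> \<le> (p - 1) * 1 * \<mu>" using \<mu>(1) p by (simp add: pos_divide_le_eq mult.commute)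
    also have "\<dots> \<le> (p - 1) * \<phi> ((norm (x - y))\<^sup>2) powr (p - 1) * \<mu>"
      using p \<mu>0 \<phi>1[of x] by (intro mult_right_mono mult_left_mono ge_one_powr_ge_zero) auto
    finally show "radial_plap p (1 * E) 0 (x - y)
      \<le> (p - 1) * \<phi> ((norm (x - y))\<^sup>2) powr (p - 1) * \<mu>" .
  qed
  moreover have "continuous_on UNIV (\<lambda>z. min M (W z))"
    unfolding W_def \<theta>_def \<phi>_def by (intro continuous_intros)
  moreover have "W (y, t0) = C" using C by (simp add: W_def \<theta>_def \<phi>_def t0)
  moreover have "C \<le> W (x, t)" if "t \<ge> 0" for x t
    using mult_mono[OF e\<theta>C[OF that] \<phi>1[of x]] C by (simp add: W_def)
  moreover have "M \<le> W (x, t)" if t: "t \<ge> 0" and far: "\<delta> \<le> norm (x - y) \<or> \<delta> \<le> \<bar>t - t0\<bar>" for x t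
    using far
  proof
    assume "\<delta> \<le> norm (x - y)"
    then have "\<delta>\<^sup>2 \<le> (norm (x - y))\<^sup>2" using \<delta> by (intro power_mono) auto
    then have "E * \<delta>\<^sup>2 \<le> E * (norm (x - y))\<^sup>2" using E by (intro mult_left_mono) auto
    moreover have "E * \<delta>\<^sup>2 = M / C" using \<delta> by (simp add: E_def)
    ultimately have "M / C \<le> \<phi> ((norm (x - y))\<^sup>2)" by (simp add: \<phi>_def)
    then have "C * (M / C) \<le> W (x, t)" unfolding W_def using e\<theta>C[OF t] C M by (intro mult_mono) auto
    then show ?thesis using C by simp
  next
    assume "\<delta> \<le> \<bar>t - t0\<bar>"
    then have "\<mu> * \<delta> \<le> \<mu> * t" using \<mu>0 t t0 by (intro mult_left_mono) auto
    then have "ln (M / C) \<le> \<mu> * t" using \<mu>(2) \<delta> by (simp add: pos_divide_le_eq)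
    then have "M / C \<le> exp (\<mu> * t)" using C M by (metis divide_pos_pos exp_le_cancel_iff exp_ln)
    then have "C * (M / C) \<le> exp (\<theta> t)" unfolding e\<theta> using C by (intro mult_left_mono) auto
    then have "M * 1 \<le> W (x, t)" unfolding W_def using \<phi>1[of x] C M by (intro mult_mono) auto
    then show ?thesis by simp
  qed
  ultimately show ?thesis
    using C by (intro exI[of _ "\<lambda>z. min M (W z)"]) auto
qed

text \<open>Mirror image of the upper barrier: the profiles decrease in space and the time factors
  decay away from \<open>t0\<close>. The bound \<open>m \<le> V\<close> comes from the truncation
  and makes the barrier admissible in Perron's class.\<close>

lemma lower_barrier:
  fixes \<Omega> :: "(real ^ 'n) set"
  assumes \<Omega>: "open \<Omega>" "bounded \<Omega>" "uniform_outer_ball \<Omega>" and p: "p \<ge> 2" and T: "T > 0"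
    and y: "(y, t0) \<in> parabolic_boundary \<Omega> T" and m: "0 < m" "m \<le> C" and \<delta>: "\<delta> > 0"
  shows "\<exists>V. continuous_on UNIV V \<and> viscosity_subsolution p (cylinder \<Omega> T) V \<and> C \<le> V (y, t0) \<and>
    (\<forall>z. m \<le> V z) \<and> (\<forall>x\<in>closure \<Omega>. \<forall>t\<in>{0..T}. V (x, t) \<le> C \<and>
      (\<delta> \<le> norm (x - y) \<or> \<delta> \<le> \<bar>t - t0\<bar> \<longrightarrow> V (x, t) \<le> m))"
proof (cases "y \<in> frontier \<Omega>")
  case True
  have t0: "0 \<le> t0" "t0 < T" using True y \<Omega>(1)
    by (auto simp: parabolic_boundary_def frontier_def interior_open)
  have C: "C > 0" using m by simp
  have Cm: "C / m \<ge> 1" using m by simp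
  define B where "B = ln (C / m) / \<delta>\<^sup>2"
  have B: "B \<ge> 0" using Cm by (simp add: B_def)
  define L where "L = (p - 1) * (2 * B * T)"
  obtain a R \<alpha> q where q: "\<And>s. q s = exp (- \<alpha> * (s - R\<^sup>2))" and aR: "(norm (y - a))\<^sup>2 = R\<^sup>2"
    and q1: "\<And>x. x \<in> closure \<Omega> \<Longrightarrow> q ((norm (x - a))\<^sup>2) \<le> 1"
    and q_far: "\<And>x. x \<in> closure \<Omega> \<Longrightarrow> \<delta> \<le> norm (x - y) \<Longrightarrow> q ((norm (x - a))\<^sup>2) \<le> 1/2"
    and layer: "\<And>x \<epsilon>. x \<in> closure \<Omega> \<Longrightarrow> 1/2 \<le> q ((norm (x - a))\<^sup>2) \<Longrightarrow> \<bar>\<epsilon>\<bar> = 1 \<Longrightarrow> L \<le> - \<epsilon> *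
      radial_plap p (\<epsilon> * 2 * \<alpha> * q ((norm (x - a))\<^sup>2)) (- \<epsilon> * 2 * \<alpha>\<^sup>2 * q ((norm (x - a))\<^sup>2)) (x - a)"
    using boundary_layer[OF \<Omega>(3) True p _ \<delta>, of 2 L] by (metis zero_less_numeral)
  \<comment> \<open>Amplitude 2 makes the profile positive exactly where \<open>q > 1/2\<close>;
    outside that layer the truncation at \<open>m > 0\<close> takes over.\<close>
  define \<phi> where "\<phi> s = 1 + (- 1) * (2 * (1 - exp (- \<alpha> * (s - R\<^sup>2))))" for s
  define \<phi>' where "\<phi>' s = (- 1) * 2 * \<alpha> * exp (- \<alpha> * (s - R\<^sup>2))" for s
  define \<phi>'' where "\<phi>'' s = - (- 1) * 2 * \<alpha>\<^sup>2 * exp (- \<alpha> * (s - R\<^sup>2))" for s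
  have d\<phi>: "(\<phi> has_real_derivative \<phi>' s) (at s)" "(\<phi>' has_real_derivative \<phi>'' s) (at s)"
    "continuous_on UNIV \<phi>''" for s
    using exp_profile_derivatives[of "- 1" 2 \<alpha> R] unfolding \<phi>_def[abs_def] \<phi>'_def[abs_def] \<phi>''_def[abs_def] .
  define \<theta> where "\<theta> t = ln C - B * (t - t0)\<^sup>2" for t
  define \<theta>' where "\<theta>' t = - (B * (2 * (t - t0)))" for t
  have d\<theta>: "(\<theta> has_real_derivative \<theta>' t) (at t)" for t
    unfolding \<theta>_def \<theta>'_def by (auto intro!: derivative_eq_intros)
  have c\<theta>': "continuous_on UNIV \<theta>'" unfolding \<theta>'_def by (intro continuous_intros)
  have e\<theta>: "exp (\<theta> t) = C * exp (- (B * (t - t0)\<^sup>2))" for t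
    using C by (simp add: \<theta>_def exp_diff exp_minus divide_inverse)
  have e\<theta>C: "exp (\<theta> t) \<le> C" for t unfolding e\<theta> using B C by simp
  have \<phi>q: "\<phi> s = 1 - 2 * (1 - q s)" for s by (simp add: \<phi>_def q)
  have \<phi>1: "\<phi> ((norm (x - a))\<^sup>2) \<le> 1" if "x \<in> closure \<Omega>" for x
    using q1[OF that] by (simp add: \<phi>q)
  define W where "W z = exp (\<theta> (snd z)) * \<phi> ((norm (fst z - a))\<^sup>2)" for z
  have "viscosity_subsolution p (cylinder \<Omega> T) (\<lambda>z. max m (W z))"
    unfolding W_def
  proof (rule radial_subsolution[OF p open_cylinder[OF \<Omega>(1)] m(1) d\<phi> d\<theta> c\<theta>'])
    fix x t assume "(x, t) \<in> cylinder \<Omega> T"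
    then have x: "x \<in> closure \<Omega>" and t: "0 < t" "t < T" using closure_subset by (auto simp: cylinder_def)
    define r where "r = norm (x - a)"
    assume \<phi>0: "0 < \<phi> ((norm (x - a))\<^sup>2)"
    then have qh: "q (r\<^sup>2) \<ge> 1/2" by (simp add: \<phi>q r_def)
    have "- \<theta>' t \<ge> - (2 * B * T)" unfolding \<theta>'_def using B t t0
      using mult_left_mono[of "t0 - t" T "2 * B"] by (simp add: algebra_simps)
    then have "\<theta>' t \<le> 2 * B * T" by simp
    moreover have "\<phi> ((norm (x - a))\<^sup>2) powr (p - 1) \<le> 1"
      using \<phi>0 \<phi>1[OF x] p by (intro powr_le1) auto
    ultimately have "\<phi> ((norm (x - a))\<^sup>2) powr (p - 1) * \<theta>' t \<le> 1 * (2 * B * T)"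
      using B T by (intro order_trans[OF mult_left_mono mult_right_mono]) auto
    then have "(p - 1) * (\<phi> ((norm (x - a))\<^sup>2) powr (p - 1) * \<theta>' t) \<le> (p - 1) * (1 * (2 * B * T))"
      using p by (intro mult_left_mono) auto
    then have "(p - 1) * \<phi> ((norm (x - a))\<^sup>2) powr (p - 1) * \<theta>' t \<le> L" unfolding L_def by simp
    also have "\<dots> \<le> radial_plap p (\<phi>' ((norm (x - a))\<^sup>2)) (\<phi>'' ((norm (x - a))\<^sup>2)) (x - a)"
      using layer[OF x, of "- 1"] qh unfolding \<phi>'_def \<phi>''_def r_def q by simp
    finally show "(p - 1) * \<phi> ((norm (x - a))\<^sup>2) powr (p - 1) * \<theta>' t
      \<le> radial_plap p (\<phi>' ((norm (x - a))\<^sup>2)) (\<phi>'' ((norm (x - a))\<^sup>2)) (x - a)" .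
  qed
  moreover have "continuous_on UNIV (\<lambda>z. max m (W z))"
    unfolding W_def \<theta>_def \<phi>_def by (intro continuous_intros)
  moreover have "W (y, t0) = C" using C by (simp add: W_def \<theta>_def \<phi>_def aR)
  moreover have le\<theta>: "W (x, t) \<le> exp (\<theta> t)" if "x \<in> closure \<Omega>" for x t
    using mult_left_mono[OF \<phi>1[OF that], of "exp (\<theta> t)"] by (simp add: W_def)
  moreover have "W (x, t) \<le> m" if x: "x \<in> closure \<Omega>" and far: "\<delta> \<le> norm (x - y) \<or> \<delta> \<le> \<bar>t - t0\<bar>" for x t
    using far
  proof
    assume "\<delta> \<le> norm (x - y)"
    from q_far[OF x this] have "\<phi> ((norm (x - a))\<^sup>2) \<le> 0" unfolding \<phi>q by simp
    then have "W (x, t) \<le> 0" unfolding W_def by (simp add: mult_nonneg_nonpos)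
    then show ?thesis using m by simp
  next
    assume "\<delta> \<le> \<bar>t - t0\<bar>"
    then have "\<delta>\<^sup>2 \<le> (t - t0)\<^sup>2" using \<delta> by (metis abs_le_square_iff abs_of_pos)
    then have "B * \<delta>\<^sup>2 \<le> B * (t - t0)\<^sup>2" using B by (intro mult_left_mono)
    then have "ln (C / m) \<le> B * (t - t0)\<^sup>2" using \<delta> by (simp add: B_def)
    then have "exp (- (B * (t - t0)\<^sup>2)) \<le> exp (- ln (C / m))" by simp
    also have "\<dots> = m / C" using C m by (simp add: exp_minus)
    finally have "exp (\<theta> t) \<le> C * (m / C)" unfolding e\<theta> using C by (intro mult_left_mono) auto
    then show ?thesis using le\<theta>[OF x, of t] C by simp
  qed
  moreover have "W (x, t) \<le> C" if "x \<in> closure \<Omega>" for x t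
    using le\<theta>[OF that, of t] e\<theta>C[of t] by simp
  ultimately show ?thesis
    using m by (intro exI[of _ "\<lambda>z. max m (W z)"]) auto
next
  case False
  then have t0: "t0 = 0" and y\<Omega>: "y \<in> \<Omega>" using y by (auto simp: parabolic_boundary_def)
  have C: "C > 0" using m by simp
  have Cm: "C / m \<ge> 1" using m by simp
  define E where "E = 1 / \<delta>\<^sup>2"
  have E: "E > 0" using \<delta> by (simp add: E_def)
  obtain r where r: "\<And>x. x \<in> \<Omega> \<Longrightarrow> norm (x - y) \<le> r"
    using \<Omega>(2) unfolding bounded_any_center[of _ y] by (auto simp: dist_norm norm_minus_commute)
  obtain D where D: "D \<ge> 0" "\<And>v::real ^ 'n. norm v \<le> r \<Longrightarrow> plap p v (mat 1) \<le> D"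
    using plap_mat_1_bounded[OF p, of r] by blast
  \<comment> \<open>Where \<open>W \<ge> m\<close> the profile is at least \<open>m / C\<close>, so
    \<open>k\<close> bounds \<open>\<phi> powr (p - 1)\<close> from below there. Without such a
    bound the decay in time could not dominate the \<open>p\<close>-Laplacian of the
    profile.\<close>
  define k where "k = (m / C) powr (p - 1)"
  have k: "k > 0" using m C by (simp add: k_def)
  define \<mu> where "\<mu> = max ((2 * E) powr (p - 1) * D / ((p - 1) * k)) (ln (C / m) / \<delta>)"
  have \<mu>: "\<mu> \<ge> (2 * E) powr (p - 1) * D / ((p - 1) * k)" "\<mu> \<ge> ln (C / m) / \<delta>" by (auto simp: \<mu>_def)
  have "ln (C / m) \<ge> 0" using Cm by simp
  then have \<mu>0: "\<mu> \<ge> 0" using \<mu>(2) \<delta> by (meson divide_nonneg_pos order_trans)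
  define \<phi> where "\<phi> s = 1 + (- 1) * E * s" for s
  have d\<phi>: "(\<phi> has_real_derivative (- 1) * E) (at s)" "((\<lambda>s. (- 1) * E) has_real_derivative 0) (at s)"
    "continuous_on UNIV (\<lambda>s::real. 0::real)" for s :: real
    unfolding \<phi>_def by (auto intro!: derivative_eq_intros)
  define \<theta> where "\<theta> t = ln C - \<mu> * t" for t
  have d\<theta>: "(\<theta> has_real_derivative - \<mu>) (at t)" "continuous_on UNIV (\<lambda>t::real. - \<mu>)" for t
    unfolding \<theta>_def by (auto intro!: derivative_eq_intros)
  have e\<theta>: "exp (\<theta> t) = C * exp (- (\<mu> * t))" for t
    using C by (simp add: \<theta>_def exp_diff exp_minus divide_inverse)
  have e\<theta>C: "exp (\<theta> t) \<le> C" if "t \<ge> 0" for t unfolding e\<theta> using \<mu>0 C that by simp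
  have \<phi>1: "\<phi> ((norm (x - y))\<^sup>2) \<le> 1" for x using E by (simp add: \<phi>_def)
  define W where "W z = exp (\<theta> (snd z)) * \<phi> ((norm (fst z - y))\<^sup>2)" for z
  have "viscosity_subsolution p (cylinder \<Omega> T) (\<lambda>z. max m (W z))"
    unfolding W_def
  proof (rule radial_subsolution[OF p open_cylinder[OF \<Omega>(1)] m(1) d\<phi> d\<theta>])
    fix x t assume "(x, t) \<in> cylinder \<Omega> T"
    then have x: "x \<in> \<Omega>" and t: "t \<ge> 0" by (auto simp: cylinder_def)
    assume \<phi>0: "0 < \<phi> ((norm (x - y))\<^sup>2)"
    assume "m \<le> exp (\<theta> t) * \<phi> ((norm (x - y))\<^sup>2)"
    also have "\<dots> \<le> C * \<phi> ((norm (x - y))\<^sup>2)" using e\<theta>C[OF t] \<phi>0 by (intro mult_right_mono) auto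
    finally have "m / C \<le> \<phi> ((norm (x - y))\<^sup>2)" using C by (simp add: pos_divide_le_eq mult.commute)
    then have k\<phi>: "k \<le> \<phi> ((norm (x - y))\<^sup>2) powr (p - 1)"
      unfolding k_def using m C p by (intro powr_mono2) auto
    have "(2 * E) powr (p - 1) * plap p (x - y) (mat 1) \<le> (2 * E) powr (p - 1) * D"
      using D(2)[OF r[OF x]] by (simp add: mult_left_mono)
    also have "\<dots> \<le> (p - 1) * k * \<mu>" using \<mu>(1) p k by (simp add: pos_divide_le_eq mult_ac)
    also have "\<dots> \<le> (p - 1) * \<phi> ((norm (x - y))\<^sup>2) powr (p - 1) * \<mu>"
      using p \<mu>0 k\<phi> by (intro mult_right_mono mult_left_mono) auto
    finally have "(p - 1) * \<phi> ((norm (x - y))\<^sup>2) powr (p - 1) * (- \<mu>)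
      \<le> (- 1) * ((2 * E) powr (p - 1) * plap p (x - y) (mat 1))" by simp
    also have "\<dots> = radial_plap p ((- 1) * E) 0 (x - y)"
      by (rule radial_plap_quadratic_profile[OF E, symmetric]) simp
    finally show "(p - 1) * \<phi> ((norm (x - y))\<^sup>2) powr (p - 1) * (- \<mu>)
      \<le> radial_plap p ((- 1) * E) 0 (x - y)" .
  qed
  moreover have "continuous_on UNIV (\<lambda>z. max m (W z))"
    unfolding W_def \<theta>_def \<phi>_def by (intro continuous_intros)
  moreover have "W (y, t0) = C" using C by (simp add: W_def \<theta>_def \<phi>_def t0)
  moreover have le\<theta>: "W (x, t) \<le> exp (\<theta> t)" for x t
    using mult_left_mono[OF \<phi>1[of x], of "exp (\<theta> t)"] by (simp add: W_def)
  moreover have "W (x, t) \<le> m" if t: "t \<ge> 0" and far: "\<delta> \<le> norm (x - y) \<or> \<delta> \<le> \<bar>t - t0\<bar>" for x t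
    using far
  proof
    assume "\<delta> \<le> norm (x - y)"
    then have "\<delta>\<^sup>2 \<le> (norm (x - y))\<^sup>2" using \<delta> by (intro power_mono) auto
    then have "E * \<delta>\<^sup>2 \<le> E * (norm (x - y))\<^sup>2" using E by (intro mult_left_mono) auto
    moreover have "E * \<delta>\<^sup>2 = 1" using \<delta> by (simp add: E_def)
    ultimately have "\<phi> ((norm (x - y))\<^sup>2) \<le> 0" by (simp add: \<phi>_def)
    then have "W (x, t) \<le> 0" unfolding W_def by (simp add: mult_nonneg_nonpos)
    then show ?thesis using m by simp
  next
    assume "\<delta> \<le> \<bar>t - t0\<bar>"
    then have "\<mu> * \<delta> \<le> \<mu> * t" using \<mu>0 t t0 by (intro mult_left_mono) auto
    moreover have "ln (C / m) \<le> \<mu> * \<delta>" using \<mu>(2) \<delta> by (simp add: pos_divide_le_eq)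
    ultimately have "exp (- (\<mu> * t)) \<le> exp (- ln (C / m))" by simp
    also have "\<dots> = m / C" using C m by (simp add: exp_minus)
    finally have "exp (\<theta> t) \<le> C * (m / C)" unfolding e\<theta> using C by (intro mult_left_mono) auto
    then show ?thesis using le\<theta>[of x t] C by simp
  qed
  moreover have "W (x, t) \<le> C" if "t \<ge> 0" for x t
    using le\<theta>[of x t] e\<theta>C[OF that] by simp
  ultimately show ?thesis
    using m by (intro exI[of _ "\<lambda>z. max m (W z)"]) auto
qed

section \<open>Perron's method\<close>

text \<open>The upper limit of \<open>u\<close> at \<open>z\<close> within \<open>D\<close>, with
  \<open>z\<close> itself included. Local boundedness, defined next, makes the set of local bounds
  nonempty, so that the infimum is meaningful.\<close>

definition usc_envelope :: "'a::metric_space set \<Rightarrow> ('a \<Rightarrow> real) \<Rightarrow> 'a \<Rightarrow> real"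
  where "usc_envelope D u z = Inf {c. \<exists>r>0. \<forall>w\<in>D \<inter> ball z r. u w \<le> c}"

definition locally_bdd_above :: "'a::metric_space set \<Rightarrow> ('a \<Rightarrow> real) \<Rightarrow> bool"
  where "locally_bdd_above D u \<longleftrightarrow> (\<forall>z\<in>D. \<exists>c. \<exists>r>0. \<forall>w\<in>D \<inter> ball z r. u w \<le> c)"

lemma usc_envelope_le:
  assumes "z \<in> D" "r > 0" "\<And>w. w \<in> D \<Longrightarrow> w \<in> ball z r \<Longrightarrow> u w \<le> c"
  shows "usc_envelope D u z \<le> c"
  unfolding usc_envelope_def
proof (rule cInf_lower)
  show "bdd_below {c. \<exists>r>0. \<forall>w\<in>D \<inter> ball z r. u w \<le> c}"
    using \<open>z \<in> D\<close> by (intro bdd_belowI[of _ "u z"]) (auto simp: Bex_def)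
qed (use assms in blast)

lemma usc_envelope_ge:
  assumes "locally_bdd_above D u" "z \<in> D"
  shows "u z \<le> usc_envelope D u z"
  unfolding usc_envelope_def
proof (rule cInf_greatest)
  show "{c. \<exists>r>0. \<forall>w\<in>D \<inter> ball z r. u w \<le> c} \<noteq> {}"
    using assms unfolding locally_bdd_above_def by blast
  show "u z \<le> c" if "c \<in> {c. \<exists>r>0. \<forall>w\<in>D \<inter> ball z r. u w \<le> c}" for c
    using that assms(2) by auto
qed

lemma usc_envelope_lessD:
  assumes "locally_bdd_above D u" "z \<in> D" "usc_envelope D u z < c"
  obtains r c' where "r > 0" "c' < c" "\<And>w. w \<in> D \<Longrightarrow> w \<in> ball z r \<Longrightarrow> u w \<le> c'"
proof -
  have "{c. \<exists>r>0. \<forall>w\<in>D \<inter> ball z r. u w \<le> c} \<noteq> {}"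
    using assms(1,2) unfolding locally_bdd_above_def by blast
  then obtain c' where "c' \<in> {c. \<exists>r>0. \<forall>w\<in>D \<inter> ball z r. u w \<le> c}" "c' < c"
    using assms(3) unfolding usc_envelope_def by (meson cInf_lessD)
  then show ?thesis using that by auto
qed

lemma upper_semicont_on_usc_envelope:
  assumes "locally_bdd_above D u"
  shows "upper_semicont_on D (usc_envelope D u)"
proof (rule upper_semicont_onI)
  fix z c assume "z \<in> D" "usc_envelope D u z < c"
  then obtain r c' where r: "r > 0" "c' < c" "\<And>w. w \<in> D \<Longrightarrow> w \<in> ball z r \<Longrightarrow> u w \<le> c'"
    using usc_envelope_lessD[OF assms] by metis
  have "usc_envelope D u w < c" if "w \<in> ball z r \<inter> D" for w
  proof -
    have "w \<in> ball z r" using that by blast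
    then obtain e where "e > 0" "ball w e \<subseteq> ball z r" by (rule openE[OF open_ball])
    then have "usc_envelope D u w \<le> c'" using that r(3) by (intro usc_envelope_le[of _ _ e]) auto
    then show ?thesis using r(2) by simp
  qed
  then show "\<exists>U. open U \<and> z \<in> U \<and> (\<forall>w\<in>U \<inter> D. usc_envelope D u w < c)"
    using r(1) by (intro exI[of _ "ball z r"]) auto
qed

lemma usc_envelope_approx:
  assumes "z \<in> D" "c < usc_envelope D u z" "r > 0"
  obtains w where "w \<in> D" "w \<in> ball z r" "c < u w"
proof -
  have "\<not> (\<forall>w\<in>D. w \<in> ball z r \<longrightarrow> u w \<le> c)"
    using usc_envelope_le[OF assms(1,3), of u c] assms(2) by force
  then show ?thesis using that by auto
qed

lemma usc_envelope_le_continuous: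
  fixes V :: "'a::metric_space \<Rightarrow> real"
  assumes "z \<in> D" "r > 0" "\<And>w. w \<in> D \<Longrightarrow> w \<in> ball z r \<Longrightarrow> u w \<le> V w"
    and V: "continuous_on (ball z r) V"
  shows "usc_envelope D u z \<le> V z"
proof (rule field_le_epsilon)
  fix e :: real assume "e > 0"
  have "isCont V z" using V \<open>r > 0\<close> by (simp add: continuous_on_eq_continuous_at)
  then obtain d where d: "d > 0" "\<And>w. dist w z < d \<Longrightarrow> dist (V w) (V z) < e"
    unfolding continuous_at_eps_delta using \<open>e > 0\<close> by metis
  show "usc_envelope D u z \<le> V z + e"
  proof (rule usc_envelope_le[of _ _ "min d r"])
    fix w assume w: "w \<in> D" "w \<in> ball z (min d r)"
    have "V w < V z + e" using d(2)[of w] w(2) by (auto simp: dist_commute dist_real_def)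
    then show "u w \<le> V z + e" using assms(3)[of w] w by auto
  qed (use assms d in auto)
qed

lemma continuous_on_if_semicont:
  assumes "upper_semicont_on S u" "lower_semicont_on S u"
  shows "continuous_on S u"
proof -
  have "(u \<longlongrightarrow> u z) (at z within S)" if "z \<in> S" for z
    using assms that unfolding upper_semicont_on_def lower_semicont_on_def order_tendsto_iff by blast
  then show ?thesis by (simp add: continuous_on_def)
qed

text \<open>Fourth order in space, so that gradient and Hessian vanish at \<open>z0\<close>; second
  order in time, where the equation has only one derivative.\<close>

definition quartic :: "(real ^ 'n) \<times> real \<Rightarrow> (real ^ 'n) \<times> real \<Rightarrow> real"
  where "quartic z0 z = ((norm (fst z - fst z0))\<^sup>2)\<^sup>2 + (snd z - snd z0)\<^sup>2"

text \<open>Adding a multiple of \<open>quartic z0\<close> makes a local maximum at \<open>z0\<close> strict without changing the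
  derivatives of the test function there.\<close>

lemma C21_on_add_quartic:
  assumes "C21_on Q \<psi> g X \<tau>"
  shows "\<exists>g' X' \<tau>'. C21_on Q (\<lambda>z. \<psi> z + \<sigma> * quartic z0 z) g' X' \<tau>' \<and>
    g' z0 = g z0 \<and> X' z0 = X z0 \<and> \<tau>' z0 = \<tau> z0"
proof -
  define d where "d z = (norm (fst z - fst z0))\<^sup>2" for z :: "(real ^ 'a) \<times> real"
  have 1: "C21_on Q (\<lambda>z. \<sigma> * (d z)\<^sup>2) (\<lambda>z. (\<sigma> * (2 * d z)) *\<^sub>R (2 *\<^sub>R (fst z - fst z0)))
      (\<lambda>z. (\<sigma> * (2 * d z)) *\<^sub>R (2 *\<^sub>R mat 1) + (\<sigma> * 2) *\<^sub>R outer (2 *\<^sub>R (fst z - fst z0)) (2 *\<^sub>R (fst z - fst z0)))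
      (\<lambda>z. \<sigma> * (2 * d z) * 0)"
    unfolding d_def
    by (rule C21_on_compose[OF C21_on_dist_sq, of "\<lambda>s. \<sigma> * s\<^sup>2" "\<lambda>s. \<sigma> * (2 * s)" "\<lambda>s. \<sigma> * 2"])
       (auto intro!: derivative_eq_intros)
  have 2: "C21_on Q (\<lambda>z. \<sigma> * (snd z - snd z0)\<^sup>2) (\<lambda>z. 0) (\<lambda>z. 0) (\<lambda>z. \<sigma> * (2 * (snd z - snd z0)))"
    by (rule C21_on_time) (auto intro!: derivative_eq_intros continuous_intros)
  have "C21_on Q (\<lambda>z. \<psi> z + (\<sigma> * (d z)\<^sup>2 + \<sigma> * (snd z - snd z0)\<^sup>2)) 
      (\<lambda>z. g z + ((\<sigma> * (2 * d z)) *\<^sub>R (2 *\<^sub>R (fst z - fst z0)) + 0))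
      (\<lambda>z. X z + (((\<sigma> * (2 * d z)) *\<^sub>R (2 *\<^sub>R mat 1) + (\<sigma> * 2) *\<^sub>R outer (2 *\<^sub>R (fst z - fst z0)) (2 *\<^sub>R (fst z - fst z0))) + 0))
      (\<lambda>z. \<tau> z + (\<sigma> * (2 * d z) * 0 + \<sigma> * (2 * (snd z - snd z0))))"
    by (intro C21_on_add assms 1 2)
  moreover have "(\<lambda>z. \<psi> z + (\<sigma> * (d z)\<^sup>2 + \<sigma> * (snd z - snd z0)\<^sup>2)) = (\<lambda>z. \<psi> z + \<sigma> * quartic z0 z)"
    by (simp add: quartic_def d_def distrib_left)
  ultimately show ?thesis
    by (intro exI conjI) (assumption | simp add: d_def outer_def vec_eq_iff)+
qed

lemma quartic_nonneg: "quartic z0 z \<ge> 0"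
  by (simp add: quartic_def)

lemma quartic_lower_bound:
  assumes "r > 0"
  shows "\<exists>d>0. \<forall>z. quartic z0 z < d \<longrightarrow> z \<in> ball z0 r"
proof -
  define d where "d = min ((r\<^sup>2 / 2)\<^sup>2) (r\<^sup>2 / 2)"
  have "d > 0" using assms by (simp add: d_def)
  moreover have "z \<in> ball z0 r" if "quartic z0 z < d" for z
  proof -
    have a: "((norm (fst z - fst z0))\<^sup>2)\<^sup>2 < (r\<^sup>2 / 2)\<^sup>2" "(snd z - snd z0)\<^sup>2 < r\<^sup>2 / 2"
      using that zero_le_power2[of "snd z - snd z0"] zero_le_power2[of "(norm (fst z - fst z0))\<^sup>2"]
      unfolding quartic_def d_def min_less_iff_conj by linarith+
    have "(norm (fst z - fst z0))\<^sup>2 < r\<^sup>2 / 2" using power_less_imp_less_base[OF a(1)] by simp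
    moreover have "(dist z z0)\<^sup>2 = (norm (fst z - fst z0))\<^sup>2 + (snd z - snd z0)\<^sup>2"
      by (simp add: dist_prod_def dist_norm)
    ultimately have "(dist z z0)\<^sup>2 < r\<^sup>2" using a(2) by simp
    then have "dist z z0 < r" using assms by (simp add: power_less_imp_less_base)
    then show ?thesis by (simp add: dist_commute)
  qed
  ultimately show ?thesis by blast
qed

text \<open>A strict failure of a viscosity inequality at \<open>z0\<close> persists nearby. The
  value \<open>a\<close> varies along with the point because \<open>u\<close> itself is a
  coefficient of the equation; positivity of \<open>a0\<close> makes the power continuous
  there.\<close>

lemma continuous_residual:
  fixes g :: "(real ^ 'n) \<times> real \<Rightarrow> real ^ 'n"
  assumes p: "p \<ge> 2" and Q: "open Q" "z0 \<in> Q" and C: "C21_on Q \<psi> g X \<tau>" and "a0 > 0" and "e > 0"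
  shows "\<exists>r>0. ball z0 r \<subseteq> Q \<and> (\<forall>z\<in>ball z0 r. \<bar>\<psi> z - \<psi> z0\<bar> < e) \<and>
    (\<exists>\<delta>>0. \<forall>z\<in>ball z0 r. \<forall>a. \<bar>a - a0\<bar> < \<delta> \<longrightarrow>
      \<bar>(plap p (g z) (X z) - (p - 1) * a powr (p - 2) * \<tau> z)
       - (plap p (g z0) (X z0) - (p - 1) * a0 powr (p - 2) * \<tau> z0)\<bar> < e)"
proof -
  define G where "G w = plap p (g (fst w)) (X (fst w)) - (p - 1) * snd w powr (p - 2) * \<tau> (fst w)" for w
  have f: "continuous_on (Q \<times> {0<..}) (\<lambda>w. k (fst w))" if "continuous_on Q k" for k :: "_ \<Rightarrow> 'c::topological_space"
    by (rule continuous_on_compose2[OF that continuous_on_fst[OF continuous_on_id]]) auto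
  have "continuous_on (Q \<times> {0<..}) G"
    unfolding G_def
    by (intro continuous_on_diff continuous_on_mult continuous_on_plap[OF p] f C21_onD(5-7)[OF C]
        continuous_on_powr continuous_intros) auto
  moreover have "open (Q \<times> {0::real<..})" using Q by (intro open_Times) auto
  ultimately have "isCont G (z0, a0)" using Q \<open>a0 > 0\<close> by (simp add: continuous_on_eq_continuous_at)
  then obtain d1 where d1: "d1 > 0" "\<And>w. dist w (z0, a0) < d1 \<Longrightarrow> dist (G w) (G (z0, a0)) < e"
    unfolding continuous_at_eps_delta using \<open>e > 0\<close> by metis
  have "isCont \<psi> z0" using C21_onD(4)[OF C] Q by (simp add: continuous_on_eq_continuous_at)
  then obtain d2 where d2: "d2 > 0" "\<And>w. dist w z0 < d2 \<Longrightarrow> dist (\<psi> w) (\<psi> z0) < e"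
    unfolding continuous_at_eps_delta using \<open>e > 0\<close> by metis
  obtain d3 where d3: "d3 > 0" "ball z0 d3 \<subseteq> Q" using openE[OF Q] by blast
  define r where "r = min (d1 / 2) (min d2 d3)"
  have "r > 0" "ball z0 r \<subseteq> Q" using d1 d2 d3 by (auto simp: r_def)
  moreover have "\<bar>\<psi> z - \<psi> z0\<bar> < e" if "z \<in> ball z0 r" for z
    using d2(2)[of z] that by (simp add: r_def dist_commute dist_real_def)
  moreover have "\<bar>G (z, a) - G (z0, a0)\<bar> < e" if "z \<in> ball z0 r" "\<bar>a - a0\<bar> < d1 / 2" for z a
  proof -
    have "dist (z, a) (z0, a0) \<le> dist z z0 + dist a a0"
      unfolding dist_Pair_Pair by (intro sqrt_sum_squares_le_sum) auto
    also have "\<dots> < d1 / 2 + d1 / 2"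
      using that by (intro add_strict_mono) (auto simp: r_def dist_commute dist_real_def abs_minus_commute)
    finally show ?thesis using d1(2)[of "(z, a)"] by (simp add: dist_real_def)
  qed
  ultimately show ?thesis using \<open>d1 > 0\<close> unfolding G_def by (intro exI[of _ r]) (auto intro!: exI[of _ "d1 / 2"])
qed

text \<open>If the inequality failed at \<open>z0\<close>, it would fail strictly for the test
  function with the quartic added, at all points near \<open>z0\<close> and values near
  \<open>v z0\<close>. A member of \<open>S\<close> almost attaining \<open>v z0\<close> near
  \<open>z0\<close> then has its own contact point inside a small ball, which contradicts its
  subsolution property.\<close>

lemma sup_envelope_viscosity_subsolution:
  fixes S :: "((real ^ 'n) \<times> real \<Rightarrow> real) set"
  assumes p: "p \<ge> 2" and Q: "open Q" "Q \<subseteq> D" and m: "m > 0" and "S \<noteq> {}"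
    and S: "\<And>U. U \<in> S \<Longrightarrow> viscosity_subsolution p Q U" "\<And>U z. U \<in> S \<Longrightarrow> z \<in> D \<Longrightarrow> m \<le> U z"
    and bdd: "\<And>z. z \<in> D \<Longrightarrow> bdd_above ((\<lambda>U. U z) ` S)"
    and loc: "locally_bdd_above D (\<lambda>z. SUP U\<in>S. U z)"
  shows "viscosity_subsolution p Q (usc_envelope D (\<lambda>z. SUP U\<in>S. U z))"
proof -
  define u where "u z = (SUP U\<in>S. U z)" for z
  define v where "v = usc_envelope D u"
  have loc: "locally_bdd_above D u" using loc by (simp add: u_def[abs_def])
  have uv: "u z \<le> v z" if "z \<in> D" for z unfolding v_def by (rule usc_envelope_ge[OF loc that])
  have Uu: "U z \<le> u z" if "U \<in> S" "z \<in> D" for U z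
    unfolding u_def by (rule cSUP_upper[OF that(1) bdd[OF that(2)]])
  have vm: "m \<le> v z" if "z \<in> D" for z
    using \<open>S \<noteq> {}\<close> S(2) Uu uv that by (meson all_not_in_conv order_trans)
  have "viscosity_subsolution p Q v"
    unfolding viscosity_subsolution_def
  proof (intro conjI ballI allI impI)
    show "0 < v z" if "z \<in> Q" for z using vm[of z] that Q m by auto
    show "upper_semicont_on Q v"
      unfolding v_def by (rule upper_semicont_on_subset[OF upper_semicont_on_usc_envelope[OF loc] Q(2)])
    fix \<psi> z0 assume "test_function Q \<psi> \<and> local_max_at Q (\<lambda>w. v w - \<psi> w) z0"
    then have \<psi>: "test_function Q \<psi>" and mx: "local_max_at Q (\<lambda>w. v w - \<psi> w) z0" by auto
    have z0: "z0 \<in> Q" "z0 \<in> D" using mx Q by (auto simp: local_max_at_def)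
    have v0: "v z0 > 0" using vm[OF z0(2)] m by simp
    show "0 \<le> p_laplacian p \<psi> z0 - (p - 1) * v z0 powr (p - 2) * time_deriv \<psi> z0"
    proof (rule ccontr)
      assume neg: "\<not> ?thesis"
      obtain g X \<tau> where C: "C21_on Q (\<lambda>z. \<psi> z + 1 * quartic z0 z) g X \<tau>"
        "g z0 = space_grad \<psi> z0" "X z0 = space_hess \<psi> z0" "\<tau> z0 = time_deriv \<psi> z0"
        using C21_on_add_quartic[OF test_function_imp_C21_on[OF \<psi>], of 1 z0] by blast
      define \<eta> where "\<eta> z = \<psi> z + quartic z0 z" for z
      have C': "C21_on Q \<eta> g X \<tau>" using C(1) by (simp add: \<eta>_def[abs_def])
      define R where "R z a = plap p (g z) (X z) - (p - 1) * a powr (p - 2) * \<tau> z" for z a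
      have R0: "R z0 (v z0) < 0" using neg by (simp add: R_def C p_laplacian_eq_plap)
      obtain r1 \<delta> where r1: "r1 > 0" "ball z0 r1 \<subseteq> Q" and "\<delta> > 0" and
        R: "\<And>z a. z \<in> ball z0 r1 \<Longrightarrow> \<bar>a - v z0\<bar> < \<delta> \<Longrightarrow> \<bar>R z a - R z0 (v z0)\<bar> < - R z0 (v z0)"
        using continuous_residual[OF p Q(1) z0(1) C' v0, of "- R z0 (v z0)"] R0 unfolding R_def by auto
      have Rneg: "R z a < 0" if "z \<in> ball z0 r1" "\<bar>a - v z0\<bar> < \<delta>" for z a
        using R[OF that] by linarith
      have "\<delta> / 3 > 0" using \<open>\<delta> > 0\<close> by simp
      from continuous_residual[OF p Q(1) z0(1) C' v0 this]
      obtain r2 where r2: "r2 > 0" "\<And>z. z \<in> ball z0 r2 \<Longrightarrow> \<bar>\<eta> z - \<eta> z0\<bar> < \<delta> / 3" by blast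
      obtain r3 where r3: "r3 > 0" "\<And>z. z \<in> ball z0 r3 \<Longrightarrow> v z - \<psi> z \<le> v z0 - \<psi> z0"
        using eventually_within_open_ball[OF Q(1) z0(1)] mx unfolding local_max_at_def by blast
      define r where "r = min r1 (min r2 r3) / 2"
      have r: "r > 0" and sub: "cball z0 r \<subseteq> ball z0 r1" "cball z0 r \<subseteq> ball z0 r2" "cball z0 r \<subseteq> ball z0 r3"
        using r1 r2 r3 by (auto simp: r_def)
      obtain d where d: "d > 0" "\<And>z. quartic z0 z < d \<Longrightarrow> z \<in> ball z0 r"
        using quartic_lower_bound[OF r, of z0] by blast
      \<comment> \<open>Below, \<open>quartic z0 y < e \<le> d\<close> forces the maximum point
        \<open>y\<close> into the open ball, while \<open>\<delta> / 3\<close>, together with the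
        oscillation of \<open>\<eta>\<close>, keeps \<open>U y\<close> within
        \<open>\<delta>\<close> of \<open>v z0\<close>.\<close>
      define e where "e = min d (\<delta> / 3)"
      have e: "e > 0" using d \<open>\<delta> > 0\<close> by (simp add: e_def)
      have "e / 2 > 0" using e by simp
      from continuous_residual[OF p Q(1) z0(1) C' v0 this]
      obtain r4 where r4: "r4 > 0" "\<And>z. z \<in> ball z0 r4 \<Longrightarrow> \<bar>\<eta> z - \<eta> z0\<bar> < e / 2" by blast
      obtain w where w: "w \<in> D" "w \<in> ball z0 (min r r4)" "v z0 - e / 2 < u w"
        using usc_envelope_approx[OF z0(2), of "v z0 - e / 2" u "min r r4"] e r r4 unfolding v_def by auto
      obtain U where U: "U \<in> S" "v z0 - e / 2 < U w"
        using w(3) less_cSUP_iff[OF \<open>S \<noteq> {}\<close> bdd[OF w(1)]] unfolding u_def by auto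
      have cQ: "cball z0 r \<subseteq> Q" using sub r1 by blast
      have "upper_semicont_on Q U" using S(1)[OF U(1)] by (simp add: viscosity_subsolution_def)
      then have "upper_semicont_on (cball z0 r) U" using cQ by (rule upper_semicont_on_subset)
      moreover have "upper_semicont_on (cball z0 r) (\<lambda>z. - \<eta> z)"
        by (intro continuous_on_imp_upper_semicont_on continuous_on_minus
            continuous_on_subset[OF C21_onD(4)[OF C'] cQ])
      ultimately have usc: "upper_semicont_on (cball z0 r) (\<lambda>z. U z + - \<eta> z)"
        by (rule upper_semicont_on_add)
      have "cball z0 r \<noteq> {}" using r by simp
      then obtain y where y: "y \<in> cball z0 r" "\<And>z. z \<in> cball z0 r \<Longrightarrow> U z + - \<eta> z \<le> U y + - \<eta> y"
        using upper_semicont_on_attains_sup[OF compact_cball _ usc] by blast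
      have \<eta>0: "\<eta> z0 = \<psi> z0" by (simp add: \<eta>_def quartic_def)
      have low: "v z0 - \<psi> z0 - e < U y - \<eta> y"
      proof -
        have "U w + - \<eta> w \<le> U y + - \<eta> y" using w(2) by (intro y(2)) auto
        moreover have "\<bar>\<eta> w - \<eta> z0\<bar> < e / 2" using r4(2)[of w] w(2) by auto
        ultimately show ?thesis using U(2) \<eta>0 by linarith
      qed
      have yQ: "y \<in> Q" using y(1) cQ by blast
      have Uv: "U y \<le> v y" using Uu[OF U(1), of y] uv[of y] yQ Q by auto
      have vy: "v y - \<psi> y \<le> v z0 - \<psi> z0" using r3(2) y(1) sub by blast
      have "quartic z0 y < e" using low Uv vy by (simp add: \<eta>_def)
      then have yb: "y \<in> ball z0 r" using d(2) by (simp add: e_def)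
      have \<eta>y: "\<bar>\<eta> y - \<eta> z0\<bar> < \<delta> / 3" using r2(2) y(1) sub by blast
      have "\<bar>U y - v z0\<bar> < \<delta>"
      proof -
        have "e \<le> \<delta> / 3" "\<eta> y = \<psi> y + quartic z0 y" by (simp_all add: e_def \<eta>_def)
        then show ?thesis using low Uv vy \<eta>y \<eta>0 quartic_nonneg[of z0 y] \<open>\<delta> > 0\<close> by linarith
      qed
      then have neg: "R y (U y) < 0" using Rneg y(1) sub by blast
      have "local_max_at Q (\<lambda>z. U z - \<eta> z) y"
        unfolding local_max_at_def eventually_at_topological
        using yQ yb y(2) by (intro conjI exI[of _ "ball z0 r"]) auto
      then have "0 \<le> p_laplacian p \<eta> y - (p - 1) * U y powr (p - 2) * time_deriv \<eta> y"
        using S(1)[OF U(1)] C21_on_imp_test_function(1)[OF Q(1) C'] unfolding viscosity_subsolution_def by blast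
      then have "0 \<le> R y (U y)"
        by (simp add: R_def p_laplacian_eq_plap C21_on_imp_test_function(2,3,4)[OF Q(1) C' yQ])
      then show False using neg by simp
    qed
  qed
  then show ?thesis by (simp add: v_def u_def[abs_def])
qed

text \<open>Near the edge of the ball \<open>W \<le> u\<close>, so the patched function equals
  \<open>u\<close> there and no jump arises across the edge.\<close>

lemma upper_semicont_on_max_patch:
  fixes u W :: "'a::metric_space \<Rightarrow> real"
  assumes u: "upper_semicont_on D u" and W: "continuous_on (ball z0 r) W" and "s < r"
    and le: "\<And>z. z \<in> D \<Longrightarrow> z \<in> ball z0 r \<Longrightarrow> z \<notin> cball z0 s \<Longrightarrow> W z \<le> u z"
  shows "upper_semicont_on D (\<lambda>z. if z \<in> ball z0 r then max (u z) (W z) else u z)"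
proof (rule upper_semicont_onI)
  fix z c assume z: "z \<in> D" and c: "(if z \<in> ball z0 r then max (u z) (W z) else u z) < c"
  then have "u z < c" by (auto split: if_splits)
  then obtain A where A: "open A" "z \<in> A" "\<And>w. w \<in> A \<Longrightarrow> w \<in> D \<Longrightarrow> u w < c"
    using upper_semicont_onD[OF u z] by metis
  show "\<exists>U. open U \<and> z \<in> U \<and> (\<forall>w\<in>U \<inter> D. (if w \<in> ball z0 r then max (u w) (W w) else u w) < c)"
  proof (cases "z \<in> ball z0 r")
    case True
    then have "W z < c" using c by simp
    then obtain B where B: "open B" "z \<in> B" "\<And>w. w \<in> B \<Longrightarrow> w \<in> ball z0 r \<Longrightarrow> W w < c"
      using upper_semicont_onD[OF continuous_on_imp_upper_semicont_on[OF W] True] by metis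
    then show ?thesis using A True by (intro exI[of _ "A \<inter> B \<inter> ball z0 r"]) auto
  next
    case False
    then have "z \<notin> cball z0 s" using \<open>s < r\<close> by auto
    moreover have "(if w \<in> ball z0 r then max (u w) (W w) else u w) < c"
      if "w \<in> (A \<inter> - cball z0 s) \<inter> D" for w
      using that A(3)[of w] le[of w] by (auto split: if_splits)
    ultimately show ?thesis using A
      by (intro exI[of _ "A \<inter> - cball z0 s"]) (auto simp: open_Int)
  qed
qed

text \<open>\<open>l\<close> is the lower envelope of \<open>u\<close>. If it failed to be a
  supersolution at \<open>z0\<close>, a strict classical subsolution slightly above \<open>l\<close>
  at \<open>z0\<close> and below \<open>u\<close> on an annulus could be glued to \<open>u\<close>.
  Maximality then puts it below \<open>u\<close>, hence below \<open>l\<close> at \<open>z0\<close>,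
  a contradiction.\<close>

lemma maximal_subsolution_is_supersolution:
  fixes u :: "(real ^ 'n) \<times> real \<Rightarrow> real"
  assumes p: "p \<ge> 2" and Q: "open Q" "Q \<subseteq> D" and m: "m > 0"
    and u: "upper_semicont_on D u" "viscosity_subsolution p Q u" "\<And>z. z \<in> D \<Longrightarrow> m \<le> u z"
    and maximal: "\<And>U. upper_semicont_on D U \<Longrightarrow> viscosity_subsolution p Q U \<Longrightarrow>
      (\<And>z. z \<in> D \<Longrightarrow> m \<le> U z) \<Longrightarrow> (\<And>z. z \<in> D - Q \<Longrightarrow> U z \<le> u z) \<Longrightarrow>
      (\<And>z. z \<in> D \<Longrightarrow> U z \<le> u z)"
  defines "l \<equiv> \<lambda>z. - usc_envelope D (\<lambda>w. - u w) z"
  shows "viscosity_supersolution p Q l"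
proof -
  have loc: "locally_bdd_above D (\<lambda>w. - u w)"
    unfolding locally_bdd_above_def using u(3)
    by (intro ballI exI[of _ "- m"] exI[of _ 1]) auto
  have lu: "l z \<le> u z" if "z \<in> D" for z
    using usc_envelope_ge[OF loc that] by (simp add: l_def)
  have lm: "m \<le> l z" if "z \<in> D" for z
    using usc_envelope_le[OF that zero_less_one, of "\<lambda>w. - u w" "- m"] u(3) by (simp add: l_def)
  show ?thesis
    unfolding viscosity_supersolution_def
  proof (intro conjI ballI allI impI)
    show "0 < l z" if "z \<in> Q" for z using lm[of z] that Q m by auto
    have "lower_semicont_on D l"
      unfolding lower_semicont_on_iff l_def using upper_semicont_on_usc_envelope[OF loc] by simp
    then show "lower_semicont_on Q l" using Q(2) by (rule lower_semicont_on_subset)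
    fix \<psi> z0 assume "test_function Q \<psi> \<and> local_min_at Q (\<lambda>w. l w - \<psi> w) z0"
    then have \<psi>: "test_function Q \<psi>" and mn: "local_min_at Q (\<lambda>w. l w - \<psi> w) z0" by auto
    have z0: "z0 \<in> Q" "z0 \<in> D" using mn Q by (auto simp: local_min_at_def)
    have l0: "l z0 > 0" using lm[OF z0(2)] m by simp
    show "p_laplacian p \<psi> z0 - (p - 1) * l z0 powr (p - 2) * time_deriv \<psi> z0 \<le> 0"
    proof (rule ccontr)
      assume pos: "\<not> ?thesis"
      obtain g X \<tau> where C: "C21_on Q (\<lambda>z. \<psi> z + (- 1) * quartic z0 z) g X \<tau>"
        "g z0 = space_grad \<psi> z0" "X z0 = space_hess \<psi> z0" "\<tau> z0 = time_deriv \<psi> z0"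
        using C21_on_add_quartic[OF test_function_imp_C21_on[OF \<psi>], of "- 1" z0] by blast
      define \<eta> where "\<eta> z = \<psi> z - quartic z0 z" for z
      have C': "C21_on Q \<eta> g X \<tau>" using C(1) by (simp add: \<eta>_def[abs_def])
      define R where "R z a = plap p (g z) (X z) - (p - 1) * a powr (p - 2) * \<tau> z" for z a
      have R0: "R z0 (l z0) > 0" using pos by (simp add: R_def C p_laplacian_eq_plap)
      obtain r1 \<delta> where r1: "r1 > 0" "ball z0 r1 \<subseteq> Q" and "\<delta> > 0" and
        R: "\<And>z a. z \<in> ball z0 r1 \<Longrightarrow> \<bar>a - l z0\<bar> < \<delta> \<Longrightarrow> \<bar>R z a - R z0 (l z0)\<bar> < R z0 (l z0)"
        using continuous_residual[OF p Q(1) z0(1) C' l0, of "R z0 (l z0)"] R0 unfolding R_def by auto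
      have Rpos: "R z a > 0" if "z \<in> ball z0 r1" "\<bar>a - l z0\<bar> < \<delta>" for z a
        using R[OF that] by linarith
      have "\<delta> / 2 > 0" using \<open>\<delta> > 0\<close> by simp
      from continuous_residual[OF p Q(1) z0(1) C' l0 this]
      obtain r2 where r2: "r2 > 0" "\<And>z. z \<in> ball z0 r2 \<Longrightarrow> \<bar>\<eta> z - \<eta> z0\<bar> < \<delta> / 2" by blast
      obtain r3 where r3: "r3 > 0" "\<And>z. z \<in> ball z0 r3 \<Longrightarrow> l z0 - \<psi> z0 \<le> l z - \<psi> z"
        using eventually_within_open_ball[OF Q(1) z0(1)] mn unfolding local_min_at_def by blast
      define r where "r = min r1 (min r2 r3)"
      have r: "r > 0" and sub: "ball z0 r \<subseteq> ball z0 r1" "ball z0 r \<subseteq> ball z0 r2" "ball z0 r \<subseteq> ball z0 r3"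
        using r1 r2 r3 by (auto simp: r_def)
      have rQ: "ball z0 r \<subseteq> Q" using sub r1 by blast
      have r2': "r / 2 > 0" using r by simp
      obtain d where d: "d > 0" "\<And>z. quartic z0 z < d \<Longrightarrow> z \<in> ball z0 (r / 2)"
        using quartic_lower_bound[OF r2', of z0] by blast
      \<comment> \<open>\<open>e \<le> d\<close> gives \<open>W \<le> l\<close> outside the half
        ball, where the quartic is at least \<open>d\<close>; \<open>e \<le> \<delta> / 2\<close>
        keeps the values of \<open>W\<close> in the range where the residual is positive.\<close>
      define e where "e = min d (\<delta> / 2)"
      have e: "e > 0" using d \<open>\<delta> > 0\<close> by (simp add: e_def)
      define k where "k = l z0 - \<psi> z0 + e"
      define W where "W z = \<eta> z + k" for z
      have CW: "C21_on Q W g X \<tau>"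
        using C21_on_add[OF C' C21_on_const[of Q k]] by (simp add: W_def[abs_def])
      have \<eta>0: "\<eta> z0 = \<psi> z0" by (simp add: \<eta>_def quartic_def)
      have Wl: "\<bar>W z - l z0\<bar> < \<delta>" if "z \<in> ball z0 r" for z
      proof -
        have "\<bar>\<eta> z - \<eta> z0\<bar> < \<delta> / 2" using r2(2) that sub by blast
        moreover have "e \<le> \<delta> / 2" by (simp add: e_def)
        ultimately show ?thesis using \<eta>0 e unfolding W_def k_def by linarith
      qed
      have out: "W z \<le> u z" if "z \<in> D" "z \<in> ball z0 r" "z \<notin> cball z0 (r / 2)" for z
      proof -
        have "\<not> quartic z0 z < d" using d(2)[of z] that(3) by auto
        moreover have "l z0 - \<psi> z0 \<le> l z - \<psi> z" using r3(2) that(2) sub by blast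
        moreover have "e \<le> d" by (simp add: e_def)
        ultimately show ?thesis using lu[OF that(1)] unfolding W_def \<eta>_def k_def by linarith
      qed
      have cW: "continuous_on (ball z0 r) W" using C21_onD(4)[OF CW] rQ by (rule continuous_on_subset)
      define U where "U z = (if z \<in> ball z0 r then max (u z) (W z) else u z)" for z
      have uU: "u z \<le> U z" for z by (simp add: U_def)
      have "upper_semicont_on D U"
        unfolding U_def by (rule upper_semicont_on_max_patch[where s="r / 2", OF u(1) cW]) (use r out in auto)
      moreover have "viscosity_subsolution p Q U"
        unfolding viscosity_subsolution_def
      proof (intro conjI ballI allI impI)
        show "0 < U z" if "z \<in> Q" for z using u(3)[of z] uU[of z] m that Q by auto
        show "upper_semicont_on Q U" using \<open>upper_semicont_on D U\<close> Q(2) by (rule upper_semicont_on_subset)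
        fix \<phi> z assume "test_function Q \<phi> \<and> local_max_at Q (\<lambda>w. U w - \<phi> w) z"
        then have \<phi>: "test_function Q \<phi>" and mx: "local_max_at Q (\<lambda>w. U w - \<phi> w) z" by auto
        have z: "z \<in> Q" using mx by (simp add: local_max_at_def)
        show "0 \<le> p_laplacian p \<phi> z - (p - 1) * U z powr (p - 2) * time_deriv \<phi> z"
        proof (cases "U z = u z")
          case True
          have "eventually (\<lambda>w. U w - \<phi> w \<le> U z - \<phi> z) (at z within Q)"
            using mx by (simp add: local_max_at_def)
          then have "eventually (\<lambda>w. u w - \<phi> w \<le> u z - \<phi> z) (at z within Q)"
          proof eventually_elim
            case (elim w)
            then show ?case using uU[of w] True by linarith
          qed
          then have "local_max_at Q (\<lambda>w. u w - \<phi> w) z" using z by (simp add: local_max_at_def)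
          then have "0 \<le> p_laplacian p \<phi> z - (p - 1) * u z powr (p - 2) * time_deriv \<phi> z"
            using u(2) \<phi> unfolding viscosity_subsolution_def by blast
          then show ?thesis using True by simp
        next
          case False
          then have zb: "z \<in> ball z0 r" and UW: "U z = W z" by (auto simp: U_def max_def split: if_splits)
          have "eventually (\<lambda>w. w \<in> ball z0 r) (at z)"
            using zb by (intro eventually_at_in_open') auto
          then have le: "eventually (\<lambda>w. W w \<le> U w) (at z)"
            by eventually_elim (simp add: U_def)
          note touch = touching_subsolution_test[OF p Q(1) z CW \<phi> mx le UW]
          have "z \<in> ball z0 r1" using zb sub by blast
          then have "R z (W z) > 0" by (rule Rpos) (rule Wl[OF zb])
          then show ?thesis using touch UW by (simp add: R_def)
        qed
      qed
      moreover have "m \<le> U z" if "z \<in> D" for z using u(3)[OF that] uU[of z] by simp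
      moreover have "U z \<le> u z" if "z \<in> D - Q" for z using that rQ by (auto simp: U_def)
      ultimately have "U z \<le> u z" if "z \<in> D" for z using maximal that by blast
      then have "W z \<le> u z" if "z \<in> D" "z \<in> ball z0 r" for z using that unfolding U_def by fastforce
      \<comment> \<open>Continuity of \<open>W\<close> carries \<open>W \<le> u\<close> over to the
        lower envelope; at \<open>z0\<close> this reads \<open>l z0 + e \<le> l z0\<close>.\<close>
      then have "usc_envelope D (\<lambda>w. - u w) z0 \<le> - W z0"
        using z0(2) r cW by (intro usc_envelope_le_continuous[of _ _ r]) (auto intro!: continuous_intros)
      then have "W z0 \<le> l z0" by (simp add: l_def)
      then show False using e by (simp add: W_def k_def \<eta>0)
    qed
  qed
qed

section \<open>The half-open cylinder and its boundary data\<close>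

lemma closed_cylinder_eq:
  assumes "open \<Omega>" "T > 0"
  shows "cylinder \<Omega> T \<union> parabolic_boundary \<Omega> T = closure \<Omega> \<times> {0..<T}"
proof -
  have "closure \<Omega> = \<Omega> \<union> frontier \<Omega>"
    using assms closure_subset[of \<Omega>] by (auto simp: frontier_def interior_open)
  then show ?thesis using assms by (auto simp: cylinder_def parabolic_boundary_def)
qed

text \<open>Compactness is available only below time \<open>T\<close>, so comparison is applied up
  to a time \<open>s\<close> strictly between that of \<open>z\<close> and \<open>T'\<close>. The
  parameter \<open>T' \<le> T\<close> admits boundary values that are ordered only on a shorter time
  interval.\<close>

lemma viscosity_comparison_cylinder:
  fixes \<Omega> :: "(real ^ 'n) set"
  assumes \<Omega>: "open \<Omega>" "bounded \<Omega>" and p: "p \<ge> 2" and T: "T > 0"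
    and usc: "upper_semicont_on (closure \<Omega> \<times> {0..<T}) U"
    and lsc: "lower_semicont_on (closure \<Omega> \<times> {0..<T}) V"
    and pos: "\<And>z. z \<in> closure \<Omega> \<times> {0..<T} \<Longrightarrow> 0 < U z" "\<And>z. z \<in> closure \<Omega> \<times> {0..<T} \<Longrightarrow> 0 < V z"
    and sub: "viscosity_subsolution p (cylinder \<Omega> T) U"
    and super: "viscosity_supersolution p (cylinder \<Omega> T) V"
    and T': "T' \<le> T"
    and bd: "\<And>z. z \<in> parabolic_boundary \<Omega> T \<Longrightarrow> snd z < T' \<Longrightarrow> U z \<le> V z"
    and z: "z \<in> closure \<Omega> \<times> {0..<T'}"
  shows "U z \<le> V z"
proof -
  define s where "s = (snd z + T') / 2"
  have s: "0 < s" "s < T'" "snd z < s" using z by (auto simp: s_def)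
  have K: "closure \<Omega> \<times> {0..s} \<subseteq> closure \<Omega> \<times> {0..<T}" using s T' by auto
  show ?thesis
  proof (rule viscosity_comparison[OF \<Omega> p s(1) _ upper_semicont_on_subset[OF usc K]
        lower_semicont_on_subset[OF lsc K] pos(1)[OF subsetD[OF K]] pos(2)[OF subsetD[OF K]] sub super])
    show "s < T" using s T' by simp
    show "z \<in> closure \<Omega> \<times> {0..<s}" using z s by auto
    show "U w \<le> V w" if "w \<in> parabolic_boundary \<Omega> T" "snd w \<le> s" for w using bd[OF that(1)] that s by auto
  qed
qed

text \<open>The boundary points up to time \<open>T'\<close> lie in a compact subset of the
  parabolic boundary, since the closure of the initial slice adds only lateral points at time
  0.\<close>

lemma boundary_data_bounded:
  fixes \<Omega> :: "(real ^ 'n) set"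
  assumes "open \<Omega>" "bounded \<Omega>" "0 < T" "T' < T" and h: "continuous_on (parabolic_boundary \<Omega> T) h"
  shows "\<exists>M. \<forall>z\<in>parabolic_boundary \<Omega> T. snd z \<le> T' \<longrightarrow> h z \<le> (M::real)"
proof -
  define B where "B = closure \<Omega> \<times> {0} \<union> frontier \<Omega> \<times> {0..T'}"
  have c: "compact B" unfolding B_def using assms(2)
    by (intro compact_Un compact_Times) (auto simp: compact_frontier_bounded)
  have "closure \<Omega> \<subseteq> \<Omega> \<union> frontier \<Omega>" using assms(1) by (auto simp: frontier_def interior_open)
  then have "B \<subseteq> parabolic_boundary \<Omega> T" using assms(3,4) by (auto simp: B_def parabolic_boundary_def)
  then have "bounded (h ` B)"
    using h c by (intro compact_imp_bounded compact_continuous_image continuous_on_subset[OF h]) auto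
  then obtain M where M: "\<And>z. z \<in> B \<Longrightarrow> \<bar>h z\<bar> \<le> M" unfolding bounded_iff by auto
  have "z \<in> B" if "z \<in> parabolic_boundary \<Omega> T" "snd z \<le> T'" for z
    using that closure_subset[of \<Omega>] by (auto simp: B_def parabolic_boundary_def)
  then show ?thesis using M abs_le_D1 by blast
qed

lemma viscosity_supersolution_cong:
  assumes eq: "\<And>z. z \<in> Q \<Longrightarrow> v z = u z" and u: "viscosity_supersolution p Q u"
  shows "viscosity_supersolution p Q v"
  unfolding viscosity_supersolution_def
proof (intro conjI ballI allI impI)
  show "0 < v z" if "z \<in> Q" for z using u eq[OF that] that by (simp add: viscosity_supersolution_def)
  show "lower_semicont_on Q v"
    by (rule lower_semicont_on_cong[OF eq]) (use u in \<open>auto simp: viscosity_supersolution_def\<close>)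
  fix \<psi> z assume \<psi>: "test_function Q \<psi> \<and> local_min_at Q (\<lambda>w. v w - \<psi> w) z"
  then have z: "z \<in> Q" and ev: "eventually (\<lambda>w. v z - \<psi> z \<le> v w - \<psi> w) (at z within Q)"
    by (auto simp: local_min_at_def)
  have "eventually (\<lambda>w. w \<in> Q) (at z within Q)" by (simp add: eventually_at_filter)
  with ev have "eventually (\<lambda>w. u z - \<psi> z \<le> u w - \<psi> w) (at z within Q)"
    by eventually_elim (simp add: eq z)
  then have "local_min_at Q (\<lambda>w. u w - \<psi> w) z" using z by (simp add: local_min_at_def)
  then have "p_laplacian p \<psi> z - (p - 1) * u z powr (p - 2) * time_deriv \<psi> z \<le> 0"
    using u \<psi> unfolding viscosity_supersolution_def by blast
  then show "p_laplacian p \<psi> z - (p - 1) * v z powr (p - 2) * time_deriv \<psi> z \<le> 0" by (simp add: eq z)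
qed

theorem theorem1p2:
  fixes \<Omega> :: "(real ^ 'n) set" and T p :: real
    and h :: "(real ^ 'n) \<times> real \<Rightarrow> real"
  assumes "CARD('n) \<ge> 2"
    and "open \<Omega>" and "connected \<Omega>" and "\<Omega> \<noteq> {}" and "bounded \<Omega>"
    and "T > 0"
    and "2 \<le> p" and "p \<le> real CARD('n)"
    and "continuous_on (parabolic_boundary \<Omega> T) h"
    and "\<forall>z\<in>parabolic_boundary \<Omega> T. 0 < h z"
    and "(INF z\<in>parabolic_boundary \<Omega> T. h z) > 0"
    and "uniform_outer_ball \<Omega>"
  shows "\<exists>u. positive_viscosity_solution p \<Omega> T h u \<and>
    (\<forall>v. positive_viscosity_solution p \<Omega> T h v \<longrightarrow>
      (\<forall>z\<in>cylinder \<Omega> T \<union> parabolic_boundary \<Omega> T. v z = u z))"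
proof -
  note \<Omega> = \<open>open \<Omega>\<close> \<open>bounded \<Omega>\<close> and p = \<open>2 \<le> p\<close> and T = \<open>T > 0\<close>
  define Q where "Q = cylinder \<Omega> T"
  define P where "P = parabolic_boundary \<Omega> T"
  define D where "D = closure \<Omega> \<times> {0..<T}"
  have D_eq: "Q \<union> P = D" unfolding Q_def P_def D_def by (rule closed_cylinder_eq[OF \<Omega>(1) T])
  have oQ: "open Q" unfolding Q_def by (rule open_cylinder[OF \<Omega>(1)])
  have QD: "Q \<subseteq> D" and PD: "P \<subseteq> D" using D_eq by auto
  have PT: "0 \<le> snd z" "snd z < T" if "z \<in> P" for z using that T by (auto simp: P_def parabolic_boundary_def)
  have comparison: "U z \<le> V z"
    if "upper_semicont_on D U" "lower_semicont_on D V" "\<And>z. z \<in> D \<Longrightarrow> 0 < U z" "\<And>z. z \<in> D \<Longrightarrow> 0 < V z"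
      "viscosity_subsolution p Q U" "viscosity_supersolution p Q V" "T' \<le> T"
      "\<And>z. z \<in> P \<Longrightarrow> snd z < T' \<Longrightarrow> U z \<le> V z" "z \<in> D" "snd z < T'" for U V z T'
  proof (rule viscosity_comparison_cylinder[OF \<Omega> p T that(1-6)[unfolded D_def Q_def] that(7) that(8)[unfolded P_def]])
    show "z \<in> closure \<Omega> \<times> {0..<T'}" using that(9,10) by (auto simp: D_def)
  qed (use that in \<open>auto simp: D_def\<close>)
  define m0 where "m0 = (INF z\<in>P. h z)"
  have m0: "m0 > 0" using assms(11) by (simp add: m0_def P_def)
  have "bdd_below (h ` P)" using assms(10) by (intro bdd_belowI[of _ 0]) (auto simp: P_def less_imp_le)
  then have m0h: "m0 \<le> h z" if "z \<in> P" for z unfolding m0_def using that by (rule cINF_lower)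
  \<comment> \<open>Half the infimum leaves room below \<open>h\<close> for lower barriers of height
    \<open>h (y, t0) - e\<close> with \<open>e \<le> m\<close>.\<close>
  define m where "m = m0 / 2"
  have m: "m > 0" using m0 by (simp add: m_def)
  have mh: "m \<le> h z" if "z \<in> P" for z using m0h[OF that] m0 by (simp add: m_def)
  have bounded_h: "\<exists>M>0. \<forall>z\<in>P. snd z < T' \<longrightarrow> h z \<le> M" if T': "T' < T" for T'
  proof -
    obtain M where M: "\<And>z. z \<in> P \<Longrightarrow> snd z \<le> T' \<Longrightarrow> h z \<le> M"
      using boundary_data_bounded[OF \<Omega> T T' assms(9)] unfolding P_def by blast
    then have "\<forall>z\<in>P. snd z < T' \<longrightarrow> h z \<le> max 1 M" by (auto intro: max.coboundedI2)
    then show ?thesis by (intro exI[of _ "max 1 M"]) simp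
  qed
  \<comment> \<open>Perron's class. The common lower bound \<open>m\<close> keeps all envelopes
    positive and makes \<open>- u\<close> bounded above, as the lower envelope requires.\<close>
  define S where "S = {U. upper_semicont_on D U \<and> viscosity_subsolution p Q U \<and>
    (\<forall>z\<in>D. m \<le> U z) \<and> (\<forall>z\<in>P. U z \<le> h z)}"
  have S: "upper_semicont_on D U" "viscosity_subsolution p Q U" "\<And>z. z \<in> D \<Longrightarrow> m \<le> U z"
    "\<And>z. z \<in> P \<Longrightarrow> U z \<le> h z" "\<And>z. z \<in> D \<Longrightarrow> 0 < U z" if "U \<in> S" for U
    using that m unfolding S_def by fastforce+
  have "viscosity_subsolution p Q (\<lambda>z. max m m)"
    by (rule viscosity_subsolution_max_const[OF p oQ C21_on_const m]) simp
  moreover have "upper_semicont_on D (\<lambda>z. m)"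
    by (intro continuous_on_imp_upper_semicont_on continuous_intros)
  ultimately have "(\<lambda>z. m) \<in> S" using mh by (simp add: S_def)
  then have "S \<noteq> {}" by blast
  \<comment> \<open>A constant \<open>M\<close> bounding \<open>h\<close> before \<open>T'\<close>
    is a supersolution, so comparison bounds the whole class up to \<open>T'\<close>. The bound may
    grow as \<open>T'\<close> tends to \<open>T\<close>.\<close>
  have bound: "\<exists>M. \<forall>U\<in>S. \<forall>z\<in>D. snd z < T' \<longrightarrow> U z \<le> M" if T': "T' < T" for T'
  proof -
    obtain M where M: "M > 0" "\<And>z. z \<in> P \<Longrightarrow> snd z < T' \<Longrightarrow> h z \<le> M" using bounded_h[OF T'] by blast
    have super: "viscosity_supersolution p Q (\<lambda>z. min M M)"
      by (rule viscosity_supersolution_min_const[OF p oQ C21_on_const M(1)]) (use M in auto)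
    have "U z \<le> M" if U: "U \<in> S" and z: "z \<in> D" "snd z < T'" for U z
    proof (rule comparison[OF S(1)[OF U] _ S(5)[OF U] _ S(2)[OF U] _ _ _ z])
      show "lower_semicont_on D (\<lambda>z. M)"
        by (intro continuous_on_imp_lower_semicont_on continuous_intros)
      show "viscosity_supersolution p Q (\<lambda>z. M)" using super by simp
      show "U w \<le> M" if "w \<in> P" "snd w < T'" for w using S(4)[OF U that(1)] M(2)[OF that] by simp
    qed (use M T' in auto)
    then show ?thesis by blast
  qed
  have Dmid: "snd z < (snd z + T) / 2" "(snd z + T) / 2 < T" if "z \<in> D" for z using that by (auto simp: D_def)
  define w where "w z = (SUP U\<in>S. U z)" for z
  have bdd: "bdd_above ((\<lambda>U. U z) ` S)" if "z \<in> D" for z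
    using bound[OF Dmid(2)[OF that]] Dmid(1)[OF that] that unfolding bdd_above_def by blast
  have wle: "w z \<le> c" if "\<And>U. U \<in> S \<Longrightarrow> U z \<le> c" for z c
    unfolding w_def by (rule cSUP_least[OF \<open>S \<noteq> {}\<close> that])
  have Uw: "U z \<le> w z" if "U \<in> S" "z \<in> D" for U z
    unfolding w_def by (rule cSUP_upper[OF that(1) bdd[OF that(2)]])
  have near: "snd y < T'" if "y \<in> ball z (T' - snd z)" for y z :: "(real ^ 'n) \<times> real" and T'
    using that dist_snd_le[of z y] by (auto simp: dist_real_def)
  have loc: "locally_bdd_above D w"
    unfolding locally_bdd_above_def
  proof
    fix z assume z: "z \<in> D"
    define T' where "T' = (snd z + T) / 2"
    obtain M where M: "\<And>U y. U \<in> S \<Longrightarrow> y \<in> D \<Longrightarrow> snd y < T' \<Longrightarrow> U y \<le> M"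
      using bound[OF Dmid(2)[OF z]] unfolding T'_def by blast
    have "w y \<le> M" if "y \<in> D \<inter> ball z (T' - snd z)" for y
      using that by (intro wle M near) auto
    then have "\<forall>y\<in>D \<inter> ball z (T' - snd z). w y \<le> M" by blast
    moreover have "T' - snd z > 0" using Dmid(1)[OF z] by (simp add: T'_def)
    ultimately show "\<exists>c. \<exists>r>0. \<forall>y\<in>D \<inter> ball z r. w y \<le> c" by blast
  qed
  define u where "u = usc_envelope D w"
  have wu: "w z \<le> u z" if "z \<in> D" for z unfolding u_def by (rule usc_envelope_ge[OF loc that])
  have u_sub: "viscosity_subsolution p Q u"
    unfolding u_def w_def
    by (rule sup_envelope_viscosity_subsolution[OF p oQ QD m \<open>S \<noteq> {}\<close>])
       (use S(2,3) bdd loc[unfolded w_def[abs_def]] in auto)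
  have u_usc: "upper_semicont_on D u" unfolding u_def by (rule upper_semicont_on_usc_envelope[OF loc])
  have u_m: "m \<le> u z" if "z \<in> D" for z
    using Uw[OF \<open>(\<lambda>z. m) \<in> S\<close> that] wu[OF that] by simp
  have h_near: "\<exists>\<delta>>0. \<forall>x t. (x, t) \<in> P \<longrightarrow> norm (x - y) < \<delta> \<longrightarrow> \<bar>t - t0\<bar> < \<delta> \<longrightarrow> \<bar>h (x, t) - h (y, t0)\<bar> < e"
    if yP: "(y, t0) \<in> P" and e: "e > 0" for y t0 e
  proof -
    obtain d where d: "d > 0" "\<And>z. z \<in> P \<Longrightarrow> dist z (y, t0) < d \<Longrightarrow> dist (h z) (h (y, t0)) < e"
      using assms(9) yP e unfolding P_def continuous_on_iff by metis
    have "\<bar>h (x, t) - h (y, t0)\<bar> < e"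
      if "(x, t) \<in> P" "norm (x - y) < d / 2" "\<bar>t - t0\<bar> < d / 2" for x t
    proof -
      have "dist (x, t) (y, t0) \<le> dist x y + dist t t0"
        unfolding dist_Pair_Pair by (intro sqrt_sum_squares_le_sum) auto
      also have "\<dots> < d / 2 + d / 2" using that by (intro add_strict_mono) (auto simp: dist_norm dist_real_def)
      finally show ?thesis using d(2)[OF that(1)] by (simp add: dist_real_def)
    qed
    then show ?thesis using d(1) by (intro exI[of _ "d / 2"]) auto
  qed
  have u_le_h: "u z0 \<le> h z0" if z0: "z0 \<in> P" for z0
  proof (rule field_le_epsilon)
    fix e :: real assume e: "e > 0"
    obtain y t0 where yt: "z0 = (y, t0)" by force
    have yP: "(y, t0) \<in> P" using z0 yt by simp
    \<comment> \<open>\<open>h\<close> is bounded below time \<open>T'\<close>, so there the barrier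
      can be compared with the class. Points of \<open>D\<close> near \<open>z0\<close> have such
      times, and the envelope at \<open>z0\<close> depends only on them.\<close>
    define T' where "T' = (t0 + T) / 2"
    have T': "t0 < T'" "T' < T" using PT[OF yP] by (auto simp: T'_def)
    obtain M0 where M0: "M0 > 0" "\<And>z. z \<in> P \<Longrightarrow> snd z < T' \<Longrightarrow> h z \<le> M0" using bounded_h[OF T'(2)] by blast
    \<comment> \<open>Within \<open>\<delta>\<close> of \<open>z0\<close> the data stay below
      \<open>C\<close>, a lower bound of the barrier; farther away the barrier is at least
      \<open>M\<close>.\<close>
    define C where "C = h (y, t0) + e"
    have C: "C > 0" using mh[OF yP] m e by (simp add: C_def)
    define M where "M = max C M0"
    have CM: "C \<le> M" by (simp add: M_def)
    obtain \<delta> where \<delta>: "\<delta> > 0" "\<And>x t. (x, t) \<in> P \<Longrightarrow> norm (x - y) < \<delta> \<Longrightarrow> \<bar>t - t0\<bar> < \<delta> \<Longrightarrow> \<bar>h (x, t) - h (y, t0)\<bar> < e"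
      using h_near[OF yP e] by blast
    obtain V where V: "continuous_on UNIV V" "viscosity_supersolution p Q V" "V (y, t0) \<le> C"
      "\<And>x t. x \<in> closure \<Omega> \<Longrightarrow> t \<in> {0..T} \<Longrightarrow> C \<le> V (x, t)"
      "\<And>x t. x \<in> closure \<Omega> \<Longrightarrow> t \<in> {0..T} \<Longrightarrow> \<delta> \<le> norm (x - y) \<or> \<delta> \<le> \<bar>t - t0\<bar> \<Longrightarrow> M \<le> V (x, t)"
      using upper_barrier[OF \<Omega> assms(12) p T yP[unfolded P_def] C CM \<delta>(1)] unfolding Q_def by blast
    have UV: "U z \<le> V z" if U: "U \<in> S" and z: "z \<in> D" "snd z < T'" for U z
    proof (rule comparison[OF S(1)[OF U] _ S(5)[OF U] _ S(2)[OF U] V(2) _ _ z])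
      show "lower_semicont_on D V"
        by (rule continuous_on_imp_lower_semicont_on[OF continuous_on_subset[OF V(1)]]) simp
      show "0 < V a" if "a \<in> D" for a using V(4)[of "fst a" "snd a"] that C by (auto simp: D_def)
      show "U a \<le> V a" if a: "a \<in> P" "snd a < T'" for a
      proof -
        have aD: "fst a \<in> closure \<Omega>" "snd a \<in> {0..T}" using a PD by (auto simp: D_def)
        have "h a \<le> V a"
        proof (cases "\<delta> \<le> norm (fst a - y) \<or> \<delta> \<le> \<bar>snd a - t0\<bar>")
          case True
          have "h a \<le> M" using M0(2)[OF a] by (simp add: M_def)
          also have "M \<le> V a" using V(5)[OF aD True] by simp
          finally show ?thesis .
        next
          case False
          then have "\<bar>h a - h (y, t0)\<bar> < e" using \<delta>(2)[of "fst a" "snd a"] a(1) by auto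
          then have "h a \<le> C" by (simp add: C_def abs_less_iff)
          also have "C \<le> V a" using V(4)[OF aD] by simp
          finally show ?thesis .
        qed
        then show ?thesis using S(4)[OF U a(1)] by simp
      qed
    qed (use T' in auto)
    have "u z0 \<le> V z0" unfolding u_def
    proof (rule usc_envelope_le_continuous[of _ _ "T' - snd z0"])
      show "z0 \<in> D" using z0 PD by blast
      show "T' - snd z0 > 0" using T' yt by simp
      show "w a \<le> V a" if "a \<in> D" "a \<in> ball z0 (T' - snd z0)" for a
        using that by (intro wle UV near)
      show "continuous_on (ball z0 (T' - snd z0)) V" by (rule continuous_on_subset[OF V(1)]) simp
    qed
    then show "u z0 \<le> h z0 + e" using V(3) yt by (simp add: C_def)
  qed
  \<comment> \<open>The envelope keeps the boundary inequality, so it belongs to the class and is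
    its largest member.\<close>
  have uS: "u \<in> S" using u_usc u_sub u_m u_le_h by (simp add: S_def)
  have maximal: "U z \<le> u z" if "U \<in> S" "z \<in> D" for U z
    using Uw[OF that] wu[OF that(2)] by simp
  define l where "l = (\<lambda>z. - usc_envelope D (\<lambda>w. - u w) z)"
  have l_super: "viscosity_supersolution p Q l"
    unfolding l_def
  proof (rule maximal_subsolution_is_supersolution[OF p oQ QD m u_usc u_sub u_m])
    fix U z assume "upper_semicont_on D U" "viscosity_subsolution p Q U" "\<And>z. z \<in> D \<Longrightarrow> m \<le> U z"
      and le: "\<And>z. z \<in> D - Q \<Longrightarrow> U z \<le> u z" and z: "z \<in> D"
    \<comment> \<open>Points of \<open>P\<close> lie outside the open cylinder, so a competitor that
      is below \<open>u\<close> there is below \<open>h\<close> and belongs to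
      \<open>S\<close>.\<close>
    moreover have "U a \<le> h a" if "a \<in> P" for a
    proof -
      have "a \<in> D - Q" using that PD \<Omega>(1) by (auto simp: P_def Q_def cylinder_def parabolic_boundary_def frontier_def interior_open)
      then show ?thesis using le u_le_h[OF that] by fastforce
    qed
    ultimately have "U \<in> S" by (simp add: S_def)
    then show "U z \<le> u z" using z by (rule maximal)
  qed
  have loc': "locally_bdd_above D (\<lambda>w. - u w)"
    unfolding locally_bdd_above_def using u_m by (intro ballI exI[of _ "- m"] exI[of _ 1]) auto
  have l_lsc: "lower_semicont_on D l"
    unfolding lower_semicont_on_iff l_def using upper_semicont_on_usc_envelope[OF loc'] by simp
  have lu: "l z \<le> u z" if "z \<in> D" for z
    using usc_envelope_ge[OF loc' that] by (simp add: l_def)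
  have lm: "m \<le> l z" if "z \<in> D" for z
    using usc_envelope_le[OF that zero_less_one, of "\<lambda>w. - u w" "- m"] u_m by (simp add: l_def)
  have h_le_l: "h z0 \<le> l z0" if z0: "z0 \<in> P" for z0
  proof (rule field_le_epsilon)
    fix e' :: real assume e': "e' > 0"
    \<comment> \<open>The cap \<open>m\<close> keeps the barrier height
      \<open>C = h (y, t0) - e\<close> at least \<open>m0 - m = m\<close>, as the lower barrier
      requires.\<close>
    define e where "e = min e' m"
    have e: "e > 0" "e \<le> m" "e \<le> e'" using e' m by (auto simp: e_def)
    obtain y t0 where yt: "z0 = (y, t0)" by force
    have yP: "(y, t0) \<in> P" using z0 yt by simp
    define C where "C = h (y, t0) - e"
    have C: "m \<le> C" using m0h[OF yP] e by (simp add: C_def m_def)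
    obtain \<delta> where \<delta>: "\<delta> > 0" "\<And>x t. (x, t) \<in> P \<Longrightarrow> norm (x - y) < \<delta> \<Longrightarrow> \<bar>t - t0\<bar> < \<delta> \<Longrightarrow> \<bar>h (x, t) - h (y, t0)\<bar> < e"
      using h_near[OF yP e(1)] by blast
    obtain V where V: "continuous_on UNIV V" "viscosity_subsolution p Q V" "C \<le> V (y, t0)" "\<And>z. m \<le> V z"
      "\<And>x t. x \<in> closure \<Omega> \<Longrightarrow> t \<in> {0..T} \<Longrightarrow> V (x, t) \<le> C"
      "\<And>x t. x \<in> closure \<Omega> \<Longrightarrow> t \<in> {0..T} \<Longrightarrow> \<delta> \<le> norm (x - y) \<or> \<delta> \<le> \<bar>t - t0\<bar> \<Longrightarrow> V (x, t) \<le> m"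
      using lower_barrier[OF \<Omega> assms(12) p T yP[unfolded P_def] m C \<delta>(1)] unfolding Q_def by blast
    have "V a \<le> h a" if a: "a \<in> P" for a
    proof -
      have aD: "fst a \<in> closure \<Omega>" "snd a \<in> {0..T}" using a PD by (auto simp: D_def)
      show ?thesis
      proof (cases "\<delta> \<le> norm (fst a - y) \<or> \<delta> \<le> \<bar>snd a - t0\<bar>")
        case True
        have "V a \<le> m" using V(6)[OF aD True] by simp
        also have "m \<le> h a" by (rule mh[OF a])
        finally show ?thesis .
      next
        case False
        have "V a \<le> C" using V(5)[OF aD] by simp
        also have "\<bar>h a - h (y, t0)\<bar> < e" using False \<delta>(2)[of "fst a" "snd a"] a by auto
        then have "C \<le> h a" by (simp add: C_def abs_less_iff)
        finally show ?thesis .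
      qed
    qed
    moreover have "upper_semicont_on D V"
      by (rule continuous_on_imp_upper_semicont_on[OF continuous_on_subset[OF V(1)]]) simp
    \<comment> \<open>Membership puts the continuous barrier below \<open>u\<close> throughout
      \<open>D\<close>, and continuity carries this over to the lower envelope.\<close>
    ultimately have "V \<in> S" using V(2,4) by (simp add: S_def)
    then have "usc_envelope D (\<lambda>w. - u w) z0 \<le> - V z0"
      using maximal z0 PD V(1)
      by (intro usc_envelope_le_continuous[of _ _ 1]) (auto intro!: continuous_intros intro: continuous_on_subset)
    then show "h z0 \<le> l z0 + e'" using V(3) e yt by (simp add: l_def C_def)
  qed
  \<comment> \<open>The two kinds of barriers give \<open>u \<le> h \<le> l\<close> on
    \<open>P\<close>. Comparing the subsolution \<open>u\<close> with the supersolution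
    \<open>l\<close> extends \<open>u \<le> l\<close> to \<open>D\<close>, so the envelopes coincide
    and \<open>u\<close> is continuous.\<close>
  have "u z \<le> l z" if "z \<in> D" for z
  proof (rule comparison[OF u_usc l_lsc _ _ u_sub l_super order_refl _ that])
    show "0 < u a" "0 < l a" if "a \<in> D" for a using u_m[OF that] lm[OF that] m by auto
    show "u a \<le> l a" if "a \<in> P" for a using u_le_h[OF that] h_le_l[OF that] by simp
    show "snd z < T" using that by (auto simp: D_def)
  qed
  then have ul: "u z = l z" if "z \<in> D" for z using lu[OF that] that by (simp add: antisym)
  have u_lsc: "lower_semicont_on D u"
    by (rule lower_semicont_on_cong[OF ul l_lsc])
  have u_super: "viscosity_supersolution p Q u"
    by (rule viscosity_supersolution_cong[OF _ l_super]) (use ul QD in auto)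
  have "positive_viscosity_solution p \<Omega> T h u"
    unfolding positive_viscosity_solution_def Q_def[symmetric] P_def[symmetric] D_eq
  proof (intro conjI ballI)
    show "0 < u z" if "z \<in> D" for z using u_m[OF that] m by simp
    show "continuous_on D u" by (rule continuous_on_if_semicont[OF u_usc u_lsc])
    show "u z = h z" if "z \<in> P" for z
      using u_le_h[OF that] h_le_l[OF that] ul[of z] that PD by auto
  qed (rule u_sub u_super)+
  moreover have "v z = u z"
    if v: "positive_viscosity_solution p \<Omega> T h v" and z: "z \<in> D" for v z
  proof -
    have le: "a z \<le> b z" if a: "positive_viscosity_solution p \<Omega> T h a" and b: "positive_viscosity_solution p \<Omega> T h b" for a b
    proof -
      note ab = a[unfolded positive_viscosity_solution_def Q_def[symmetric] P_def[symmetric] D_eq]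
        b[unfolded positive_viscosity_solution_def Q_def[symmetric] P_def[symmetric] D_eq]
      show ?thesis
      proof (rule comparison[OF _ _ _ _ _ _ order_refl _ z])
        show "upper_semicont_on D a" using ab by (blast intro: continuous_on_imp_upper_semicont_on)
        show "lower_semicont_on D b" using ab by (blast intro: continuous_on_imp_lower_semicont_on)
        show "snd z < T" using z by (auto simp: D_def)
      qed (use ab in auto)
    qed
    show ?thesis using le[OF v \<open>positive_viscosity_solution p \<Omega> T h u\<close>] le[OF \<open>positive_viscosity_solution p \<Omega> T h u\<close> v] by simp
  qed
  ultimately show ?thesis unfolding Q_def[symmetric] P_def[symmetric] D_eq by blast
qed

end
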